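(* Let $\{G_i\}_{i\in\mathbb{N}}$ (with $\mathbb{N}=\{1,2,3,\dots\}$) be a fixed collection of non-trivial finite groups. Let $p=p(n)$ be a function of $n$ with $0<p<1$. For a random graph $\Gamma\in G(n,p)$ on the vertex set $\{1,\dots,n\}$, let $\mathcal{G}_\Gamma=\mathcal{G}(\Gamma,\{G_i\})$ be the associated graph product, in which the vertex $i$ carries the group $G_i$. Then: (1) If $(1-p)n^2\to 0$ as $n\to\infty$, then $\mathcal{G}_\Gamma$ is finite, asymptotically almost surely. (2) If $pn\to 0$ as $n\to\infty$, then $\mathcal{G}_\Gamma$ is (Gromov) hyperbolic, asymptotically almost surely. (3) If $pn\to\infty$ and $(1-p)n^2\to\infty$ as $n\to\infty$, then $\mathcal{G}_\Gamma$ is not (Gromov) hyperbolic, asymptotically almost surely.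
   Context: Graph product: for a finite simplicial graph $\Gamma$ with vertex set $V$ and non-trivial finitely generated groups $\{G_v\}_{v\in V}$, the graph product $\mathcal{G}(\Gamma,\{G_v\})$ is the quotient of the free product of the groups $G_v$ ($v\in V$) by the relations that every element of $G_v$ commutes with every element of $G_w$ whenever $v,w$ are connected by an edge of $\Gamma$. Random graph model (Erdős–Rényi): $G(n,p)$ is the probability space of all graphs on the vertex set $\{1,\dots,n\}$, each edge of the complete graph being included independently with probability $p=p(n)$; thus $\mathrm{Prob}(\Gamma)=p^{E_\Gamma}(1-p)^{\binom n2-E_\Gamma}$, where $E_\Gamma$ is the number of edges of $\Gamma$. A statement about $\Gamma\in G(n,p)$ holds asymptotically almost surely if the probability that it holds tends to $1$ as $n\to\infty$. *)

theory Defs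
  imports "HOL-Probability.Probability" "HOL-Algebra.Algebra"
begin

definition fp_words :: "'v set \<Rightarrow> ('v \<Rightarrow> ('a, 'b) monoid_scheme) \<Rightarrow> ('v \<times> 'a) list set" where
  "fp_words V G = lists (SIGMA v:V. carrier (G v))"

text \<open>The free product is the monoid of words over the disjoint union of the carriers, modulo the
  congruence generated by the identities and the multiplication tables of the factors.\<close>

inductive_set fp_rel ::
  "'v set \<Rightarrow> ('v \<Rightarrow> ('a, 'b) monoid_scheme) \<Rightarrow> (('v \<times> 'a) list \<times> ('v \<times> 'a) list) set"
  for V :: "'v set" and G :: "'v \<Rightarrow> ('a, 'b) monoid_scheme" where
  unit: "\<lbrakk>xs \<in> fp_words V G; ys \<in> fp_words V G; v \<in> V\<rbrakk>
    \<Longrightarrow> (xs @ [(v, \<one>\<^bsub>G v\<^esub>)] @ ys, xs @ ys) \<in> fp_rel V G"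
| mult: "\<lbrakk>xs \<in> fp_words V G; ys \<in> fp_words V G; v \<in> V; g \<in> carrier (G v); h \<in> carrier (G v)\<rbrakk>
    \<Longrightarrow> (xs @ [(v, g), (v, h)] @ ys, xs @ [(v, g \<otimes>\<^bsub>G v\<^esub> h)] @ ys) \<in> fp_rel V G"
| refl: "xs \<in> fp_words V G \<Longrightarrow> (xs, xs) \<in> fp_rel V G"
| sym: "(xs, ys) \<in> fp_rel V G \<Longrightarrow> (ys, xs) \<in> fp_rel V G"
| trans: "\<lbrakk>(xs, ys) \<in> fp_rel V G; (ys, zs) \<in> fp_rel V G\<rbrakk> \<Longrightarrow> (xs, zs) \<in> fp_rel V G"

definition free_product ::
  "'v set \<Rightarrow> ('v \<Rightarrow> ('a, 'b) monoid_scheme) \<Rightarrow> ('v \<times> 'a) list set monoid" where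
  "free_product V G =
     \<lparr>carrier = fp_words V G // fp_rel V G,
      mult = (\<lambda>A B. \<Union>x\<in>A. \<Union>y\<in>B. fp_rel V G `` {x @ y}),
      one = fp_rel V G `` {[]}\<rparr>"

definition fp_inj ::
  "'v set \<Rightarrow> ('v \<Rightarrow> ('a, 'b) monoid_scheme) \<Rightarrow> 'v \<Rightarrow> 'a \<Rightarrow> ('v \<times> 'a) list set" where
  "fp_inj V G v g = fp_rel V G `` {[(v, g)]}"

definition normal_closure :: "('a, 'b) monoid_scheme \<Rightarrow> 'a set \<Rightarrow> 'a set" where
  "normal_closure F R = \<Inter>{N. N \<lhd> F \<and> R \<subseteq> N}"

definition commutator :: "('a, 'b) monoid_scheme \<Rightarrow> 'a \<Rightarrow> 'a \<Rightarrow> 'a" where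
  "commutator F x y = x \<otimes>\<^bsub>F\<^esub> y \<otimes>\<^bsub>F\<^esub> inv\<^bsub>F\<^esub> x \<otimes>\<^bsub>F\<^esub> inv\<^bsub>F\<^esub> y"

text \<open>A simple graph is given by its vertex set \<open>V\<close> and its set \<open>E\<close> of edges, which are two-element
  subsets of \<open>V\<close>.\<close>

definition graph_product_relators ::
  "'v set \<Rightarrow> 'v set set \<Rightarrow> ('v \<Rightarrow> ('a, 'b) monoid_scheme) \<Rightarrow> ('v \<times> 'a) list set set" where
  "graph_product_relators V E G =
     {commutator (free_product V G) (fp_inj V G v g) (fp_inj V G w h) | v w g h.
        v \<in> V \<and> w \<in> V \<and> {v, w} \<in> E \<and> g \<in> carrier (G v) \<and> h \<in> carrier (G w)}"

definition graph_product ::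
  "'v set \<Rightarrow> 'v set set \<Rightarrow> ('v \<Rightarrow> ('a, 'b) monoid_scheme) \<Rightarrow> ('v \<times> 'a) list set set monoid" where
  "graph_product V E G =
     free_product V G Mod normal_closure (free_product V G) (graph_product_relators V E G)"

definition gromov_product :: "('a \<Rightarrow> 'a \<Rightarrow> real) \<Rightarrow> 'a \<Rightarrow> 'a \<Rightarrow> 'a \<Rightarrow> real" where
  "gromov_product d w x y = (d x w + d y w - d x y) / 2"

definition gromov_hyperbolic_space :: "'a set \<Rightarrow> ('a \<Rightarrow> 'a \<Rightarrow> real) \<Rightarrow> bool" where
  "gromov_hyperbolic_space M d \<longleftrightarrow> Metric_space M d \<and>
     (\<exists>\<delta>. \<forall>w\<in>M. \<forall>x\<in>M. \<forall>y\<in>M. \<forall>z\<in>M.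
        gromov_product d w x z \<ge> min (gromov_product d w x y) (gromov_product d w y z) - \<delta>)"

definition word_length :: "('a, 'b) monoid_scheme \<Rightarrow> 'a set \<Rightarrow> 'a \<Rightarrow> nat" where
  "word_length G S g =
     (LEAST n. \<exists>ss. length ss = n \<and> set ss \<subseteq> S \<union> (\<lambda>s. inv\<^bsub>G\<^esub> s) ` S \<and>
                    foldr (\<otimes>\<^bsub>G\<^esub>) ss \<one>\<^bsub>G\<^esub> = g)"

text \<open>The path metric of the Cayley graph on its vertices. The value outside the carrier is fixed
  because \<open>Metric_space\<close> demands symmetry and nonnegativity for all arguments.\<close>

definition word_dist :: "('a, 'b) monoid_scheme \<Rightarrow> 'a set \<Rightarrow> 'a \<Rightarrow> 'a \<Rightarrow> real" where
  "word_dist G S g h =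
     (if g \<in> carrier G \<and> h \<in> carrier G then real (word_length G S (inv\<^bsub>G\<^esub> g \<otimes>\<^bsub>G\<^esub> h)) else 0)"

text \<open>Gromov's definition for finitely generated groups. By quasi-isometry invariance, hyperbolicity
  for some finite generating set is the same as for all of them.\<close>

definition hyperbolic_group :: "('a, 'b) monoid_scheme \<Rightarrow> bool" where
  "hyperbolic_group G \<longleftrightarrow> group G \<and>
     (\<exists>S. finite S \<and> S \<subseteq> carrier G \<and> generate G S = carrier G \<and>
          gromov_hyperbolic_space (carrier G) (word_dist G S))"

definition all_edges :: "nat \<Rightarrow> nat set set" where
  "all_edges n = {e. e \<subseteq> {1..n} \<and> card e = 2}"

text \<open>A graph on \<open>{1..n}\<close> is identified with its edge set.\<close>

definition random_graph :: "nat \<Rightarrow> real \<Rightarrow> nat set set pmf" where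
  "random_graph n p =
     map_pmf (\<lambda>f. {e. f e}) (Pi_pmf (all_edges n) False (\<lambda>_. bernoulli_pmf p))"

definition asymptotically_almost_surely ::
  "(nat \<Rightarrow> real) \<Rightarrow> (nat \<Rightarrow> nat set set \<Rightarrow> bool) \<Rightarrow> bool" where
  "asymptotically_almost_surely p P \<longleftrightarrow>
     (\<lambda>n. measure_pmf.prob (random_graph n (p n)) {E. P n E}) \<longlonglongrightarrow> 1"

lemma finite_all_edges: "finite (all_edges n)"
  by (rule finite_subset[of _ "Pow {1..n}"]) (auto simp: all_edges_def)

lemma card_all_edges: "card (all_edges n) = n choose 2"
  using n_subsets[of "{1..n}" 2] by (simp add: all_edges_def)

lemma pmf_random_graph:
  assumes "0 \<le> p" "p \<le> 1" "E \<subseteq> all_edges n"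
  shows "pmf (random_graph n p) E = p ^ card E * (1 - p) ^ ((n choose 2) - card E)"
proof -
  have inj: "inj (\<lambda>f::nat set \<Rightarrow> bool. {e. f e})"
    by (auto simp: inj_def fun_eq_iff)
  have fin: "finite E"
    using assms(3) finite_all_edges finite_subset by blast
  have "pmf (random_graph n p) E =
      pmf (Pi_pmf (all_edges n) False (\<lambda>_. bernoulli_pmf p)) (\<lambda>e. e \<in> E)"
    unfolding random_graph_def using pmf_map_inj'[OF inj, of _ "\<lambda>e. e \<in> E"] by simp
  also have "\<dots> = (\<Prod>e\<in>all_edges n. pmf (bernoulli_pmf p) (e \<in> E))"
    using assms(3) by (intro pmf_Pi' finite_all_edges) auto
  also have "\<dots> = (\<Prod>e\<in>all_edges n. if e \<in> E then p else 1 - p)"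
    using assms by (intro prod.cong) auto
  also have "\<dots> = p ^ card E * (1 - p) ^ card (all_edges n - E)"
    using assms(3) by (simp add: prod.If_cases finite_all_edges Int_absorb1 Diff_eq)
  finally show ?thesis
    using assms(3) fin by (simp add: card_Diff_subset card_all_edges)
qed

lemma fp_words_append:
  "\<lbrakk>xs \<in> fp_words V G; ys \<in> fp_words V G\<rbrakk> \<Longrightarrow> xs @ ys \<in> fp_words V G"
  by (simp add: fp_words_def)

lemma fp_rel_words:
  assumes "\<And>v. v \<in> V \<Longrightarrow> group (G v)" and "(xs, ys) \<in> fp_rel V G"
  shows "xs \<in> fp_words V G \<and> ys \<in> fp_words V G"
  using assms(2)
  by induction (auto simp: fp_words_def assms(1) group.is_monoid monoid.m_closed)

lemma equiv_fp_rel: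
  assumes "\<And>v. v \<in> V \<Longrightarrow> group (G v)"
  shows "equiv (fp_words V G) (fp_rel V G)"
proof (rule equivI)
  show "fp_rel V G \<subseteq> fp_words V G \<times> fp_words V G"
    using fp_rel_words[of V G] assms by auto
qed (auto intro!: refl_onI symI transI intro: fp_rel.refl fp_rel.sym fp_rel.trans)

lemma fp_rel_append_left:
  assumes "(xs, ys) \<in> fp_rel V G" "zs \<in> fp_words V G"
  shows "(zs @ xs, zs @ ys) \<in> fp_rel V G"
  using assms
proof induction
  case (unit xs ys v)
  then show ?case using fp_rel.unit[of "zs @ xs" V G ys v] by (simp add: fp_words_append)
next
  case (mult xs ys v g h)
  then show ?case using fp_rel.mult[of "zs @ xs" V G ys v g h] by (simp add: fp_words_append)
qed (auto intro: fp_rel.refl fp_rel.sym fp_rel.trans simp: fp_words_append)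

lemma fp_rel_append_right:
  assumes "(xs, ys) \<in> fp_rel V G" "zs \<in> fp_words V G"
  shows "(xs @ zs, ys @ zs) \<in> fp_rel V G"
  using assms
proof induction
  case (unit xs ys v)
  then show ?case using fp_rel.unit[of xs V G "ys @ zs" v] by (simp add: fp_words_append)
next
  case (mult xs ys v g h)
  then show ?case using fp_rel.mult[of xs V G "ys @ zs" v g h] by (simp add: fp_words_append)
qed (auto intro: fp_rel.refl fp_rel.sym fp_rel.trans simp: fp_words_append)

lemma free_product_mult:
  assumes G: "\<And>v. v \<in> V \<Longrightarrow> group (G v)" and xs: "xs \<in> fp_words V G" and ys: "ys \<in> fp_words V G"
  shows "fp_rel V G `` {xs} \<otimes>\<^bsub>free_product V G\<^esub> fp_rel V G `` {ys} = fp_rel V G `` {xs @ ys}"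
proof -
  have eq: "equiv (fp_words V G) (fp_rel V G)"
    using equiv_fp_rel G by blast
  have words: "xs \<in> fp_words V G \<and> ys \<in> fp_words V G" if "(xs, ys) \<in> fp_rel V G" for xs ys
    using fp_rel_words[of V G] G that by blast
  have cong: "congruent2 (fp_rel V G) (fp_rel V G) (\<lambda>x y. fp_rel V G `` {x @ y})"
  proof (rule congruent2I')
    fix x x' y y'
    assume "(x, x') \<in> fp_rel V G" "(y, y') \<in> fp_rel V G"
    then have "(x @ y, x' @ y') \<in> fp_rel V G"
      using words fp_rel_append_left fp_rel_append_right fp_rel.trans by metis
    then show "fp_rel V G `` {x @ y} = fp_rel V G `` {x' @ y'}"
      using equiv_class_eq[OF eq] by simp
  qed
  show ?thesis
    using UN_equiv_class2[OF eq eq cong xs ys] by (simp add: free_product_def)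
qed

lemma group_free_product:
  assumes G: "\<And>v. v \<in> V \<Longrightarrow> group (G v)"
  shows "group (free_product V G)"
proof -
  let ?F = "free_product V G" and ?c = "\<lambda>xs. fp_rel V G `` {xs}"
  have mult: "?c xs \<otimes>\<^bsub>?F\<^esub> ?c ys = ?c (xs @ ys)"
    if "xs \<in> fp_words V G" "ys \<in> fp_words V G" for xs ys
    using free_product_mult[of V G xs ys] G that by blast
  have eq: "equiv (fp_words V G) (fp_rel V G)"
    using equiv_fp_rel G by blast
  have car: "carrier ?F = ?c ` fp_words V G" and one: "\<one>\<^bsub>?F\<^esub> = ?c []"
    by (auto simp: free_product_def quotient_def)
  have nil: "[] \<in> fp_words V G"
    by (simp add: fp_words_def)
  have linv: "\<exists>ys \<in> fp_words V G. (ys @ xs, []) \<in> fp_rel V G" if "xs \<in> fp_words V G" for xs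
    using that
  proof (induction xs)
    case Nil
    then show ?case using fp_rel.refl by fastforce
  next
    case (Cons a xs)
    obtain v g where a: "a = (v, g)" "v \<in> V" "g \<in> carrier (G v)"
      using Cons.prems by (auto simp: fp_words_def)
    have xs: "xs \<in> fp_words V G"
      using Cons.prems by (auto simp: fp_words_def)
    with Cons.IH obtain ys where ys: "ys \<in> fp_words V G" "(ys @ xs, []) \<in> fp_rel V G"
      by blast
    define h where "h = inv\<^bsub>G v\<^esub> g"
    have h: "h \<in> carrier (G v)" "h \<otimes>\<^bsub>G v\<^esub> g = \<one>\<^bsub>G v\<^esub>"
      using a G unfolding h_def by (auto simp: group.l_inv)
    have "(ys @ [(v, h), (v, g)] @ xs, ys @ [(v, \<one>\<^bsub>G v\<^esub>)] @ xs) \<in> fp_rel V G"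
      using fp_rel.mult[of ys V G xs v h g] ys xs a h by simp
    moreover have "(ys @ [(v, \<one>\<^bsub>G v\<^esub>)] @ xs, ys @ xs) \<in> fp_rel V G"
      using fp_rel.unit[of ys V G xs v] ys xs a by simp
    ultimately have "((ys @ [(v, h)]) @ a # xs, []) \<in> fp_rel V G"
      using ys(2) a by (simp) (meson fp_rel.trans)
    moreover have "ys @ [(v, h)] \<in> fp_words V G"
      using ys(1) a h by (auto simp: fp_words_def)
    ultimately show ?case by blast
  qed
  show ?thesis
  proof (rule groupI)
    fix x assume "x \<in> carrier ?F"
    then obtain xs where xs: "x = ?c xs" "xs \<in> fp_words V G" by (auto simp: car)
    obtain ys where ys: "ys \<in> fp_words V G" "(ys @ xs, []) \<in> fp_rel V G"
      using linv[OF xs(2)] by blast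
    have "?c ys \<otimes>\<^bsub>?F\<^esub> x = \<one>\<^bsub>?F\<^esub>"
      using mult[OF ys(1) xs(2)] equiv_class_eq[OF eq ys(2)]
      by (simp add: xs one)
    then show "\<exists>y \<in> carrier ?F. y \<otimes>\<^bsub>?F\<^esub> x = \<one>\<^bsub>?F\<^esub>"
      using ys car by blast
  qed (auto simp: car one mult fp_words_append nil)
qed

lemma normal_normal_closure:
  assumes "group F" "R \<subseteq> carrier F"
  shows "normal_closure F R \<lhd> F"
proof -
  interpret group F by fact
  have "carrier F \<lhd> F"
    by (simp add: normal_inv_iff subgroup_self)
  then have ne: "{N. N \<lhd> F \<and> R \<subseteq> N} \<noteq> {}"
    using assms(2) by blast
  have "subgroup (normal_closure F R) F"
    unfolding normal_closure_def
    by (rule subgroups_Inter[OF _ ne]) (auto simp: normal_imp_subgroup)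
  then show ?thesis
    unfolding normal_inv_iff
    by (auto simp: normal_closure_def normal.inv_op_closed2)
qed

lemma group_graph_product:
  assumes G: "\<And>v. v \<in> V \<Longrightarrow> group (G v)"
  shows "group (graph_product V E G)"
proof -
  interpret F: group "free_product V G"
    using group_free_product G by blast
  have "fp_inj V G v g \<in> carrier (free_product V G)" if "v \<in> V" "g \<in> carrier (G v)" for v g
    using that by (auto simp: fp_inj_def free_product_def fp_words_def intro!: quotientI)
  then have "graph_product_relators V E G \<subseteq> carrier (free_product V G)"
    by (auto simp: graph_product_relators_def commutator_def)
  then show ?thesis
    unfolding graph_product_def
    by (intro normal.factorgroup_is_group normal_normal_closure F.is_group)
qed

lemma Metric_space_word_dist:
  fixes G (structure)
  assumes "group G" "S \<subseteq> carrier G" "generate G S = carrier G"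
  shows "Metric_space (carrier G) (word_dist G S)"
proof -
  interpret group G by fact
  let ?T = "S \<union> (\<lambda>s. inv s) ` S" and ?P = "\<lambda>ss. foldr (\<otimes>) ss \<one>"
  have T: "?T \<subseteq> carrier G" using assms(2) by auto
  have Pc: "?P ss \<in> carrier G" if "set ss \<subseteq> ?T" for ss
    using that
  proof (induction ss)
    case (Cons a ss)
    then have "a \<in> carrier G" "?P ss \<in> carrier G" using T by auto
    then show ?case by simp
  qed simp
  have Papp: "?P (ss @ ts) = ?P ss \<otimes> ?P ts" if "set ss \<subseteq> ?T" "set ts \<subseteq> ?T" for ss ts
    using that(1)
  proof (induction ss)
    case (Cons a ss)
    then have "a \<in> carrier G" "set ss \<subseteq> ?T" using T by auto
    then show ?case using Cons Pc[of ss] Pc[OF that(2)] by (simp add: m_assoc)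
  qed (use Pc[OF that(2)] in simp)
  have Pinv: "\<exists>ts. set ts \<subseteq> ?T \<and> length ts = length ss \<and> ?P ts = inv (?P ss)"
    if "set ss \<subseteq> ?T" for ss
    using that
  proof (induction ss)
    case (Cons a ss)
    then have a: "a \<in> ?T" "a \<in> carrier G" and ss: "set ss \<subseteq> ?T" using T by auto
    obtain ts where ts: "set ts \<subseteq> ?T" "length ts = length ss" "?P ts = inv (?P ss)"
      using Cons ss by blast
    have ia: "inv a \<in> ?T" using a assms(2) by auto
    have "?P (ts @ [inv a]) = ?P ts \<otimes> inv a"
      using Papp[OF ts(1), of "[inv a]"] ia a(2) by simp
    then have "?P (ts @ [inv a]) = inv (?P (a # ss))"
      using Pc[OF ss] a(2) ts(3) by (simp add: inv_mult_group)
    then show ?case using ts ia by (intro exI[of _ "ts @ [inv a]"]) auto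
  qed simp
  have ex: "\<exists>ss. set ss \<subseteq> ?T \<and> ?P ss = g" if "g \<in> carrier G" for g
  proof -
    have "g \<in> generate G S" using that assms(3) by simp
    then show ?thesis
    proof induction
      case one show ?case by (intro exI[of _ "[]"]) auto
    next
      case (incl h) then show ?case using assms(2) by (intro exI[of _ "[h]"]) auto
    next
      case (inv h) then show ?case using assms(2) by (intro exI[of _ "[inv h]"]) auto
    next
      case (eng h1 h2)
      then obtain s t where "set s \<subseteq> ?T" "?P s = h1" "set t \<subseteq> ?T" "?P t = h2" by blast
      then show ?case using Papp[of s t] by (intro exI[of _ "s @ t"]) auto
    qed
  qed
  have le: "word_length G S g \<le> length ss" if "set ss \<subseteq> ?T" "?P ss = g" for g ss
    unfolding word_length_def by (rule Least_le) (use that in blast)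
  have wit: "\<exists>ss. length ss = word_length G S g \<and> set ss \<subseteq> ?T \<and> ?P ss = g"
    if g: "g \<in> carrier G" for g
    unfolding word_length_def by (rule LeastI_ex) (use ex[OF g] in blast)
  have linv: "word_length G S (inv g) \<le> word_length G S g" if "g \<in> carrier G" for g
    using wit[OF that] Pinv le by metis
  have lmult: "word_length G S (g \<otimes> h) \<le> word_length G S g + word_length G S h"
    if gh: "g \<in> carrier G" "h \<in> carrier G" for g h
  proof -
    obtain s t where s: "length s = word_length G S g" "set s \<subseteq> ?T" "?P s = g"
      and t: "length t = word_length G S h" "set t \<subseteq> ?T" "?P t = h"
      using wit gh by meson
    have "word_length G S (g \<otimes> h) \<le> length (s @ t)"
      using Papp[OF s(2) t(2)] s t by (intro le) auto
    then show ?thesis using s t by simp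
  qed
  have l0: "word_length G S g = 0 \<longleftrightarrow> g = \<one>" if "g \<in> carrier G" for g
    using wit[OF that] le[of "[]" \<one>] by auto
  show ?thesis
  proof
    fix x y show "word_dist G S x y \<ge> 0" by (simp add: word_dist_def)
    show "word_dist G S x y = word_dist G S y x"
    proof (cases "x \<in> carrier G \<and> y \<in> carrier G")
      case True
      then have "inv (inv x \<otimes> y) = inv y \<otimes> x" "inv (inv y \<otimes> x) = inv x \<otimes> y"
        by (simp_all add: inv_mult_group)
      then show ?thesis
        using linv[of "inv x \<otimes> y"] linv[of "inv y \<otimes> x"] True by (simp add: word_dist_def)
    qed (auto simp: word_dist_def)
  next
    fix x y assume xy: "x \<in> carrier G" "y \<in> carrier G"
    have "inv x \<otimes> y = \<one> \<longleftrightarrow> x = y"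
      using xy inv_equality inv_comm by (metis inv_closed inv_inv l_inv)
    then show "word_dist G S x y = 0 \<longleftrightarrow> x = y"
      using xy l0[of "inv x \<otimes> y"] by (simp add: word_dist_def)
  next
    fix x y z assume xyz: "x \<in> carrier G" "y \<in> carrier G" "z \<in> carrier G"
    have "(inv x \<otimes> y) \<otimes> (inv y \<otimes> z) = inv x \<otimes> z"
      using xyz by (simp add: m_assoc[symmetric] r_inv) (simp add: m_assoc)
    then show "word_dist G S x z \<le> word_dist G S x y + word_dist G S y z"
      using xyz lmult[of "inv x \<otimes> y" "inv y \<otimes> z"] by (simp add: word_dist_def)
  qed
qed

end

theory Submission
  imports Defs "HOL-Library.Sublist"
begin

text \<open>A graph product of finite groups is finite over a complete graph, hyperbolic over a forest, and not
  hyperbolic over a graph with an induced square. The three hypotheses make a complete graph, a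
  forest, and an induced square asymptotically almost certain, by union bounds over non-edges and
  over cycles, and by the second moment method.

  Over a forest, adding a vertex with at most one neighbour amalgamates over a finite group. The
  normal forms of the amalgam are geodesic and change only within a bounded distance of their end
  under right multiplication by a letter, so that the length of the common prefix, which is
  ultrametric, approximates the Gromov product. Over an induced square, two nontrivial elements of
  opposite vertex groups multiply to an element of infinite order, and the two diagonals yield an
  undistorted copy of \<open>\<int>\<^sup>2\<close>. The stable length on it is a norm that satisfies the four-point
  condition with constant 0, which is impossible in dimension 2.\<close>

section \<open>Word metrics and prefix-stable normal forms\<close>

text \<open>Two obstacles shape the proof. A graph product is a quotient of a quotient of words, so
  that distinctness of elements cannot be read off. Every lower bound on word length therefore comes
  from a right action on a set of words that respects the relations, as in van der Waerden's
  argument for free products: an action on the normal forms over a forest, and one on the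
  alternating words in two opposite vertex groups of a square. Moreover, hyperbolicity asks for some
  finite generating set. The positive part may choose it, and takes all elements of the vertex
  groups; the negative part must refute every choice, so its distortion constant depends on the
  generating set.

  The normal forms over a forest are built for growing vertex sets \<open>U\<close> inside the fixed
  group over \<open>V\<close>, so that no graph products of smaller graphs have to be compared.
  Squares are sought only with corners of residues 1, 2, 3, 0 modulo 4 in cyclic order. This costs a
  constant factor in their number and makes the dependence between two squares a matter of comparing
  coordinates.\<close>

lemma (in group) foldr_mult_closed:
  "set ss \<subseteq> carrier G \<Longrightarrow> foldr (\<otimes>) ss \<one> \<in> carrier G"
  by (induction ss) auto

lemma (in group) foldr_mult_append:
  "set ss \<subseteq> carrier G \<Longrightarrow> set ts \<subseteq> carrier G \<Longrightarrow>
     foldr (\<otimes>) (ss @ ts) \<one> = foldr (\<otimes>) ss \<one> \<otimes> foldr (\<otimes>) ts \<one>"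
  by (induction ss) (auto simp: foldr_mult_closed m_assoc)

lemma (in group) generate_imp_word:
  assumes "S \<subseteq> carrier G" "g \<in> generate G S"
  shows "\<exists>ss. set ss \<subseteq> S \<union> (\<lambda>s. inv s) ` S \<and> foldr (\<otimes>) ss \<one> = g"
  using assms(2)
proof induction
  case one
  show ?case by (intro exI[of _ "[]"]) auto
next
  case (incl h)
  then show ?case using assms(1) by (intro exI[of _ "[h]"]) auto
next
  case (inv h)
  then show ?case using assms(1) by (intro exI[of _ "[inv h]"]) auto
next
  case (eng h1 h2)
  then obtain s t where "set s \<subseteq> S \<union> (\<lambda>s. inv s) ` S" "foldr (\<otimes>) s \<one> = h1"
    "set t \<subseteq> S \<union> (\<lambda>s. inv s) ` S" "foldr (\<otimes>) t \<one> = h2" by blast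
  moreover from this have "set s \<subseteq> carrier G" "set t \<subseteq> carrier G"
    using assms(1) by auto
  ultimately show ?case
    using foldr_mult_append[of s t] by (intro exI[of _ "s @ t"]) auto
qed

lemma (in group) word_length_witness:
  assumes "S \<subseteq> carrier G" "g \<in> generate G S"
  shows "\<exists>ss. length ss = word_length G S g \<and> set ss \<subseteq> S \<union> (\<lambda>s. inv s) ` S \<and>
    foldr (\<otimes>) ss \<one> = g"
  unfolding word_length_def by (rule LeastI_ex) (use generate_imp_word[OF assms] in blast)

lemma word_length_le:
  assumes "set ss \<subseteq> S \<union> (\<lambda>s. inv\<^bsub>G\<^esub> s) ` S" "foldr (\<otimes>\<^bsub>G\<^esub>) ss \<one>\<^bsub>G\<^esub> = g"
  shows "word_length G S g \<le> length ss"
  unfolding word_length_def by (rule Least_le) (use assms in blast)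

locale generated_group = group G for G (structure) +
  fixes S
  assumes S_carrier: "S \<subseteq> carrier G" and generate_S: "generate G S = carrier G"
begin

abbreviation len :: "'a \<Rightarrow> nat" where "len \<equiv> word_length G S"

abbreviation letters :: "'a set" where "letters \<equiv> S \<union> (\<lambda>s. inv s) ` S"

lemma letters_carrier: "letters \<subseteq> carrier G"
  using S_carrier by auto

lemma metric: "Metric_space (carrier G) (word_dist G S)"
  using Metric_space_word_dist[OF is_group S_carrier generate_S] .

lemma word_dist_eq:
  "g \<in> carrier G \<Longrightarrow> h \<in> carrier G \<Longrightarrow> word_dist G S g h = real (len (inv g \<otimes> h))"
  by (simp add: word_dist_def)

lemma len_witness:
  assumes "g \<in> carrier G"
  obtains ss where "length ss = len g" "set ss \<subseteq> letters" "foldr (\<otimes>) ss \<one> = g"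
  using word_length_witness[OF S_carrier, of g] assms generate_S by blast

lemma len_one: "len \<one> = 0"
  using word_length_le[of "[]" S G "\<one>"] by simp

lemma len_letter: "s \<in> letters \<Longrightarrow> len s \<le> 1"
  using word_length_le[of "[s]" S G s] letters_carrier by auto

lemma len_inv:
  assumes "g \<in> carrier G" shows "len (inv g) = len g"
proof -
  have "word_dist G S g \<one> = word_dist G S \<one> g"
    using metric by (rule Metric_space.commute)
  then show ?thesis using assms by (simp add: word_dist_eq)
qed

lemma len_mult:
  assumes "g \<in> carrier G" "h \<in> carrier G"
  shows "len (g \<otimes> h) \<le> len g + len h"
proof -
  have "word_dist G S \<one> (g \<otimes> h) \<le> word_dist G S \<one> g + word_dist G S g (g \<otimes> h)"
    using assms by (intro Metric_space.triangle[OF metric]) auto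
  then have "real (len (g \<otimes> h)) \<le> real (len g) + real (len (inv g \<otimes> (g \<otimes> h)))"
    using assms by (simp add: word_dist_eq)
  then show ?thesis using assms by (simp add: m_assoc[symmetric])
qed

text \<open>A normal form whose words are geodesic and change only within distance \<open>C\<close> of their end when
  a letter is multiplied on the right turns the length of the longest common prefix, which is
  ultrametric, into the Gromov product up to the error \<open>C\<close>.\<close>

lemma hyperbolic_if_prefix_stable:
  fixes nf :: "'a \<Rightarrow> 'c list"
  assumes le: "\<And>g. g \<in> carrier G \<Longrightarrow> length (nf g) \<le> len g"
    and dist: "\<And>g h z u w. \<lbrakk>g \<in> carrier G; h \<in> carrier G; nf g = z @ u; nf h = z @ w\<rbrakk>
      \<Longrightarrow> len (inv g \<otimes> h) \<le> length u + length w"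
    and step: "\<And>g s. \<lbrakk>g \<in> carrier G; s \<in> letters\<rbrakk>
      \<Longrightarrow> \<exists>z. prefix z (nf g) \<and> prefix z (nf (g \<otimes> s)) \<and> length (nf g) \<le> length z + C"
  shows "gromov_hyperbolic_space (carrier G) (word_dist G S)"
proof -
  define c where "c g h = length (longest_common_prefix (nf g) (nf h))" for g h
  have c_pre: "\<exists>z. length z = c g h \<and> prefix z (nf g) \<and> prefix z (nf h)" for g h
    unfolding c_def using longest_common_prefix_prefix1 longest_common_prefix_prefix2 by blast
  have c_max: "length z \<le> c g h" if "prefix z (nf g)" "prefix z (nf h)" for z g h
    unfolding c_def using longest_common_prefix_max_prefix[OF that] prefix_length_le by blast
  have c_sym: "c g h = c h g" for g h
    using c_pre[of g h] c_pre[of h g] c_max by (metis order_antisym)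
  have c_ultra: "min (c g k) (c k h) \<le> c g h" for g h k
  proof -
    obtain z where z: "length z = c g k" "prefix z (nf g)" "prefix z (nf k)" using c_pre by blast
    obtain y where y: "length y = c k h" "prefix y (nf k)" "prefix y (nf h)" using c_pre by blast
    show ?thesis
    proof (cases "length z \<le> length y")
      case True
      then have "prefix z y" using z y prefix_length_prefix by blast
      then have "prefix z (nf h)" using y by (meson prefix_order.trans)
      then show ?thesis using c_max[of z g h] z y by auto
    next
      case False
      then have "prefix y z" using z y prefix_length_prefix by (metis nat_le_linear)
      then have "prefix y (nf g)" using z by (meson prefix_order.trans)
      then show ?thesis using c_max[of y g h] z y by auto
    qed
  qed
  have nf1: "nf \<one> = []" using le[of \<one>] len_one by simp
  have len_nf: "len g = length (nf g)" if "g \<in> carrier G" for g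
    using dist[of \<one> g "[]" "[]" "nf g"] le[OF that] that nf1 by simp
  have upper: "len (inv g \<otimes> h) + 2 * c g h \<le> len g + len h"
    if gh: "g \<in> carrier G" "h \<in> carrier G" for g h
  proof -
    obtain z u w where "length z = c g h" "nf g = z @ u" "nf h = z @ w"
      using c_pre[of g h] by (auto simp: prefix_def)
    then show ?thesis using dist[OF gh, of z u w] len_nf gh by simp
  qed
  \<comment> \<open>Induction along a path from \<open>g\<close> to \<open>h\<close>, with
    \<open>g'\<close> the next vertex. If \<open>g'\<close> shares at most as much with
    \<open>h\<close> as with \<open>g\<close>, then \<open>c g' h\<close> is at most
    \<open>c g h\<close>, and the bound for \<open>g'\<close> carries over. Otherwise
    \<open>c g g'\<close>, which is at least \<open>len g - C\<close>, is at most
    \<open>c g h\<close>, and \<open>len h\<close> exceeds \<open>len g\<close> at most by the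
    length of the path.\<close>
  have lower: "len g + len (g \<otimes> foldr (\<otimes>) ss \<one>) \<le> length ss + 2 * c g (g \<otimes> foldr (\<otimes>) ss \<one>) + 2 * C"
    if "g \<in> carrier G" "set ss \<subseteq> letters" for g ss
    using that
  proof (induction ss arbitrary: g)
    case Nil
    have "length (nf g) \<le> c g g" using c_max[of "nf g" g g] by simp
    then show ?case using Nil len_nf by simp
  next
    case (Cons s ss)
    have s: "s \<in> letters" "s \<in> carrier G" and ss: "set ss \<subseteq> letters" "set ss \<subseteq> carrier G"
      using Cons.prems letters_carrier by auto
    define g' where "g' = g \<otimes> s"
    define h where "h = g' \<otimes> foldr (\<otimes>) ss \<one>"
    have P: "foldr (\<otimes>) ss \<one> \<in> carrier G" using ss foldr_mult_closed by blast
    have h: "h = g \<otimes> foldr (\<otimes>) (s # ss) \<one>"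
      using P s Cons.prems by (simp add: h_def g'_def m_assoc)
    have g': "g' \<in> carrier G" using s Cons.prems by (simp add: g'_def)
    have IH: "len g' + len h \<le> length ss + 2 * c g' h + 2 * C"
      using Cons.IH[OF g' ss(1)] by (simp add: h_def)
    have "g = g' \<otimes> inv s" using s Cons.prems by (simp add: g'_def m_assoc)
    then have gg': "len g \<le> len g' + 1"
      using len_mult[OF g', of "inv s"] s len_inv[OF s(2)] len_letter[OF s(1)] by simp
    have lP: "len (foldr (\<otimes>) (s # ss) \<one>) \<le> length (s # ss)"
      by (rule word_length_le[OF Cons.prems(2) HOL.refl])
    have hg: "len h \<le> len g + length (s # ss)"
      unfolding h using len_mult[OF Cons.prems(1), of "foldr (\<otimes>) (s # ss) \<one>"] lP P s
      by simp
    obtain z where "prefix z (nf g)" "prefix z (nf g')" "length (nf g) \<le> length z + C"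
      using step[OF Cons.prems(1) s(1)] unfolding g'_def by blast
    then have cg: "len g \<le> c g g' + C" using c_max[of z g g'] len_nf Cons.prems(1) by fastforce
    have "len g + len h \<le> length (s # ss) + 2 * c g h + 2 * C"
    proof (cases "c g' h \<le> c g g'")
      case True
      then show ?thesis using c_ultra[of g g' h] IH gg' by simp
    next
      case False
      then show ?thesis using c_ultra[of g g' h] cg hg by simp
    qed
    then show ?case unfolding h .
  qed
  have lower': "len g + len h \<le> len (inv g \<otimes> h) + 2 * c g h + 2 * C"
    if gh: "g \<in> carrier G" "h \<in> carrier G" for g h
  proof -
    have "inv g \<otimes> h \<in> carrier G" using gh by simp
    then obtain ss where ss: "length ss = len (inv g \<otimes> h)" "set ss \<subseteq> letters"
      "foldr (\<otimes>) ss \<one> = inv g \<otimes> h" by (rule len_witness)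
    have "g \<otimes> (inv g \<otimes> h) = h" using gh by (simp add: m_assoc[symmetric])
    then show ?thesis using lower[OF gh(1) ss(2)] ss by simp
  qed
  define d where "d = word_dist G S"
  have gp_inv: "gromov_product d w x y = gromov_product d \<one> (inv w \<otimes> x) (inv w \<otimes> y)"
    if wxy: "w \<in> carrier G" "x \<in> carrier G" "y \<in> carrier G" for w x y
  proof -
    have "inv (inv w \<otimes> x) \<otimes> (inv w \<otimes> y) = inv x \<otimes> y"
      using wxy by (simp add: inv_mult_group m_assoc[symmetric]) (simp add: m_assoc)
    then show ?thesis
      using wxy by (simp add: gromov_product_def d_def word_dist_eq inv_mult_group)
  qed
  have gp_c: "real (c x y) \<le> gromov_product d \<one> x y \<and> gromov_product d \<one> x y \<le> real (c x y) + real C"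
    if xy: "x \<in> carrier G" "y \<in> carrier G" for x y
  proof -
    have "real (len (inv x \<otimes> y)) + 2 * real (c x y) \<le> real (len x) + real (len y)"
      using upper[OF xy] by linarith
    moreover have "real (len x) + real (len y) \<le> real (len (inv x \<otimes> y)) + 2 * real (c x y) + 2 * real C"
      using lower'[OF xy] by linarith
    ultimately show ?thesis
      using xy by (simp add: gromov_product_def d_def word_dist_eq len_inv)
  qed
  have "gromov_product d w x z \<ge> min (gromov_product d w x y) (gromov_product d w y z) - real C"
    if m: "w \<in> carrier G" "x \<in> carrier G" "y \<in> carrier G" "z \<in> carrier G" for w x y z
  proof -
    define x' y' z' where "x' = inv w \<otimes> x" and "y' = inv w \<otimes> y" and "z' = inv w \<otimes> z"
    have c: "x' \<in> carrier G" "y' \<in> carrier G" "z' \<in> carrier G"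
      using m by (auto simp: x'_def y'_def z'_def)
    have "min (real (c x' y')) (real (c y' z')) \<le> real (c x' z')"
      using c_ultra[of x' y' z'] by (simp add: min_def split: if_splits)
    then show ?thesis
      using gp_c[OF c(1,2)] gp_c[OF c(2,3)] gp_c[OF c(1,3)]
      unfolding gp_inv[OF m(1,2,3)] gp_inv[OF m(1,3,4)] gp_inv[OF m(1,2,4)]
        x'_def[symmetric] y'_def[symmetric] z'_def[symmetric] by linarith
  qed
  then show ?thesis
    unfolding gromov_hyperbolic_space_def d_def using metric by blast
qed

text \<open>The points \<open>\<one>\<close>, \<open>g\<close>, \<open>g \<otimes> h\<close>,
  \<open>h\<close> form a parallelogram with sides \<open>len g\<close>, \<open>len h\<close>:
  commutativity makes the side from \<open>h\<close> to \<open>g \<otimes> h\<close> as long as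
  \<open>g\<close>. The four-point condition bounds the sum of its diagonals by twice the longer
  side.\<close>

lemma four_point_commuting:
  assumes "gromov_hyperbolic_space (carrier G) (word_dist G S)"
  obtains \<delta> where "\<And>g h. \<lbrakk>g \<in> carrier G; h \<in> carrier G; g \<otimes> h = h \<otimes> g\<rbrakk>
    \<Longrightarrow> real (len (g \<otimes> h)) + real (len (inv g \<otimes> h)) \<le> 2 * max (real (len g)) (real (len h)) + \<delta>"
proof -
  define d where "d = word_dist G S"
  obtain \<delta> where \<delta>: "\<And>w x y z. \<lbrakk>w \<in> carrier G; x \<in> carrier G; y \<in> carrier G; z \<in> carrier G\<rbrakk> \<Longrightarrow>
      gromov_product d w x z \<ge> min (gromov_product d w x y) (gromov_product d w y z) - \<delta>"
    using assms unfolding gromov_hyperbolic_space_def d_def by blast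
  show ?thesis
  proof (rule that[of "2 * \<delta>"])
    fix g h assume g: "g \<in> carrier G" and h: "h \<in> carrier G" and comm: "g \<otimes> h = h \<otimes> g"
    have "inv (g \<otimes> h) \<otimes> h = inv g"
      using g h by (simp add: comm inv_mult_group m_assoc)
    then have dh: "d (g \<otimes> h) h = len g"
      using g h by (simp add: d_def word_dist_eq len_inv)
    have dg: "d g (g \<otimes> h) = len h"
      using g h by (simp add: d_def word_dist_eq m_assoc[symmetric])
    have d1: "d k \<one> = len k" if "k \<in> carrier G" for k
      using that by (simp add: d_def word_dist_eq len_inv)
    have "d g h = len (inv g \<otimes> h)"
      using g h by (simp add: d_def word_dist_eq)
    then show "real (len (g \<otimes> h)) + real (len (inv g \<otimes> h)) \<le>
        2 * max (real (len g)) (real (len h)) + 2 * \<delta>"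
      using \<delta>[of \<one> g "g \<otimes> h" h] g h
      by (simp add: gromov_product_def dh dg d1 min_def max_def field_simps split: if_splits)
  qed
qed

text \<open>The parallelogram spanned by the diagonals \<open>g \<otimes> h\<close> and
  \<open>inv g \<otimes> h\<close> has itself the diagonals \<open>h \<otimes> h\<close> and
  \<open>inv (g \<otimes> g)\<close>, so that the four-point condition can be applied to it a second
  time.\<close>

lemma inv_mult_mult_commute:
  assumes "g \<in> carrier G" "h \<in> carrier G" "g \<otimes> h = h \<otimes> g"
  shows "(g \<otimes> h) \<otimes> (inv g \<otimes> h) = h \<otimes> h" "(inv g \<otimes> h) \<otimes> (g \<otimes> h) = h \<otimes> h"
    "inv (g \<otimes> h) \<otimes> (inv g \<otimes> h) = inv (g \<otimes> g)"
proof -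
  have "(g \<otimes> h) \<otimes> (inv g \<otimes> h) = h \<otimes> (g \<otimes> inv g) \<otimes> h"
    using assms by (simp add: m_assoc[symmetric]) (simp add: m_assoc)
  then show "(g \<otimes> h) \<otimes> (inv g \<otimes> h) = h \<otimes> h" using assms(1,2) by simp
  have "(inv g \<otimes> h) \<otimes> (g \<otimes> h) = inv g \<otimes> (h \<otimes> g) \<otimes> h"
    using assms(1,2) by (simp add: m_assoc)
  also have "\<dots> = (inv g \<otimes> g) \<otimes> h \<otimes> h"
    unfolding assms(3)[symmetric] using assms(1,2) by (simp add: m_assoc[symmetric])
  finally show "(inv g \<otimes> h) \<otimes> (g \<otimes> h) = h \<otimes> h" using assms(1,2) by simp
  have hg: "h \<otimes> inv g = inv g \<otimes> h"
  proof -
    have "h \<otimes> inv g = inv g \<otimes> (g \<otimes> h) \<otimes> inv g"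
      using assms(1,2) by (simp add: m_assoc[symmetric])
    also have "\<dots> = inv g \<otimes> h"
      unfolding assms(3) using assms(1,2) by (simp add: m_assoc)
    finally show ?thesis .
  qed
  have "inv (g \<otimes> h) \<otimes> (inv g \<otimes> h) = inv (g \<otimes> h) \<otimes> h \<otimes> inv g"
    using assms(1,2) by (simp add: hg[symmetric] m_assoc)
  also have "\<dots> = inv g \<otimes> inv g"
    using assms(1,2) by (simp add: assms(3) inv_mult_group m_assoc)
  finally show "inv (g \<otimes> h) \<otimes> (inv g \<otimes> h) = inv (g \<otimes> g)"
    using assms(1,2) by (simp add: inv_mult_group)
qed

end

section \<open>Stable length and undistorted commuting pairs\<close>

lemma fekete:
  fixes f :: "nat \<Rightarrow> real"
  assumes sub: "\<And>m n. f (m + n) \<le> f m + f n" and pos: "\<And>n. 0 \<le> f n"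
  shows "convergent (\<lambda>n. f n / real n)"
proof -
  define L where "L = (INF n\<in>{1..}. f n / real n)"
  have bdd: "bdd_below ((\<lambda>n. f n / real n) ` {1..})"
    by (rule bdd_belowI2[of _ 0]) (simp add: pos)
  have L_le: "L \<le> f n / real n" if "n \<ge> 1" for n
    unfolding L_def by (rule cINF_lower[OF bdd]) (use that in simp)
  have mult: "f (q * k + r) \<le> real q * f k + f r" for q k r
  proof (induction q)
    case (Suc q)
    have "f (Suc q * k + r) \<le> f k + f (q * k + r)"
      using sub[of k "q * k + r"] by (simp add: add.assoc)
    then show ?case using Suc by (simp add: algebra_simps)
  qed simp
  have "(\<lambda>n. f n / real n) \<longlonglongrightarrow> L"
  proof (rule LIMSEQ_I)
    fix e :: real assume e: "e > 0"
    have "\<exists>k\<in>{1..}. f k / real k < L + e / 2"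
      unfolding L_def by (subst cINF_less_iff[OF _ bdd, symmetric]) (use e in auto)
    then obtain k where k: "k \<ge> 1" "f k / real k < L + e / 2" by auto
    define M where "M = (\<Sum>r<k. f r)"
    have M: "f r \<le> M" if "r < k" for r
      unfolding M_def using that pos by (intro member_le_sum) auto
    obtain N where N: "M / (e / 2) < real N" using reals_Archimedean2 by blast
    show "\<exists>no. \<forall>n\<ge>no. norm (f n / real n - L) < e"
    proof (intro exI[of _ "max 1 N"] allI impI)
      fix n assume n: "n \<ge> max 1 N"
      have "real n \<ge> real N" using n by simp
      then have Mn: "M < e / 2 * real n" using N e
        by (smt (verit) divide_less_eq mult.commute mult_left_mono half_gt_zero)
      have "f n \<le> real (n div k) * f k + f (n mod k)"
        using mult[of "n div k" k "n mod k"] by simp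
      also have "\<dots> \<le> real n / real k * f k + M"
        using M[of "n mod k"] k(1) pos[of k] of_nat_div_le_of_nat[of n k]
        by (intro add_mono mult_right_mono) auto
      also have "\<dots> < real n * (f k / real k) + e / 2 * real n" using Mn by simp
      also have "\<dots> \<le> real n * (L + e / 2) + e / 2 * real n"
        using k e by (intro add_mono mult_left_mono) auto
      finally have "f n < real n * (L + e)" by (simp add: algebra_simps)
      then have "f n / real n < L + e" using n by (simp add: field_simps)
      moreover have "L \<le> f n / real n" using L_le n by simp
      ultimately show "norm (f n / real n - L) < e" by simp
    qed
  qed
  then show ?thesis by (auto simp: convergent_def)
qed

context generated_group begin

text \<open>Subadditivity makes the stable length \<open>L\<close> exist. Stating the limit along
  all multiples \<open>i * n\<close> lets the limits for different powers be taken over one and the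
  same \<open>n\<close>.\<close>

lemma len_pow_limit:
  assumes "x \<in> carrier G"
  obtains L where "\<And>i. (\<lambda>n. real (len (x [^] (i * n))) / real n) \<longlonglongrightarrow> real i * L"
proof -
  have "convergent (\<lambda>n. real (len (x [^] n)) / real n)"
  proof (rule fekete)
    fix m n :: nat
    show "real (len (x [^] (m + n))) \<le> real (len (x [^] m)) + real (len (x [^] n))"
      using len_mult[of "x [^] m" "x [^] n"] assms by (simp add: nat_pow_mult)
  qed simp
  then obtain L where L: "(\<lambda>n. real (len (x [^] n)) / real n) \<longlonglongrightarrow> L"
    by (auto simp: convergent_def)
  have "(\<lambda>n. real (len (x [^] (i * n))) / real n) \<longlonglongrightarrow> real i * L" for i :: nat
  proof (cases "i = 0")
    case True
    then show ?thesis using len_one by simp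
  next
    case False
    then have "strict_mono (\<lambda>n. i * n)" by (auto simp: strict_mono_def)
    from LIMSEQ_subseq_LIMSEQ[OF L this]
    have "(\<lambda>n. real i * (real (len (x [^] (i * n))) / real (i * n))) \<longlonglongrightarrow> real i * L"
      by (intro tendsto_mult_left) (simp add: o_def)
    then show ?thesis using False by (simp add: field_simps)
  qed
  then show ?thesis using that by blast
qed

text \<open>On \<open>\<langle>x, y\<rangle>\<close> the stable length is a norm. In the limit the four-point condition makes it
  0-hyperbolic, so \<open>g = x\<^sup>i\<close> and \<open>h = y\<^sup>j\<close> of nearly equal norm would have \<open>g h\<close> or \<open>g\<inverse> h\<close> of bounded
  norm.\<close>

lemma not_hyperbolic_if_undistorted_commuting:
  assumes x: "x \<in> carrier G" and y: "y \<in> carrier G" and comm: "x \<otimes> y = y \<otimes> x" and \<epsilon>: "\<epsilon> > 0"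
    and len_x: "\<And>i::nat. \<epsilon> * real i \<le> real (len (x [^] i))"
    and len_xy: "\<And>(i::nat) (j::nat). \<epsilon> * real j \<le> real (len (x [^] i \<otimes> y [^] j))"
    and len_ixy: "\<And>(i::nat) (j::nat). \<epsilon> * real j \<le> real (len (inv (x [^] i) \<otimes> y [^] j))"
  shows "\<not> gromov_hyperbolic_space (carrier G) (word_dist G S)"
proof
  assume "gromov_hyperbolic_space (carrier G) (word_dist G S)"
  then obtain \<delta> where \<delta>: "\<And>g h. \<lbrakk>g \<in> carrier G; h \<in> carrier G; g \<otimes> h = h \<otimes> g\<rbrakk>
    \<Longrightarrow> real (len (g \<otimes> h)) + real (len (inv g \<otimes> h)) \<le> 2 * max (real (len g)) (real (len h)) + \<delta>"
    by (rule four_point_commuting) blast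
  obtain a where a: "\<And>i. (\<lambda>n. real (len (x [^] (i * n))) / real n) \<longlonglongrightarrow> real i * a"
    using len_pow_limit[OF x] by blast
  obtain b where b: "\<And>i. (\<lambda>n. real (len (y [^] (i * n))) / real n) \<longlonglongrightarrow> real i * b"
    using len_pow_limit[OF y] by blast
  have a_pos: "a \<ge> \<epsilon>"
  proof -
    have "\<epsilon> \<le> real (len (x [^] (1 * n))) / real n" if "n \<ge> 1" for n
      using len_x[of n] that by (simp add: field_simps)
    then have "\<epsilon> \<le> real 1 * a"
      by (intro LIMSEQ_le_const[OF a[of 1]]) (intro exI[of _ 1], blast)
    then show ?thesis by simp
  qed
  have b_pos: "b \<ge> 0"
    using LIMSEQ_le_const[OF b[of 1], of 0] by simp
  have key: "2 * (real i * a) + 2 * (real j * b) \<le> 4 * max (real i * a) (real j * b) - 2 * (\<epsilon> * real j)"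
    for i j :: nat
  proof -
    define xl where "xl k n = real (len (x [^] (k * n))) / real n" for k n :: nat
    define yl where "yl k n = real (len (y [^] (k * n))) / real n" for k n :: nat
    have bound: "xl (2 * i) n + yl (2 * j) n \<le> 4 * max (xl i n) (yl j n) - 2 * (\<epsilon> * real j) + 3 * \<delta> / real n"
      if n: "n \<ge> 1" for n
    proof -
      define g h where "g = x [^] (i * n)" and "h = y [^] (j * n)"
      have gh: "g \<in> carrier G" "h \<in> carrier G" using x y by (auto simp: g_def h_def)
      have c: "g \<otimes> h = h \<otimes> g"
        unfolding g_def h_def using x y comm by (metis pow_mult_distrib nat_pow_closed nat_pow_comm group_commutes_pow)
      have g2: "g \<otimes> g = x [^] (2 * i * n)" and h2: "h \<otimes> h = y [^] (2 * j * n)"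
        unfolding g_def h_def using x y by (simp_all add: nat_pow_mult mult_2 add_mult_distrib)
      let ?A = "real (len (g \<otimes> h))" and ?B = "real (len (inv g \<otimes> h))"
      let ?m = "max (real (len g)) (real (len h))"
      \<comment> \<open>The first use of the four-point condition bounds the sum of the diagonals;
        since each of them is at least \<open>\<epsilon> * j * n\<close>, the longer one is at most
        \<open>2 * ?m - \<epsilon> * j * n + \<delta>\<close>. The second use, on the diagonals as
        sides, doubles this and adds \<open>\<delta>\<close>, whence the coefficients 4, 2 and
        3.\<close>
      have 1: "?A + ?B \<le> 2 * ?m + \<delta>" using \<delta>[OF gh c] .
      have 2: "real (len (h \<otimes> h)) + real (len (g \<otimes> g)) \<le> 2 * max ?A ?B + \<delta>"
        using \<delta>[of "g \<otimes> h" "inv g \<otimes> h"] inv_mult_mult_commute[OF gh c] gh by (simp add: len_inv)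
      have 3: "\<epsilon> * real j * real n \<le> ?A" "\<epsilon> * real j * real n \<le> ?B"
        using len_xy[of "j * n" "i * n"] len_ixy[of "j * n" "i * n"] by (simp_all add: g_def h_def mult.assoc)
      have "real (len (h \<otimes> h)) + real (len (g \<otimes> g)) \<le> 4 * ?m - 2 * (\<epsilon> * real j * real n) + 3 * \<delta>"
        using 1 2 3 by (auto simp: max_def split: if_splits)
      then have "(real (len (g \<otimes> g)) + real (len (h \<otimes> h))) / real n
          \<le> (4 * ?m - 2 * (\<epsilon> * real j * real n) + 3 * \<delta>) / real n"
        by (intro divide_right_mono) auto
      moreover have "?m / real n = max (xl i n) (yl j n)"
        using n by (simp add: xl_def yl_def g_def h_def max_divide_distrib_right)
      ultimately show ?thesis
        using n by (simp add: xl_def yl_def g2 h2 add_divide_distrib diff_divide_distrib)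
    qed
    have "(\<lambda>n. 3 * \<delta> / real n) \<longlonglongrightarrow> 0" by (rule lim_const_over_n)
    then have lim1: "(\<lambda>n. 4 * max (xl i n) (yl j n) - 2 * (\<epsilon> * real j) + 3 * \<delta> / real n) \<longlonglongrightarrow>
        4 * max (real i * a) (real j * b) - 2 * (\<epsilon> * real j) + 0"
      unfolding xl_def yl_def by (intro tendsto_intros a b)
    have lim2: "(\<lambda>n. xl (2 * i) n + yl (2 * j) n) \<longlonglongrightarrow> real (2 * i) * a + real (2 * j) * b"
      unfolding xl_def yl_def by (intro tendsto_intros a b)
    have "real (2 * i) * a + real (2 * j) * b \<le>
        4 * max (real i * a) (real j * b) - 2 * (\<epsilon> * real j) + 0"
      by (rule LIMSEQ_le[OF lim2 lim1]) (use bound in blast)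
    then show ?thesis by simp
  qed
  \<comment> \<open>\<open>j\<close> is chosen so that \<open>\<epsilon> * j\<close> exceeds
    \<open>a\<close>, and \<open>i\<close> is the largest number with
    \<open>i * a \<le> j * b\<close>. The two norms then differ by less than \<open>a\<close>, while
    \<open>key\<close> forces them to differ by at least \<open>\<epsilon> * j\<close>.\<close>
  obtain j :: nat where j: "a / \<epsilon> < real j" using reals_Archimedean2 by blast
  define i where "i = nat \<lfloor>real j * b / a\<rfloor>"
  have a0: "a > 0" using a_pos \<epsilon> by simp
  have "real i \<le> real j * b / a" "real j * b / a < real i + 1"
    using a0 b_pos unfolding i_def by (auto simp: of_nat_nat floor_le_iff)
  then have "real i * a \<le> real j * b" "real j * b < real i * a + a"
    using a0 by (simp_all add: field_simps)
  moreover have "a < \<epsilon> * real j" using j \<epsilon> by (simp add: field_simps)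
  ultimately show False using key[of i j] max_absorb2[of "real i * a" "real j * b"] by linarith
qed

end

section \<open>Graph products as quotients of words\<close>

locale vertex_groups =
  fixes V :: "'v set" and E :: "'v set set" and G :: "'v \<Rightarrow> ('a, 'b) monoid_scheme"
  assumes group_G: "\<And>v. v \<in> V \<Longrightarrow> group (G v)"
begin

abbreviation "F \<equiv> free_product V G"
abbreviation "P \<equiv> graph_product V E G"
abbreviation "words \<equiv> fp_words V G"
abbreviation "fpc w \<equiv> fp_rel V G `` {w}"
abbreviation "K \<equiv> normal_closure F (graph_product_relators V E G)"

definition ev :: "('v \<times> 'a) list \<Rightarrow> ('v \<times> 'a) list set set" where
  "ev w = K #>\<^bsub>F\<^esub> fpc w"

sublocale F: group F
  using group_free_product group_G by blast

sublocale P: group P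
  using group_graph_product group_G by blast

lemma carrier_F: "carrier F = fpc ` words"
  by (auto simp: free_product_def quotient_def)

lemma fpc_mult: "\<lbrakk>u \<in> words; w \<in> words\<rbrakk> \<Longrightarrow> fpc u \<otimes>\<^bsub>F\<^esub> fpc w = fpc (u @ w)"
  using free_product_mult group_G by blast

lemma one_F: "\<one>\<^bsub>F\<^esub> = fpc []"
  by (simp add: free_product_def)

lemma fpc_eq_iff: "\<lbrakk>u \<in> words; w \<in> words\<rbrakk> \<Longrightarrow> fpc u = fpc w \<longleftrightarrow> (u, w) \<in> fp_rel V G"
  by (rule eq_equiv_class_iff[OF equiv_fp_rel]) (use group_G in auto)

lemma fpc_closed: "w \<in> words \<Longrightarrow> fpc w \<in> carrier F"
  by (simp add: carrier_F)

lemma words_simps [simp]: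
  "[] \<in> words" "(v, g) # w \<in> words \<longleftrightarrow> v \<in> V \<and> g \<in> carrier (G v) \<and> w \<in> words"
  "u @ w \<in> words \<longleftrightarrow> u \<in> words \<and> w \<in> words"
  by (auto simp: fp_words_def)

lemma fpc_letter_mult:
  assumes "v \<in> V" "g \<in> carrier (G v)" "h \<in> carrier (G v)"
  shows "fpc [(v, g), (v, h)] = fpc [(v, g \<otimes>\<^bsub>G v\<^esub> h)]"
  using fp_rel.mult[of "[]" V G "[]" v g h] assms
  by (subst fpc_eq_iff) (auto simp: group_G group.is_monoid monoid.m_closed)

lemma fpc_letter_one: "v \<in> V \<Longrightarrow> fpc [(v, \<one>\<^bsub>G v\<^esub>)] = fpc []"
  using fp_rel.unit[of "[]" V G "[]" v]
  by (subst fpc_eq_iff) (auto simp: group_G group.is_monoid)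

lemma inv_fpc_letter:
  assumes "v \<in> V" "g \<in> carrier (G v)"
  shows "inv\<^bsub>F\<^esub> (fpc [(v, g)]) = fpc [(v, inv\<^bsub>G v\<^esub> g)]"
proof -
  interpret Gv: group "G v" using group_G assms by blast
  have "fpc [(v, inv\<^bsub>G v\<^esub> g)] \<otimes>\<^bsub>F\<^esub> fpc [(v, g)] = \<one>\<^bsub>F\<^esub>"
    using assms by (simp add: fpc_mult fpc_letter_mult fpc_letter_one one_F)
  then show ?thesis
    using assms by (intro F.inv_equality fpc_closed) auto
qed

lemma relators_closed: "graph_product_relators V E G \<subseteq> carrier F"
  by (auto simp: graph_product_relators_def commutator_def fp_inj_def fpc_closed)

lemma normal_K: "K \<lhd> F"
  by (rule normal_normal_closure[OF F.is_group relators_closed])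

lemma ev_append: "\<lbrakk>u \<in> words; w \<in> words\<rbrakk> \<Longrightarrow> ev (u @ w) = ev u \<otimes>\<^bsub>P\<^esub> ev w"
  using normal.rcos_sum[OF normal_K]
  by (simp add: ev_def graph_product_def FactGroup_def fpc_closed fpc_mult)

lemma carrier_P: "carrier P = ev ` words"
  by (auto simp: graph_product_def FactGroup_def RCOSETS_def ev_def carrier_F)

lemma ev_closed: "w \<in> words \<Longrightarrow> ev w \<in> carrier P"
  by (simp add: carrier_P)

lemma ev_Nil: "ev [] = \<one>\<^bsub>P\<^esub>"
  using P.l_cancel_one[of "ev []" "ev []"] ev_append[of "[]" "[]"] ev_closed[of "[]"] by simp

lemma ev_Cons:
  "\<lbrakk>v \<in> V; g \<in> carrier (G v); w \<in> words\<rbrakk> \<Longrightarrow> ev ((v, g) # w) = ev [(v, g)] \<otimes>\<^bsub>P\<^esub> ev w"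
  using ev_append[of "[(v, g)]" w] by simp

lemma ev_mult:
  "\<lbrakk>v \<in> V; g \<in> carrier (G v); h \<in> carrier (G v)\<rbrakk>
    \<Longrightarrow> ev [(v, g)] \<otimes>\<^bsub>P\<^esub> ev [(v, h)] = ev [(v, g \<otimes>\<^bsub>G v\<^esub> h)]"
  by (subst ev_append[symmetric]) (auto simp: ev_def fpc_letter_mult)

lemma ev_letter_one: "v \<in> V \<Longrightarrow> ev [(v, \<one>\<^bsub>G v\<^esub>)] = \<one>\<^bsub>P\<^esub>"
  by (simp add: ev_def fpc_letter_one flip: ev_Nil)

lemma inv_ev_letter:
  assumes "v \<in> V" "g \<in> carrier (G v)"
  shows "inv\<^bsub>P\<^esub> (ev [(v, g)]) = ev [(v, inv\<^bsub>G v\<^esub> g)]"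
proof -
  interpret Gv: group "G v" using group_G assms by blast
  show ?thesis
    using assms by (intro P.inv_equality ev_closed) (auto simp: ev_mult ev_letter_one)
qed

lemma ev_commute:
  assumes "v \<in> V" "w \<in> V" "{v, w} \<in> E" "g \<in> carrier (G v)" "h \<in> carrier (G w)"
  shows "ev [(v, g)] \<otimes>\<^bsub>P\<^esub> ev [(w, h)] = ev [(w, h)] \<otimes>\<^bsub>P\<^esub> ev [(v, g)]"
proof -
  have sub: "subgroup K F" using normal_K normal_imp_subgroup by blast
  have l: "fpc [(v, g)] \<in> carrier F" "fpc [(w, h)] \<in> carrier F"
    using assms by (auto intro!: fpc_closed)
  have "commutator F (fpc [(v, g)]) (fpc [(w, h)]) \<in> graph_product_relators V E G"
    using assms unfolding graph_product_relators_def fp_inj_def by blast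
  then have "commutator F (fpc [(v, g)]) (fpc [(w, h)]) \<in> K"
    unfolding normal_closure_def by blast
  moreover have "commutator F (fpc [(v, g)]) (fpc [(w, h)]) =
      (fpc [(v, g)] \<otimes>\<^bsub>F\<^esub> fpc [(w, h)]) \<otimes>\<^bsub>F\<^esub> inv\<^bsub>F\<^esub> (fpc [(w, h)] \<otimes>\<^bsub>F\<^esub> fpc [(v, g)])"
    using l by (simp add: commutator_def F.inv_mult_group F.m_assoc)
  ultimately have "K #>\<^bsub>F\<^esub> (fpc [(v, g)] \<otimes>\<^bsub>F\<^esub> fpc [(w, h)]) = K #>\<^bsub>F\<^esub> (fpc [(w, h)] \<otimes>\<^bsub>F\<^esub> fpc [(v, g)])"
    using l sub by (metis F.m_closed F.repr_independence subgroup.rcos_module[OF sub F.is_group])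
  then show ?thesis
    using assms by (subst (1 2) ev_append[symmetric]) (auto simp: ev_def fpc_mult)
qed

section \<open>Right actions that tell elements of a graph product apart\<close>

definition action :: "'s set \<Rightarrow> ('s \<Rightarrow> 'v \<Rightarrow> 'a \<Rightarrow> 's) \<Rightarrow> bool" where
  "action N \<phi> \<longleftrightarrow>
     (\<forall>x\<in>N. \<forall>v\<in>V. \<phi> x v (\<one>\<^bsub>G v\<^esub>) = x) \<and>
     (\<forall>x\<in>N. \<forall>v\<in>V. \<forall>g\<in>carrier (G v). \<phi> x v g \<in> N) \<and>
     (\<forall>x\<in>N. \<forall>v\<in>V. \<forall>g\<in>carrier (G v). \<forall>h\<in>carrier (G v).
        \<phi> (\<phi> x v g) v h = \<phi> x v (g \<otimes>\<^bsub>G v\<^esub> h)) \<and>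
     (\<forall>x\<in>N. \<forall>v\<in>V. \<forall>w\<in>V. \<forall>g\<in>carrier (G v). \<forall>h\<in>carrier (G w). {v, w} \<in> E \<longrightarrow>
        \<phi> (\<phi> x v g) w h = \<phi> (\<phi> x w h) v g)"

definition run :: "('s \<Rightarrow> 'v \<Rightarrow> 'a \<Rightarrow> 's) \<Rightarrow> 's \<Rightarrow> ('v \<times> 'a) list \<Rightarrow> 's" where
  "run \<phi> = foldl (\<lambda>x (v, g). \<phi> x v g)"

lemma run_simps [simp]:
  "run \<phi> x [] = x" "run \<phi> x ((v, g) # w) = run \<phi> (\<phi> x v g) w"
  "run \<phi> x (u @ w) = run \<phi> (run \<phi> x u) w"
  by (simp_all add: run_def)

lemma run_closed: "\<lbrakk>action N \<phi>; x \<in> N; w \<in> words\<rbrakk> \<Longrightarrow> run \<phi> x w \<in> N"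
proof (induction w arbitrary: x)
  case (Cons l w)
  obtain v g where "l = (v, g)" by fastforce
  then show ?case using Cons by (auto simp: action_def)
qed simp

lemma run_fp_rel:
  assumes "(u, w) \<in> fp_rel V G" and \<phi>: "action N \<phi>" and "x \<in> N"
  shows "run \<phi> x u = run \<phi> x w"
  using assms(1,3)
proof (induction arbitrary: x)
  case (unit xs ys v)
  then have "\<phi> (run \<phi> x xs) v \<one>\<^bsub>G v\<^esub> = run \<phi> x xs"
    using run_closed[OF \<phi>] \<phi> unfolding action_def by blast
  then show ?case by simp
next
  case (mult xs ys v g h)
  then have "\<phi> (\<phi> (run \<phi> x xs) v g) v h = \<phi> (run \<phi> x xs) v (g \<otimes>\<^bsub>G v\<^esub> h)"
    using run_closed[OF \<phi>] \<phi> unfolding action_def by blast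
  then show ?case by simp
qed auto

text \<open>The elements of the free product that act trivially form a normal subgroup containing
  the commutators of adjacent letters, hence all of \<open>K\<close>. Two words with different
  results of \<open>run\<close> therefore represent different elements.\<close>

lemma run_ev:
  assumes \<phi>: "action N \<phi>" and "x \<in> N" and u: "u \<in> words" and w: "w \<in> words" and eq: "ev u = ev w"
  shows "run \<phi> x u = run \<phi> x w"
proof -
  \<comment> \<open>Elements of \<open>F\<close> are congruence classes of words, so all
    representatives are required to act trivially; \<open>M_iff\<close> reduces this to a single
    one.\<close>
  define M where "M = {c \<in> carrier F. \<forall>w\<in>c \<inter> words. \<forall>x\<in>N. run \<phi> x w = x}"
  have fpcD: "(w, u) \<in> fp_rel V G" if "w \<in> words" "u \<in> fpc w" for u w
    using that by simp
  have M_iff: "fpc w \<in> M \<longleftrightarrow> (\<forall>x\<in>N. run \<phi> x w = x)" if "w \<in> words" for w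
  proof
    assume "fpc w \<in> M"
    moreover have "w \<in> fpc w" using that by (simp add: fp_rel.refl)
    ultimately show "\<forall>x\<in>N. run \<phi> x w = x" using that by (auto simp: M_def)
  next
    assume "\<forall>x\<in>N. run \<phi> x w = x"
    then show "fpc w \<in> M"
      using run_fp_rel[OF _ \<phi>] fpcD[OF that] that by (auto simp: M_def fpc_closed)
  qed
  have inverse: "\<exists>w'\<in>words. inv\<^bsub>F\<^esub> (fpc w) = fpc w' \<and> (\<forall>x\<in>N. run \<phi> (run \<phi> x w) w' = x)"
    if "w \<in> words" for w
  proof -
    have "inv\<^bsub>F\<^esub> (fpc w) \<in> carrier F" using that by (simp add: fpc_closed)
    then obtain w' where w': "w' \<in> words" "inv\<^bsub>F\<^esub> (fpc w) = fpc w'" by (auto simp: carrier_F)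
    have "fpc (w @ w') = fpc []"
      using that w' by (simp add: one_F[symmetric] fpc_mult[symmetric] fpc_closed flip: w'(2))
    then have "(w @ w', []) \<in> fp_rel V G" using that w' by (subst fpc_eq_iff[symmetric]) auto
    then show ?thesis using run_fp_rel[OF _ \<phi>] w' by force
  qed
  have "M \<lhd> F"
    unfolding F.normal_inv_iff
  proof (intro conjI ballI)
    show "subgroup M F"
    proof (rule F.subgroupI)
      show "M \<subseteq> carrier F" by (auto simp: M_def)
      show "M \<noteq> {}" using M_iff[of "[]"] by auto
    next
      fix a assume a: "a \<in> M"
      then obtain w where w: "w \<in> words" "a = fpc w" by (auto simp: M_def carrier_F)
      obtain w' where "w' \<in> words" "inv\<^bsub>F\<^esub> (fpc w) = fpc w'" "\<forall>x\<in>N. run \<phi> (run \<phi> x w) w' = x"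
        using inverse[OF w(1)] by blast
      then show "inv\<^bsub>F\<^esub> a \<in> M" using a w M_iff by simp
    next
      fix a b assume ab: "a \<in> M" "b \<in> M"
      then obtain u w where "u \<in> words" "a = fpc u" "w \<in> words" "b = fpc w"
        by (auto simp: M_def carrier_F)
      then show "a \<otimes>\<^bsub>F\<^esub> b \<in> M" using ab by (simp add: fpc_mult M_iff)
    qed
  next
    fix c a assume c: "c \<in> carrier F" and a: "a \<in> M"
    then obtain u w where u: "u \<in> words" "c = fpc u" and w: "w \<in> words" "a = fpc w"
      by (auto simp: M_def carrier_F)
    obtain u' where "u' \<in> words" "inv\<^bsub>F\<^esub> c = fpc u'" "\<forall>x\<in>N. run \<phi> (run \<phi> x u) u' = x"
      using inverse[OF u(1)] u by blast
    then show "c \<otimes>\<^bsub>F\<^esub> a \<otimes>\<^bsub>F\<^esub> inv\<^bsub>F\<^esub> c \<in> M"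
      using u w a run_closed[OF \<phi>] by (simp add: fpc_mult M_iff)
  qed
  moreover have "graph_product_relators V E G \<subseteq> M"
  proof
    fix r assume "r \<in> graph_product_relators V E G"
    then obtain v w g h where r: "r = commutator F (fpc [(v, g)]) (fpc [(w, h)])"
      and vw: "v \<in> V" "w \<in> V" "{v, w} \<in> E" "g \<in> carrier (G v)" "h \<in> carrier (G w)"
      by (auto simp: graph_product_relators_def fp_inj_def)
    interpret Gv: group "G v" using group_G vw by blast
    interpret Gw: group "G w" using group_G vw by blast
    have "r = fpc [(v, g), (w, h), (v, inv\<^bsub>G v\<^esub> g), (w, inv\<^bsub>G w\<^esub> h)]"
      using vw by (simp add: r commutator_def inv_fpc_letter fpc_mult)
    moreover have "\<phi> (\<phi> (\<phi> (\<phi> x v g) w h) v (inv\<^bsub>G v\<^esub> g)) w (inv\<^bsub>G w\<^esub> h) = x"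
      if x: "x \<in> N" for x
    proof -
      have "\<phi> (\<phi> x v g) w h = \<phi> (\<phi> x w h) v g"
        using \<phi> x vw unfolding action_def by blast
      moreover have "\<phi> x w h \<in> N" using \<phi> x vw unfolding action_def by blast
      ultimately show ?thesis
        using \<phi> x vw unfolding action_def by simp
    qed
    ultimately show "r \<in> M" using vw by (simp add: M_iff)
  qed
  ultimately have "K \<subseteq> M" unfolding normal_closure_def by blast
  have sub: "subgroup K F" using normal_K normal_imp_subgroup by blast
  have "fpc u \<in> K #>\<^bsub>F\<^esub> fpc w"
    using eq F.rcos_self[OF fpc_closed[OF u] sub] by (simp add: ev_def)
  then obtain k where k: "k \<in> K" "fpc u = k \<otimes>\<^bsub>F\<^esub> fpc w" by (auto simp: r_coset_def)
  with \<open>K \<subseteq> M\<close> obtain t where t: "t \<in> words" "k = fpc t" "fpc t \<in> M" by (auto simp: M_def carrier_F)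
  then have "(u, t @ w) \<in> fp_rel V G"
    using k u w by (simp add: fpc_mult flip: fpc_eq_iff)
  then show ?thesis
    using run_fp_rel[OF _ \<phi> \<open>x \<in> N\<close>] t M_iff \<open>x \<in> N\<close> by simp
qed

end

section \<open>Normal forms for graph products over forests\<close>

text \<open>For \<open>U = V\<close> the words in \<open>N\<close> are normal forms of the elements of the graph product, and \<open>\<phi>\<close> is
  right multiplication by letters. The assumption \<open>act_min\<close> says that every coset of a vertex group
  has a shortest representative, whose length all other representatives exceed by one.\<close>

locale nf_system = vertex_groups V E G
  for V :: "'v set" and E :: "'v set set" and G :: "'v \<Rightarrow> ('a, 'b) monoid_scheme" +
  fixes U :: "'v set" and N :: "('v \<times> 'a) list set"
    and \<phi> :: "('v \<times> 'a) list \<Rightarrow> 'v \<Rightarrow> 'a \<Rightarrow> ('v \<times> 'a) list" and C :: nat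
  assumes irrefl: "\<And>u. {u, u} \<notin> E"
    and U_V: "U \<subseteq> V"
    and Nil_N: "[] \<in> N"
    and N_words: "\<And>x. x \<in> N \<Longrightarrow> x \<in> words"
    and N_U: "\<And>x. x \<in> N \<Longrightarrow> fst ` set x \<subseteq> U"
    and act_closed: "\<And>x w g. \<lbrakk>x \<in> N; w \<in> U; g \<in> carrier (G w)\<rbrakk> \<Longrightarrow> \<phi> x w g \<in> N"
    and act_one: "\<And>x w. \<lbrakk>x \<in> N; w \<in> U\<rbrakk> \<Longrightarrow> \<phi> x w (\<one>\<^bsub>G w\<^esub>) = x"
    and act_mult: "\<And>x w g h. \<lbrakk>x \<in> N; w \<in> U; g \<in> carrier (G w); h \<in> carrier (G w)\<rbrakk>
      \<Longrightarrow> \<phi> (\<phi> x w g) w h = \<phi> x w (g \<otimes>\<^bsub>G w\<^esub> h)"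
    and act_comm: "\<And>x u w g h. \<lbrakk>x \<in> N; u \<in> U; w \<in> U; {u, w} \<in> E; g \<in> carrier (G u); h \<in> carrier (G w)\<rbrakk>
      \<Longrightarrow> \<phi> (\<phi> x u g) w h = \<phi> (\<phi> x w h) u g"
    and act_stable: "\<And>x w g. \<lbrakk>x \<in> N; w \<in> U; g \<in> carrier (G w)\<rbrakk>
      \<Longrightarrow> \<exists>z. prefix z x \<and> prefix z (\<phi> x w g) \<and> length x \<le> length z + C"
    and act_ev: "\<And>x w g. \<lbrakk>x \<in> N; w \<in> U; g \<in> carrier (G w)\<rbrakk>
      \<Longrightarrow> ev (\<phi> x w g) = ev x \<otimes>\<^bsub>P\<^esub> ev [(w, g)]"
    and act_min: "\<And>x w. \<lbrakk>x \<in> N; w \<in> U\<rbrakk> \<Longrightarrow> \<exists>t\<in>N. \<exists>g\<in>carrier (G w). x = \<phi> t w g \<and>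
      (\<forall>h\<in>carrier (G w). h \<noteq> \<one>\<^bsub>G w\<^esub> \<longrightarrow> length (\<phi> t w h) = length t + 1)"

text \<open>If \<open>H\<close> is the graph product over \<open>U\<close> and \<open>L\<close> is the subgroup generated by the neighbours of \<open>v\<close>,
  then the graph product over \<open>insert v U\<close> is the amalgam of \<open>H\<close> and \<open>L \<times> G v\<close> over \<open>L\<close>. Here \<open>tm x\<close>
  is the representative of the coset \<open>x L\<close>, and \<open>cp x\<close> is the component of \<open>x\<close> in \<open>L\<close>.\<close>

locale nf_extension = nf_system V E G U N \<phi> C
  for V :: "'v set" and E :: "'v set set" and G :: "'v \<Rightarrow> ('a, 'b) monoid_scheme"
    and U :: "'v set" and N :: "('v \<times> 'a) list set"
    and \<phi> :: "('v \<times> 'a) list \<Rightarrow> 'v \<Rightarrow> 'a \<Rightarrow> ('v \<times> 'a) list" and C :: nat +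
  fixes v :: 'v and tm cp :: "('v \<times> 'a) list \<Rightarrow> ('v \<times> 'a) list"
  assumes v_V: "v \<in> V" and v_U: "v \<notin> U"
    and tm_N: "\<And>x. x \<in> N \<Longrightarrow> tm x \<in> N" and cp_N: "\<And>x. x \<in> N \<Longrightarrow> cp x \<in> N"
    and tm_tm: "\<And>x. x \<in> N \<Longrightarrow> tm (tm x) = tm x" and cp_tm: "\<And>x. x \<in> N \<Longrightarrow> cp (tm x) = []"
    and tm_cp: "\<And>x. x \<in> N \<Longrightarrow> tm (cp x) = []" and cp_cp: "\<And>x. x \<in> N \<Longrightarrow> cp (cp x) = cp x"
    and length_tm_cp: "\<And>x. x \<in> N \<Longrightarrow> length x = length (tm x) + length (cp x)"
    and length_cp: "\<And>x. x \<in> N \<Longrightarrow> length (cp x) \<le> 1"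
    and tm_cp_inj: "\<And>x y. \<lbrakk>x \<in> N; y \<in> N; tm x = tm y; cp x = cp y\<rbrakk> \<Longrightarrow> x = y"
    and tm_cp_surj: "\<And>x y. \<lbrakk>x \<in> N; y \<in> N\<rbrakk> \<Longrightarrow> \<exists>z\<in>N. tm z = tm x \<and> cp z = cp y"
    and tm_nbr: "\<And>x w g. \<lbrakk>x \<in> N; w \<in> U; {v, w} \<in> E; g \<in> carrier (G w)\<rbrakk> \<Longrightarrow> tm (\<phi> x w g) = tm x"
    and cp_nbr: "\<And>x w g. \<lbrakk>x \<in> N; w \<in> U; {v, w} \<in> E; g \<in> carrier (G w)\<rbrakk>
      \<Longrightarrow> cp (\<phi> x w g) = \<phi> (cp x) w g"
    and tm_stable: "\<And>x. x \<in> N \<Longrightarrow> \<exists>z. prefix z x \<and> prefix z (tm x) \<and> length x \<le> length z + C"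
    and tm_ev: "\<And>x a. \<lbrakk>x \<in> N; a \<in> carrier (G v)\<rbrakk>
      \<Longrightarrow> ev (tm x @ [(v, a)] @ cp x) = ev x \<otimes>\<^bsub>P\<^esub> ev [(v, a)]"
begin

section \<open>Normal forms of the amalgam\<close>

sublocale Gv: group "G v"
  using group_G v_V by blast

text \<open>The initial parts of normal forms that end with a letter of \<open>v\<close>. Between
  consecutive letters of \<open>v\<close> the coset representative must be nonempty, as the two
  letters would merge otherwise; only before the first of them may it be empty.\<close>

inductive_set heads :: "('v \<times> 'a) list set" where
  Nil: "[] \<in> heads"
| step: "\<lbrakk>p \<in> heads; x \<in> N; tm x \<noteq> [] \<or> p = []; b \<in> carrier (G v); b \<noteq> \<one>\<^bsub>G v\<^esub>\<rbrakk>
    \<Longrightarrow> p @ tm x @ [(v, b)] \<in> heads"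

definition pfx :: "('v \<times> 'a) list \<Rightarrow> ('v \<times> 'a) list" where
  "pfx x = rev (dropWhile (\<lambda>l. fst l \<noteq> v) (rev x))"

definition sfx :: "('v \<times> 'a) list \<Rightarrow> ('v \<times> 'a) list" where
  "sfx x = rev (takeWhile (\<lambda>l. fst l \<noteq> v) (rev x))"

definition N' :: "('v \<times> 'a) list set" where
  "N' = {p @ h | p h. p \<in> heads \<and> h \<in> N}"

text \<open>Representatives of the cosets of \<open>G v\<close>. If \<open>tm h\<close> is empty,
  then \<open>h\<close> lies in \<open>L\<close> and commutes with \<open>G v\<close>, so that the
  last letter of a nonempty \<open>p\<close> could still be altered from the right; these words are
  excluded.\<close>

definition base :: "('v \<times> 'a) list set" where
  "base = {p @ h | p h. p \<in> heads \<and> h \<in> N \<and> (tm h \<noteq> [] \<or> p = [])}"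

text \<open>The product of \<open>m\<close> with the letter \<open>a\<close>, where the component of
  the last syllable in \<open>L\<close> has been moved behind the new letter.\<close>

definition ext :: "('v \<times> 'a) list \<Rightarrow> 'a \<Rightarrow> ('v \<times> 'a) list" where
  "ext m a = (if a = \<one>\<^bsub>G v\<^esub> then m else pfx m @ tm (sfx m) @ [(v, a)] @ cp (sfx m))"

definition coords :: "('v \<times> 'a) list \<Rightarrow> ('v \<times> 'a) list \<times> 'a" where
  "coords x = (SOME (m, a). m \<in> base \<and> a \<in> carrier (G v) \<and> x = ext m a)"

definition \<phi>' :: "('v \<times> 'a) list \<Rightarrow> 'v \<Rightarrow> 'a \<Rightarrow> ('v \<times> 'a) list" where
  "\<phi>' x w b = (if w = v then case coords x of (m, a) \<Rightarrow> ext m (a \<otimes>\<^bsub>G v\<^esub> b)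
     else pfx x @ \<phi> (sfx x) w b)"

lemma v_notin_N: "x \<in> N \<Longrightarrow> l \<in> set x \<Longrightarrow> fst l \<noteq> v"
  using N_U v_U by blast

text \<open>A nonempty head ends with a letter of \<open>v\<close>, and the words in
  \<open>N\<close> contain none, so the split behind the last such letter is unambiguous.\<close>

lemma pfx_sfx:
  assumes "p \<in> heads" "h \<in> N"
  shows pfx_append: "pfx (p @ h) = p" and sfx_append: "sfx (p @ h) = h"
proof -
  have h: "fst l \<noteq> v" if "l \<in> set (rev h)" for l
    using that v_notin_N[OF assms(2)] by simp
  have "p = [] \<or> (\<exists>q b. p = q @ [(v, b)])"
    using assms(1) by cases auto
  then show "pfx (p @ h) = p" "sfx (p @ h) = h"
    using dropWhile_append2[of "rev h" "\<lambda>l. fst l \<noteq> v" "rev p", OF h]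
      takeWhile_append2[of "rev h" "\<lambda>l. fst l \<noteq> v" "rev p", OF h]
    by (auto simp: pfx_def sfx_def)
qed

lemma heads_words: "p \<in> heads \<Longrightarrow> p \<in> words"
  by (induction rule: heads.induct) (use tm_N N_words v_V in auto)

lemma heads_U: "p \<in> heads \<Longrightarrow> fst ` set p \<subseteq> insert v U"
  by (induction rule: heads.induct) (use tm_N N_U in fastforce)+

lemma N'_cases:
  assumes "x \<in> N'"
  obtains p h where "p \<in> heads" "h \<in> N" "x = p @ h" "pfx x = p" "sfx x = h"
  using assms pfx_sfx by (auto simp: N'_def)

lemma base_cases:
  assumes "m \<in> base"
  obtains p h where "p \<in> heads" "h \<in> N" "m = p @ h" "pfx m = p" "sfx m = h" "tm h \<noteq> [] \<or> p = []"
  using assms pfx_sfx by (fastforce simp: base_def)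

lemma N'I: "\<lbrakk>p \<in> heads; h \<in> N\<rbrakk> \<Longrightarrow> p @ h \<in> N'"
  by (auto simp: N'_def)

lemma baseI: "\<lbrakk>p \<in> heads; h \<in> N; tm h \<noteq> [] \<or> p = []\<rbrakk> \<Longrightarrow> p @ h \<in> base"
  unfolding base_def by blast

lemma base_N': "base \<subseteq> N'"
  by (auto simp: base_def N'_def)

lemma pfx_sfx_ext:
  assumes "m \<in> base" "a \<in> carrier (G v)" "a \<noteq> \<one>\<^bsub>G v\<^esub>"
  shows "pfx (ext m a) = pfx m @ tm (sfx m) @ [(v, a)]" "sfx (ext m a) = cp (sfx m)"
    "pfx (ext m a) \<in> heads" "ext m a = pfx (ext m a) @ sfx (ext m a)"
proof -
  obtain p h where m: "p \<in> heads" "h \<in> N" "m = p @ h" "pfx m = p" "sfx m = h" "tm h \<noteq> [] \<or> p = []"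
    using base_cases assms(1) by blast
  have q: "p @ tm h @ [(v, a)] \<in> heads" using m assms by (intro heads.step)
  have e: "ext m a = (p @ tm h @ [(v, a)]) @ cp h" using assms m by (simp add: ext_def)
  show 1: "pfx (ext m a) = pfx m @ tm (sfx m) @ [(v, a)]" and 2: "sfx (ext m a) = cp (sfx m)"
    unfolding e using pfx_sfx[OF q cp_N[OF m(2)]] m by simp_all
  show "pfx (ext m a) \<in> heads" using 1 q m by simp
  show "ext m a = pfx (ext m a) @ sfx (ext m a)" unfolding 1 2 using e m by simp
qed

lemma ext_N':
  assumes "m \<in> base" "a \<in> carrier (G v)"
  shows "ext m a \<in> N'"
proof (cases "a = \<one>\<^bsub>G v\<^esub>")
  case True
  then show ?thesis using assms base_N' by (auto simp: ext_def)
next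
  case False
  moreover have "cp (sfx m) \<in> N" using assms(1) base_cases cp_N by metis
  moreover note e = pfx_sfx_ext[OF assms False]
  ultimately have "pfx (ext m a) @ sfx (ext m a) \<in> N'"
    unfolding e(2) using N'I[OF e(3)] by blast
  then show ?thesis by (subst e(4))
qed

text \<open>Together with \<open>ext_surj\<close> this identifies \<open>N'\<close> with the product
  of \<open>base\<close> and \<open>G v\<close>. In these coordinates multiplication by
  \<open>G v\<close> is the regular action on the second factor, which makes its laws
  immediate.\<close>

lemma ext_inj:
  assumes m: "m \<in> base" "m' \<in> base" and a: "a \<in> carrier (G v)" "a' \<in> carrier (G v)"
    and eq: "ext m a = ext m' a'"
  shows "m = m' \<and> a = a'"
proof -
  \<comment> \<open>What follows the last letter of \<open>v\<close> lies in \<open>L\<close>, so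
    the word is outside \<open>base\<close>: the word alone shows whether its second coordinate is
    trivial.\<close>
  have not_base: "ext n b \<notin> base" if n: "n \<in> base" "b \<in> carrier (G v)" "b \<noteq> \<one>\<^bsub>G v\<^esub>" for n b
  proof
    assume "ext n b \<in> base"
    then have "tm (sfx (ext n b)) \<noteq> [] \<or> pfx (ext n b) = []"
      using base_cases by metis
    moreover have "sfx n \<in> N" using n(1) base_cases by metis
    ultimately show False using pfx_sfx_ext[OF n] tm_cp by simp
  qed
  show ?thesis
  proof (cases "a = \<one>\<^bsub>G v\<^esub> \<or> a' = \<one>\<^bsub>G v\<^esub>")
    case True
    moreover have one: "ext n (\<one>\<^bsub>G v\<^esub>) = n" for n by (simp add: ext_def)
    ultimately have "a = \<one>\<^bsub>G v\<^esub> \<and> a' = \<one>\<^bsub>G v\<^esub>"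
    proof (elim disjE)
      assume "a = \<one>\<^bsub>G v\<^esub>"
      then show ?thesis using not_base[OF m(2) a(2)] m eq one by auto
    next
      assume "a' = \<one>\<^bsub>G v\<^esub>"
      then show ?thesis using not_base[OF m(1) a(1)] m eq one by auto
    qed
    then show ?thesis using eq one by simp
  next
    case False
    obtain p h where p: "p \<in> heads" "h \<in> N" "m = p @ h" "pfx m = p" "sfx m = h"
      using base_cases m by metis
    obtain p' h' where p': "p' \<in> heads" "h' \<in> N" "m' = p' @ h'" "pfx m' = p'" "sfx m' = h'"
      using base_cases m by metis
    have "p @ tm h @ [(v, a)] = p' @ tm h' @ [(v, a')]" and c: "cp h = cp h'"
      using pfx_sfx_ext(1,2)[of m a] pfx_sfx_ext(1,2)[of m' a'] m a eq False p p' by simp_all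
    then have "a = a'" and q: "p @ tm h = p' @ tm h'"
      by (simp_all flip: append_assoc)
    have "p = p'" "tm h = tm h'"
      using pfx_sfx[OF p(1) tm_N[OF p(2)]] pfx_sfx[OF p'(1) tm_N[OF p'(2)]] q by simp_all
    then show ?thesis using tm_cp_inj[OF p(2) p'(2)] c p p' \<open>a = a'\<close> by simp
  qed
qed

lemma ext_surj:
  assumes "x \<in> N'"
  obtains m a where "m \<in> base" "a \<in> carrier (G v)" "x = ext m a"
proof -
  obtain p h where x: "p \<in> heads" "h \<in> N" "x = p @ h"
    using N'_cases[OF assms] by metis
  show ?thesis
  proof (cases "tm h \<noteq> [] \<or> p = []")
    case True
    then have "x \<in> base" using x baseI by blast
    then show ?thesis using that[of x "\<one>\<^bsub>G v\<^esub>"] by (simp add: ext_def)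
  next
    case False
    \<comment> \<open>Here \<open>h\<close> lies in \<open>L\<close> and \<open>p\<close> ends with
      a letter of \<open>v\<close>. This letter becomes the second coordinate, and \<open>h\<close>
      is attached again to the coset representative in front of it.\<close>
    from x(1) False obtain q y b where q: "p = q @ tm y @ [(v, b)]" "q \<in> heads" "y \<in> N"
      "tm y \<noteq> [] \<or> q = []" "b \<in> carrier (G v)" "b \<noteq> \<one>\<^bsub>G v\<^esub>"
      by cases auto
    obtain z where z: "z \<in> N" "tm z = tm y" "cp z = cp h" using tm_cp_surj q x by blast
    have "cp h = h"
      using False x by (intro tm_cp_inj[OF cp_N[OF x(2)] x(2)]) (simp_all add: tm_cp cp_cp)
    then have "x = ext (q @ z) b" using q x z pfx_sfx[of q z] by (simp add: ext_def)
    moreover have "q @ z \<in> base" using q z by (intro baseI) auto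
    ultimately show ?thesis using that q by blast
  qed
qed

lemma coords_ext: "\<lbrakk>m \<in> base; a \<in> carrier (G v)\<rbrakk> \<Longrightarrow> coords (ext m a) = (m, a)"
  unfolding coords_def by (rule some_equality) (auto dest: ext_inj)

lemma act_ext:
  "\<lbrakk>m \<in> base; a \<in> carrier (G v); b \<in> carrier (G v)\<rbrakk> \<Longrightarrow> \<phi>' (ext m a) v b = ext m (a \<otimes>\<^bsub>G v\<^esub> b)"
  by (simp add: \<phi>'_def coords_ext)

lemma act_append:
  "\<lbrakk>p \<in> heads; h \<in> N; w \<in> U\<rbrakk> \<Longrightarrow> \<phi>' (p @ h) w b = p @ \<phi> h w b"
  using v_U by (auto simp: \<phi>'_def pfx_sfx)

text \<open>A neighbour of \<open>v\<close> changes only the component in \<open>L\<close> and never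
  the coset representative. Hence it acts on the first coordinate alone and commutes with
  \<open>G v\<close>.\<close>

lemma act_ext_nbr:
  assumes m: "m \<in> base" and a: "a \<in> carrier (G v)" and w: "w \<in> U" "{v, w} \<in> E" and g: "g \<in> carrier (G w)"
  shows "\<phi>' m w g \<in> base" "\<phi>' (ext m a) w g = ext (\<phi>' m w g) a"
proof -
  obtain p h where p: "p \<in> heads" "h \<in> N" "m = p @ h" "pfx m = p" "sfx m = h" "tm h \<noteq> [] \<or> p = []"
    using base_cases m by metis
  have m': "\<phi>' m w g = p @ \<phi> h w g" using act_append p w by simp
  have h': "\<phi> h w g \<in> N" using act_closed p w g by blast
  then show "\<phi>' m w g \<in> base"
    using p tm_nbr[OF p(2) w g] unfolding m' by (intro baseI) auto
  show "\<phi>' (ext m a) w g = ext (\<phi>' m w g) a"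
  proof (cases "a = \<one>\<^bsub>G v\<^esub>")
    case False
    note e = pfx_sfx_ext[OF m a False]
    have "\<phi>' (ext m a) w g = pfx (ext m a) @ \<phi> (cp h) w g"
      using e p w v_U by (auto simp: \<phi>'_def)
    also have "\<dots> = ext (\<phi>' m w g) a"
      using False p e pfx_sfx[OF p(1) h'] by (simp add: act_append[OF p(1,2) w(1)] ext_def tm_nbr[OF p(2) w g] cp_nbr[OF p(2) w g])
    finally show ?thesis .
  qed (simp add: ext_def)
qed

lemma length_ext:
  assumes "m \<in> base" "a \<in> carrier (G v)" "a \<noteq> \<one>\<^bsub>G v\<^esub>"
  shows "length (ext m a) = length m + 1"
proof -
  obtain p h where p: "p \<in> heads" "h \<in> N" "m = p @ h" "pfx m = p" "sfx m = h"
    using base_cases assms(1) by metis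
  then show ?thesis using length_tm_cp[of h] assms by (simp add: ext_def)
qed

text \<open>The constant covers two cases. If both letters are nontrivial, only the letter of
  \<open>v\<close> and a component of length at most 1 follow the common prefix. If one of them is
  trivial, \<open>tm\<close> disturbs up to \<open>C\<close> letters, and the letter of
  \<open>v\<close> may add one.\<close>

lemma ext_stable:
  assumes m: "m \<in> base" and a: "a \<in> carrier (G v)" "b \<in> carrier (G v)"
  shows "\<exists>z. prefix z (ext m a) \<and> prefix z (ext m b) \<and> length (ext m a) \<le> length z + (C + 2)"
proof -
  obtain p h where p: "p \<in> heads" "h \<in> N" "m = p @ h" "pfx m = p" "sfx m = h"
    using base_cases m by metis
  have ext: "ext m c = p @ tm h @ [(v, c)] @ cp h" if "c \<noteq> \<one>\<^bsub>G v\<^esub>" for c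
    using that p by (simp add: ext_def)
  have one: "ext m (\<one>\<^bsub>G v\<^esub>) = p @ h" using p by (simp add: ext_def)
  have len: "length h = length (tm h) + length (cp h)" "length (cp h) \<le> 1"
    using length_tm_cp length_cp p by auto
  obtain z where z: "prefix z h" "prefix z (tm h)" "length h \<le> length z + C"
    using tm_stable p by blast
  have z': "prefix (p @ z) (p @ tm h @ y)" for y
    using z(2) by (auto simp: prefix_def)
  show ?thesis
  proof (cases "a = \<one>\<^bsub>G v\<^esub>"; cases "b = \<one>\<^bsub>G v\<^esub>")
    assume "a = \<one>\<^bsub>G v\<^esub>" "b = \<one>\<^bsub>G v\<^esub>"
    then show ?thesis by auto
  next
    assume "a = \<one>\<^bsub>G v\<^esub>" "b \<noteq> \<one>\<^bsub>G v\<^esub>"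
    then show ?thesis using ext z z' one by (intro exI[of _ "p @ z"]) auto
  next
    assume "a \<noteq> \<one>\<^bsub>G v\<^esub>" "b = \<one>\<^bsub>G v\<^esub>"
    then show ?thesis using ext z z' one len by (intro exI[of _ "p @ z"]) auto
  next
    assume "a \<noteq> \<one>\<^bsub>G v\<^esub>" "b \<noteq> \<one>\<^bsub>G v\<^esub>"
    then show ?thesis using ext len by (intro exI[of _ "p @ tm h"]) auto
  qed
qed

lemma ext_ev:
  assumes m: "m \<in> base" and a: "a \<in> carrier (G v)"
  shows "ev (ext m a) = ev m \<otimes>\<^bsub>P\<^esub> ev [(v, a)]"
proof -
  obtain p h where p: "p \<in> heads" "h \<in> N" "m = p @ h" "pfx m = p" "sfx m = h"
    using base_cases m by metis
  have w: "p \<in> words" "h \<in> words" using heads_words N_words p by auto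
  show ?thesis
  proof (cases "a = \<one>\<^bsub>G v\<^esub>")
    case True
    then show ?thesis using w p v_V ev_closed by (simp add: ext_def ev_letter_one)
  next
    case False
    have "ev (ext m a) = ev p \<otimes>\<^bsub>P\<^esub> ev (tm h @ [(v, a)] @ cp h)"
      using p w a v_V tm_N cp_N N_words False by (subst ev_append[symmetric]) (auto simp: ext_def)
    also have "\<dots> = ev p \<otimes>\<^bsub>P\<^esub> (ev h \<otimes>\<^bsub>P\<^esub> ev [(v, a)])"
      using tm_ev p a by simp
    also have "\<dots> = ev m \<otimes>\<^bsub>P\<^esub> ev [(v, a)]"
      using w p a v_V by (simp add: P.m_assoc ev_closed ev_append)
    finally show ?thesis .
  qed
qed

lemma nf_system_extension: "nf_system V E G (insert v U) N' \<phi>' (C + 2)"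
proof
  show "{u, u} \<notin> E" for u by (rule irrefl)
  show "insert v U \<subseteq> V" using U_V v_V by simp
  show "[] \<in> N'" using Nil_N heads.Nil by (force simp: N'_def)
  show "x \<in> words" if "x \<in> N'" for x
    using that by (auto simp: N'_def heads_words N_words)
  show "fst ` set x \<subseteq> insert v U" if "x \<in> N'" for x
    using that heads_U N_U by (fastforce simp: N'_def)
next
  fix x w g assume x: "x \<in> N'" and w: "w \<in> insert v U" and g: "g \<in> carrier (G w)"
  obtain p h where p: "p \<in> heads" "h \<in> N" "x = p @ h"
    using N'_cases[OF x] by metis
  obtain m a where m: "m \<in> base" "a \<in> carrier (G v)" "x = ext m a"
    using ext_surj[OF x] by metis
  show "\<phi>' x w g \<in> N'"
  proof (cases "w = v")
    case True
    then show ?thesis using m g by (simp add: act_ext ext_N')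
  next
    case False
    then have "\<phi> h w g \<in> N" using p w g act_closed by auto
    then show ?thesis using False p w g by (auto simp: act_append N'_def)
  qed
  show "\<exists>z. prefix z x \<and> prefix z (\<phi>' x w g) \<and> length x \<le> length z + (C + 2)"
  proof (cases "w = v")
    case True
    then show ?thesis using m g ext_stable by (simp add: act_ext)
  next
    case False
    then obtain z where "prefix z h" "prefix z (\<phi> h w g)" "length h \<le> length z + C"
      using act_stable p w g by blast
    then show ?thesis using False w p by (intro exI[of _ "p @ z"]) (auto simp: act_append)
  qed
  show "ev (\<phi>' x w g) = ev x \<otimes>\<^bsub>P\<^esub> ev [(w, g)]"
  proof (cases "w = v")
    case True
    have "ev m \<in> carrier P" using m base_cases heads_words N_words ev_closed by (metis words_simps(3))
    then show ?thesis
      using m g True v_V by (simp add: act_ext ext_ev P.m_assoc ev_closed ev_mult)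
  next
    case False
    then have w: "w \<in> U" "w \<in> V" using w U_V by auto
    then have "ev (\<phi>' x w g) = ev p \<otimes>\<^bsub>P\<^esub> ev (\<phi> h w g)"
      using p g act_closed by (simp add: act_append ev_append heads_words N_words)
    then show ?thesis
      using w p g by (simp add: act_ev ev_append heads_words N_words P.m_assoc ev_closed)
  qed
next
  fix x w assume x: "x \<in> N'" and w: "w \<in> insert v U"
  obtain p h where p: "p \<in> heads" "h \<in> N" "x = p @ h"
    using N'_cases[OF x] by metis
  obtain m a where m: "m \<in> base" "a \<in> carrier (G v)" "x = ext m a"
    using ext_surj[OF x] by metis
  show "\<phi>' x w (\<one>\<^bsub>G w\<^esub>) = x"
  proof (cases "w = v")
    case True
    then show ?thesis using m by (simp add: act_ext)
  next
    case False
    then show ?thesis using p w by (simp add: act_append act_one)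
  qed
  show "\<exists>t\<in>N'. \<exists>g\<in>carrier (G w). x = \<phi>' t w g \<and>
      (\<forall>h\<in>carrier (G w). h \<noteq> \<one>\<^bsub>G w\<^esub> \<longrightarrow> length (\<phi>' t w h) = length t + 1)"
  proof (cases "w = v")
    case True
    have "\<phi>' m v b = ext m b" if "b \<in> carrier (G v)" for b
      using act_ext[OF m(1) Gv.one_closed that] that by (simp add: ext_def)
    then show ?thesis
      using True m base_N' length_ext by (intro bexI[of _ m] bexI[of _ a]) auto
  next
    case False
    then obtain t g where "t \<in> N" "g \<in> carrier (G w)" "h = \<phi> t w g"
      "\<And>b. b \<in> carrier (G w) \<Longrightarrow> b \<noteq> \<one>\<^bsub>G w\<^esub> \<Longrightarrow> length (\<phi> t w b) = length t + 1"
      using act_min[OF p(2), of w] w by blast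
    then show ?thesis
      using False w p by (intro bexI[of _ "p @ t"] bexI[of _ g]) (auto simp: act_append N'_def)
  qed
next
  fix x w g h assume x: "x \<in> N'" and w: "w \<in> insert v U" and g: "g \<in> carrier (G w)" and h: "h \<in> carrier (G w)"
  obtain p y where p: "p \<in> heads" "y \<in> N" "x = p @ y"
    using N'_cases[OF x] by metis
  obtain m a where m: "m \<in> base" "a \<in> carrier (G v)" "x = ext m a"
    using ext_surj[OF x] by metis
  show "\<phi>' (\<phi>' x w g) w h = \<phi>' x w (g \<otimes>\<^bsub>G w\<^esub> h)"
  proof (cases "w = v")
    case True
    then show ?thesis using m g h by (simp add: act_ext Gv.m_assoc)
  next
    case False
    then show ?thesis using p w g h by (simp add: act_append act_closed act_mult)
  qed
next
  fix x u w g h assume x: "x \<in> N'" and u: "u \<in> insert v U" and w: "w \<in> insert v U" and uw: "{u, w} \<in> E"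
    and g: "g \<in> carrier (G u)" and h: "h \<in> carrier (G w)"
  obtain p y where p: "p \<in> heads" "y \<in> N" "x = p @ y"
    using N'_cases[OF x] by metis
  obtain m a where m: "m \<in> base" "a \<in> carrier (G v)" "x = ext m a"
    using ext_surj[OF x] by metis
  have "u \<noteq> w" using uw irrefl by blast
  then consider "u = v" "w \<in> U" "{v, w} \<in> E" | "w = v" "u \<in> U" "{v, u} \<in> E" | "u \<in> U" "w \<in> U"
    using u w uw by (auto simp: insert_commute)
  then show "\<phi>' (\<phi>' x u g) w h = \<phi>' (\<phi>' x w h) u g"
  proof cases
    case 1
    then show ?thesis using m g h by (simp add: act_ext act_ext_nbr)
  next
    case 2
    then show ?thesis using m g h by (simp add: act_ext act_ext_nbr)
  next
    case 3
    then show ?thesis using p g h act_comm[OF p(2) 3 uw g h] by (simp add: act_append act_closed)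
  qed
qed

end

section \<open>Adjoining an isolated vertex or a leaf\<close>

context nf_system begin

text \<open>Here \<open>L\<close> is trivial, and the amalgam is the free product with
  \<open>G v\<close>.\<close>

lemma nf_system_insert_isolated:
  assumes v: "v \<in> V" "v \<notin> U" and nbr: "\<And>w. w \<in> U \<Longrightarrow> {v, w} \<notin> E"
  shows "\<exists>N \<phi> C. nf_system V E G (insert v U) N \<phi> C"
proof -
  interpret nf_extension V E G U N \<phi> C v "\<lambda>x. x" "\<lambda>_. []"
    by unfold_locales (use v nbr Nil_N N_words in \<open>auto simp: ev_append\<close>)
  show ?thesis using nf_system_extension by blast
qed

definition shortest :: "'v \<Rightarrow> ('v \<times> 'a) list \<Rightarrow> bool" where
  "shortest u t \<longleftrightarrow> t \<in> N \<and>
     (\<forall>h\<in>carrier (G u). h \<noteq> \<one>\<^bsub>G u\<^esub> \<longrightarrow> length (\<phi> t u h) = length t + 1)"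

text \<open>If two shortest representatives of a coset differed by a nontrivial letter, each would
  be longer than the other by one.\<close>

lemma shortest_unique:
  assumes u: "u \<in> U" and t: "shortest u t" "shortest u t'"
    and g: "g \<in> carrier (G u)" "g' \<in> carrier (G u)" and eq: "\<phi> t u g = \<phi> t' u g'"
  shows "t = t' \<and> g = g'"
proof -
  interpret Gu: group "G u" using group_G u U_V by blast
  define k where "k = g \<otimes>\<^bsub>G u\<^esub> inv\<^bsub>G u\<^esub> g'"
  have k: "k \<in> carrier (G u)" using g by (simp add: k_def)
  have tN: "t \<in> N" "t' \<in> N" using t by (auto simp: shortest_def)
  have "\<phi> t u k = \<phi> (\<phi> t u g) u (inv\<^bsub>G u\<^esub> g')" using act_mult tN u g by (simp add: k_def)
  also have "\<dots> = t'" using act_mult act_one tN u g by (simp add: eq)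
  finally have 1: "t' = \<phi> t u k" by simp
  then have 2: "t = \<phi> t' u (inv\<^bsub>G u\<^esub> k)" using act_mult act_one tN u k by simp
  have k1: "k = \<one>\<^bsub>G u\<^esub>"
  proof (rule ccontr)
    assume "k \<noteq> \<one>\<^bsub>G u\<^esub>"
    then have "length t' = length t + 1" "length t = length t' + 1"
      using 1 2 t k unfolding shortest_def by (metis, metis Gu.inv_closed Gu.inv_eq_1_iff)
    then show False by simp
  qed
  have "g = g'"
    using k1 g Gu.inv_equality[of g "inv\<^bsub>G u\<^esub> g'"] by (simp add: k_def)
  moreover have "t = t'" using 1 k1 act_one tN u by simp
  ultimately show ?thesis by simp
qed

text \<open>Here \<open>L\<close> is the vertex group of \<open>u\<close>, and
  \<open>act_min\<close> supplies the representatives of its cosets.\<close>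

lemma nf_system_insert_leaf:
  assumes v: "v \<in> V" "v \<notin> U" and u: "u \<in> U" and vu: "{v, u} \<in> E"
    and nbr: "\<And>w. w \<in> U \<Longrightarrow> {v, w} \<in> E \<Longrightarrow> w = u"
  shows "\<exists>N \<phi> C. nf_system V E G (insert v U) N \<phi> C"
proof -
  interpret Gu: group "G u" using group_G u U_V by blast
  define sp where "sp x = (SOME (t, g). shortest u t \<and> g \<in> carrier (G u) \<and> x = \<phi> t u g)" for x
  have sp_act: "sp (\<phi> t u g) = (t, g)" if "shortest u t" "g \<in> carrier (G u)" for t g
    unfolding sp_def
  proof (rule some_equality)
    show "case (t, g) of (t', g') \<Rightarrow> shortest u t' \<and> g' \<in> carrier (G u) \<and> \<phi> t u g = \<phi> t' u g'"
      using that by simp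
  next
    fix y assume "case y of (t', g') \<Rightarrow> shortest u t' \<and> g' \<in> carrier (G u) \<and> \<phi> t u g = \<phi> t' u g'"
    then show "y = (t, g)"
      using shortest_unique[OF u that(1) _ that(2)] by (cases y) force
  qed
  have ex: "\<exists>t g. shortest u t \<and> g \<in> carrier (G u) \<and> x = \<phi> t u g" if "x \<in> N" for x
    using act_min[OF that u] unfolding shortest_def by blast
  have short_N: "t \<in> N" if "shortest u t" for t using that by (simp add: shortest_def)
  have short_Nil: "shortest u []"
  proof -
    obtain t g where t: "shortest u t" "g \<in> carrier (G u)" "[] = \<phi> t u g"
      using ex[OF Nil_N] by blast
    then have "g = \<one>\<^bsub>G u\<^esub>"
      using t(3)[symmetric] by (auto simp: shortest_def)
    then show ?thesis using t act_one u short_N by simp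
  qed
  have act1: "\<phi> t u (\<one>\<^bsub>G u\<^esub>) = t" if "t \<in> N" for t using act_one u that by simp
  define tm where "tm x = fst (sp x)" for x
  \<comment> \<open>The component is kept as the normal form of the element of \<open>G u\<close>
    instead of a bare letter. So it lies in \<open>N\<close>, and its behaviour under further
    letters of \<open>u\<close> follows from \<open>act_mult\<close>.\<close>
  define cp where "cp x = \<phi> [] u (snd (sp x))" for x
  have tm_act: "tm (\<phi> t u g) = t" and cp_act: "cp (\<phi> t u g) = \<phi> [] u g"
    if "shortest u t" "g \<in> carrier (G u)" for t g
    using sp_act[OF that] by (simp_all add: tm_def cp_def)
  have tm_short: "tm t = t" "cp t = []" if "shortest u t" for t
    using tm_act[OF that Gu.one_closed] cp_act[OF that Gu.one_closed] act1 short_N[OF that] Nil_N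
    by simp_all
  have len: "length (\<phi> t u g) = length t + (if g = \<one>\<^bsub>G u\<^esub> then 0 else 1)"
    if "shortest u t" "g \<in> carrier (G u)" for t g
    using that act1 by (auto simp: shortest_def)
  have vuw: "w = u" if "w \<in> U" "{v, w} \<in> E" for w using nbr that by blast
  interpret nf_extension V E G U N \<phi> C v tm cp
  proof
    show "v \<in> V" "v \<notin> U" by fact+
  next
    fix x assume "x \<in> N"
    then obtain t g where x: "shortest u t" "g \<in> carrier (G u)" "x = \<phi> t u g" using ex by blast
    have t: "t \<in> N" "t \<in> words" using short_N[OF x(1)] N_words by auto
    have cg: "\<phi> [] u g \<in> N" using act_closed Nil_N u x(2) by blast
    note x_simps = x(3) tm_act[OF x(1,2)] cp_act[OF x(1,2)]
    show "tm x \<in> N" "cp x \<in> N" using t cg by (simp_all add: x_simps)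
    show "tm (tm x) = tm x" "cp (tm x) = []" using tm_short[OF x(1)] by (simp_all add: x_simps)
    show "tm (cp x) = []" "cp (cp x) = cp x"
      using tm_act[OF short_Nil x(2)] cp_act[OF short_Nil x(2)] by (simp_all add: x_simps)
    show "length x = length (tm x) + length (cp x)" "length (cp x) \<le> 1"
      using len[OF x(1,2)] len[OF short_Nil x(2)] by (simp_all add: x_simps)
    show "\<exists>z. prefix z x \<and> prefix z (tm x) \<and> length x \<le> length z + C"
    proof -
      \<comment> \<open>Passing to the representative is multiplication by a single letter of
        \<open>u\<close>, so \<open>act_stable\<close> applies with the same
        \<open>C\<close>.\<close>
      have "tm x = \<phi> x u (inv\<^bsub>G u\<^esub> g)"
        using act_mult[OF t(1) u x(2)] x(2) act1[OF t(1)] by (simp add: x_simps)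
      then show ?thesis using act_stable[OF \<open>x \<in> N\<close> u, of "inv\<^bsub>G u\<^esub> g"] x(2) by simp
    qed
    show "tm (\<phi> x w h) = tm x" "cp (\<phi> x w h) = \<phi> (cp x) w h"
      if w: "w \<in> U" "{v, w} \<in> E" and h: "h \<in> carrier (G w)" for w h
    proof -
      have "w = u" using vuw w by blast
      then have h: "h \<in> carrier (G u)" using h by simp
      have "\<phi> x u h = \<phi> t u (g \<otimes>\<^bsub>G u\<^esub> h)" using act_mult t u x h by simp
      moreover have "\<phi> (\<phi> [] u g) u h = \<phi> [] u (g \<otimes>\<^bsub>G u\<^esub> h)" using act_mult Nil_N u x h by simp
      ultimately show "tm (\<phi> x w h) = tm x" "cp (\<phi> x w h) = \<phi> (cp x) w h"
        using tm_act[OF x(1), of "g \<otimes>\<^bsub>G u\<^esub> h"] cp_act[OF x(1), of "g \<otimes>\<^bsub>G u\<^esub> h"] x(2) h \<open>w = u\<close>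
        by (simp_all add: tm_act[OF x(1,2)] cp_act[OF x(1,2)]) (simp_all add: x(3) cp_act[OF x(1,2)] tm_act[OF x(1,2)])
    qed
    show "ev (tm x @ [(v, a)] @ cp x) = ev x \<otimes>\<^bsub>P\<^esub> ev [(v, a)]" if a: "a \<in> carrier (G v)" for a
    proof -
      have uV: "u \<in> V" using u U_V by blast
      have l: "ev t \<in> carrier P" "ev [(v, a)] \<in> carrier P" "ev [(u, g)] \<in> carrier P"
        using t v uV a x by (auto intro!: ev_closed)
      have "ev (\<phi> [] u g) = ev [(u, g)]" using act_ev[OF Nil_N u x(2)] l by (simp add: ev_Nil)
      then have "ev (tm x @ [(v, a)] @ cp x) = ev t \<otimes>\<^bsub>P\<^esub> (ev [(v, a)] \<otimes>\<^bsub>P\<^esub> ev [(u, g)])"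
        using t v a N_words[OF cg] by (simp add: x_simps ev_append ev_Cons[of v a "\<phi> [] u g"])
      also have "\<dots> = ev t \<otimes>\<^bsub>P\<^esub> (ev [(u, g)] \<otimes>\<^bsub>P\<^esub> ev [(v, a)])"
        using ev_commute[OF v(1) uV vu a x(2)] by simp
      also have "\<dots> = ev x \<otimes>\<^bsub>P\<^esub> ev [(v, a)]"
        using l act_ev[OF t(1) u x(2)] by (simp add: x(3) P.m_assoc)
      finally show ?thesis .
    qed
    fix y assume "y \<in> N"
    then obtain s h where y: "shortest u s" "h \<in> carrier (G u)" "y = \<phi> s u h" using ex by blast
    note y_simps = y(3) tm_act[OF y(1,2)] cp_act[OF y(1,2)]
    show "x = y" if eq: "tm x = tm y" "cp x = cp y"
    proof -
      have "t = s" using eq(1) unfolding x_simps y_simps .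
      moreover have "\<phi> [] u g = \<phi> [] u h" using eq(2) unfolding x_simps y_simps .
      ultimately show ?thesis
        using shortest_unique[OF u short_Nil short_Nil x(2) y(2)] x(3) y(3) by blast
    qed
    show "\<exists>z\<in>N. tm z = tm x \<and> cp z = cp y"
      unfolding x_simps y_simps using tm_act[OF x(1) y(2)] cp_act[OF x(1) y(2)] act_closed[OF t(1) u y(2)]
      by blast
  qed
  show ?thesis using nf_system_extension by blast
qed

end

context vertex_groups begin

lemma nf_system_empty:
  assumes "\<And>u. {u, u} \<notin> E"
  shows "nf_system V E G {} {[]} (\<lambda>x w g. x) 0"
  by unfold_locales (use assms in auto)

text \<open>The condition \<open>degenerate\<close> is the form in which a forest enters: a vertex
  with at most one neighbour is taken away and adjoined again after the rest has been treated. The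
  constant of stability grows by 2 with each vertex.\<close>

lemma ex_nf_system:
  assumes irrefl: "\<And>u. {u, u} \<notin> E"
    and degenerate: "\<And>U. \<lbrakk>U \<subseteq> V; U \<noteq> {}\<rbrakk> \<Longrightarrow>
      \<exists>v\<in>U. \<forall>u\<in>U. \<forall>w\<in>U. {v, u} \<in> E \<longrightarrow> {v, w} \<in> E \<longrightarrow> u = w"
    and U: "finite U" "U \<subseteq> V"
  shows "\<exists>N \<phi> C. nf_system V E G U N \<phi> C"
  using U
proof (induction U rule: finite_psubset_induct)
  case (psubset U)
  show ?case
  proof (cases "U = {}")
    case True
    then show ?thesis using nf_system_empty[OF irrefl] by blast
  next
    case False
    obtain v where v: "v \<in> U" "\<forall>u\<in>U. \<forall>w\<in>U. {v, u} \<in> E \<longrightarrow> {v, w} \<in> E \<longrightarrow> u = w"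
      using degenerate[OF psubset.prems False] by (rule bexE)
    define U' where "U' = U - {v}"
    have U: "U = insert v U'" "v \<notin> U'" "v \<in> V" unfolding U'_def using v(1) psubset.prems by blast+
    obtain N \<phi> C where "nf_system V E G U' N \<phi> C"
      using psubset.IH[of U'] v(1) psubset.prems unfolding U'_def by blast
    then interpret nf_system V E G U' N \<phi> C .
    show ?thesis
    proof (cases "\<exists>u\<in>U'. {v, u} \<in> E")
      case True
      then obtain u where "u \<in> U'" "{v, u} \<in> E" by blast
      then show ?thesis
        unfolding U(1) using U(2,3) v(2)
        by (intro nf_system_insert_leaf[of v u]) (auto simp: U(1))
    next
      case False
      then show ?thesis
        unfolding U(1) using U(2,3) by (intro nf_system_insert_isolated) auto
    qed
  qed
qed

end

section \<open>Finiteness and hyperbolicity of graph products\<close>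

context vertex_groups begin

text \<open>With all elements of the vertex groups as generators, word length counts the letters of
  words over the vertex groups, which is what makes the normal forms geodesic.\<close>

definition gens :: "('v \<times> 'a) list set set set" where
  "gens = {ev [(v, g)] | v g. v \<in> V \<and> g \<in> carrier (G v)}"

lemma gensI: "\<lbrakk>v \<in> V; g \<in> carrier (G v)\<rbrakk> \<Longrightarrow> ev [(v, g)] \<in> gens"
  by (auto simp: gens_def)

lemma generated_gens: "generated_group P gens"
proof
  show sub: "gens \<subseteq> carrier P" by (auto simp: gens_def ev_closed)
  have "ev w \<in> generate P gens" if "w \<in> words" for w
    using that
  proof (induction w)
    case Nil
    then show ?case by (simp add: ev_Nil generate.one)
  next
    case (Cons l w)
    obtain v g where "l = (v, g)" by fastforce
    then show ?case
      using Cons generate.eng[OF generate.incl[OF gensI[of v g]]] by (auto simp: ev_Cons[of v g w])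
  qed
  then show "generate P gens = carrier P"
    using P.generate_in_carrier[OF sub] by (auto simp: carrier_P)
qed

lemma inv_gens: "s \<in> gens \<Longrightarrow> inv\<^bsub>P\<^esub> s \<in> gens"
  unfolding gens_def using inv_ev_letter group_G group.inv_closed by fastforce

lemma foldr_ev_letters:
  "w \<in> words \<Longrightarrow> foldr (\<otimes>\<^bsub>P\<^esub>) (map (\<lambda>l. ev [l]) w) \<one>\<^bsub>P\<^esub> = ev w"
proof (induction w)
  case (Cons l w)
  then show ?case using ev_Cons[of "fst l" "snd l" w] by (cases l) simp
qed (simp add: ev_Nil)

lemma foldr_gens_word:
  assumes "set ss \<subseteq> gens"
  shows "\<exists>w\<in>words. length w = length ss \<and> ev w = foldr (\<otimes>\<^bsub>P\<^esub>) ss \<one>\<^bsub>P\<^esub>"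
  using assms
proof (induction ss)
  case Nil
  then show ?case by (intro bexI[of _ "[]"]) (auto simp: ev_Nil)
next
  case (Cons s ss)
  then obtain w v g where "w \<in> words" "length w = length ss" "ev w = foldr (\<otimes>\<^bsub>P\<^esub>) ss \<one>\<^bsub>P\<^esub>"
    "v \<in> V" "g \<in> carrier (G v)" "s = ev [(v, g)]"
    by (auto simp: gens_def)
  then show ?case by (intro bexI[of _ "(v, g) # w"]) (auto simp: ev_Cons[of v g w])
qed

lemma finite_gens:
  assumes "finite V" "\<And>v. v \<in> V \<Longrightarrow> finite (carrier (G v))"
  shows "finite gens"
proof -
  have "gens = (\<lambda>l. ev [l]) ` (SIGMA v:V. carrier (G v))"
    by (auto simp: gens_def)
  then show ?thesis using assms by simp
qed

lemma finite_if_complete: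
  assumes "finite V" "\<And>v. v \<in> V \<Longrightarrow> finite (carrier (G v))"
    and complete: "\<And>v w. \<lbrakk>v \<in> V; w \<in> V; v \<noteq> w\<rbrakk> \<Longrightarrow> {v, w} \<in> E"
  shows "finite (carrier P)"
proof -
  define W where "W U = {w \<in> words. fst ` set w \<subseteq> U}" for U
  have "finite (ev ` W U)" if "finite U" "U \<subseteq> V" for U
    using that
  proof (induction U)
    case empty
    have "W {} = {[]}" by (auto simp: W_def)
    then show ?case by simp
  next
    case (insert v U)
    then have v: "v \<in> V" "U \<subseteq> V" by auto
    interpret Gv: group "G v" using group_G v by blast
    let ?f = "\<lambda>(p, g). p \<otimes>\<^bsub>P\<^esub> ev [(v, g)]"
    \<comment> \<open>Letters of \<open>v\<close> commute with those of all other vertices, so they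
      can be collected at the right end into one element of \<open>G v\<close>, and what remains is
      a word over \<open>U\<close>.\<close>
    have "ev w \<in> ?f ` (ev ` W U \<times> carrier (G v))" if "w \<in> W (insert v U)" for w
      using that
    proof (induction w rule: rev_induct)
      case Nil
      have "ev [] = ?f (ev [], \<one>\<^bsub>G v\<^esub>)" using v by (simp add: ev_letter_one ev_Nil)
      moreover have "[] \<in> W U" by (simp add: W_def)
      ultimately show ?case by blast
    next
      case (snoc l w)
      obtain u h where l: "l = (u, h)" by fastforce
      have w: "w \<in> W (insert v U)" "w \<in> words" "u \<in> insert v U" "u \<in> V" "h \<in> carrier (G u)"
        using snoc.prems by (auto simp: W_def l)
      obtain y g where y: "y \<in> W U" "g \<in> carrier (G v)" "ev w = ev y \<otimes>\<^bsub>P\<^esub> ev [(v, g)]"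
        using snoc.IH[OF w(1)] by auto
      have yw: "y \<in> words" using y by (simp add: W_def)
      have cl: "ev y \<in> carrier P" "ev [(v, g)] \<in> carrier P" "ev [(u, h)] \<in> carrier P"
        using yw y w v by (auto intro!: ev_closed)
      have e: "ev (w @ [l]) = ev y \<otimes>\<^bsub>P\<^esub> (ev [(v, g)] \<otimes>\<^bsub>P\<^esub> ev [(u, h)])"
        using w y cl by (simp add: l ev_append P.m_assoc)
      show ?case
      proof (cases "u = v")
        case True
        then have "ev (w @ [l]) = ?f (ev y, g \<otimes>\<^bsub>G v\<^esub> h)"
          using e v y w by (simp add: ev_mult)
        then show ?thesis using y w True by (intro image_eqI) auto
      next
        case False
        then have "{v, u} \<in> E" using complete v w by auto
        then have "ev (w @ [l]) = ev y \<otimes>\<^bsub>P\<^esub> (ev [(u, h)] \<otimes>\<^bsub>P\<^esub> ev [(v, g)])"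
          using e ev_commute[of v u g h] v w y by simp
        then have "ev (w @ [l]) = ?f (ev (y @ [(u, h)]), g)"
          using cl yw w by (simp add: ev_append P.m_assoc)
        moreover have "y @ [(u, h)] \<in> W U" using y w False by (auto simp: W_def)
        ultimately show ?thesis using y by (intro image_eqI) auto
      qed
    qed
    then have "ev ` W (insert v U) \<subseteq> ?f ` (ev ` W U \<times> carrier (G v))" by blast
    moreover have "finite (ev ` W U)" using insert.IH v(2) .
    ultimately show ?case
      using assms(2)[OF v(1)] by (meson finite_SigmaI finite_imageI finite_subset)
  qed
  moreover have "words = W V" by (auto simp: W_def fp_words_def)
  ultimately show ?thesis using assms(1) by (simp add: carrier_P)
qed

text \<open>By \<open>run_ev\<close>, running a word from the empty normal form gives a result that
  depends only on the element represented, and this result represents the same element. It is the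
  normal form of the element.\<close>

lemma hyperbolic_if_nf_system:
  assumes nf: "nf_system V E G V N \<phi> C"
    and fin: "finite V" "\<And>v. v \<in> V \<Longrightarrow> finite (carrier (G v))"
  shows "hyperbolic_group P"
proof -
  interpret nf_system V E G V N \<phi> C by fact
  interpret S: generated_group P gens by (rule generated_gens)
  have act: "action N \<phi>"
    unfolding action_def using act_one act_closed act_mult act_comm by blast
  have letters: "S.letters = gens" using inv_gens by blast
  \<comment> \<open>Multiplication by \<open>G v\<close> stays within one coset, whose members have
    the length of its shortest representative or one more. Hence a letter lengthens a normal form by
    at most 1, and normal forms are geodesic.\<close>
  have act_le: "length (\<phi> x v g) \<le> length x + 1" if x: "x \<in> N" and v: "v \<in> V" and g: "g \<in> carrier (G v)" for x v g
  proof -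
    interpret Gv: group "G v" using group_G v by blast
    obtain t h where t: "t \<in> N" "h \<in> carrier (G v)" "x = \<phi> t v h"
      "\<And>k. k \<in> carrier (G v) \<Longrightarrow> k \<noteq> \<one>\<^bsub>G v\<^esub> \<Longrightarrow> length (\<phi> t v k) = length t + 1"
      using act_min[OF x v] by blast
    have "length (\<phi> t v k) \<in> {length t, length t + 1}" if "k \<in> carrier (G v)" for k
      using t(4)[OF that] act_one[OF t(1) v] by (cases "k = \<one>\<^bsub>G v\<^esub>") auto
    from this[OF t(2)] this[of "h \<otimes>\<^bsub>G v\<^esub> g"] show ?thesis
      using act_mult[OF t(1) v t(2) g] t g by auto
  qed
  have run_le: "length (run \<phi> x w) \<le> length x + length w" if "x \<in> N" "w \<in> words" for x w
    using that
  proof (induction w arbitrary: x)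
    case (Cons l w)
    obtain v g where l: "l = (v, g)" by fastforce
    have "\<phi> x v g \<in> N" "length (\<phi> x v g) \<le> length x + 1"
      using Cons.prems act_closed act_le by (auto simp: l)
    then show ?case using Cons.IH[of "\<phi> x v g"] Cons.prems by (simp add: l)
  qed simp
  have ev_run: "ev (run \<phi> x w) = ev x \<otimes>\<^bsub>P\<^esub> ev w" if "x \<in> N" "w \<in> words" for x w
    using that
  proof (induction w arbitrary: x)
    case Nil
    then show ?case using N_words ev_closed by (simp add: ev_Nil)
  next
    case (Cons l w)
    obtain v g where l: "l = (v, g)" by fastforce
    have "\<phi> x v g \<in> N" using Cons.prems act_closed by (auto simp: l)
    then show ?case
      using Cons.IH[of "\<phi> x v g"] Cons.prems N_words
      by (simp add: l act_ev ev_Cons[of v g w] ev_closed P.m_assoc)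
  qed
  define nf where "nf g = run \<phi> [] (SOME w. w \<in> words \<and> ev w = g)" for g
  have nf_ev: "nf (ev w) = run \<phi> [] w" if "w \<in> words" for w
  proof -
    let ?w = "SOME u. u \<in> words \<and> ev u = ev w"
    have "?w \<in> words \<and> ev ?w = ev w" by (rule someI[of _ w]) (use that in simp)
    then show ?thesis unfolding nf_def using run_ev[OF act Nil_N] that by blast
  qed
  have nf: "nf g \<in> words" "ev (nf g) = g" if g: "g \<in> carrier P" for g
  proof -
    obtain w where w: "w \<in> words" "g = ev w" using g by (auto simp: carrier_P)
    show "nf g \<in> words" using w nf_ev run_closed[OF act Nil_N] N_words by simp
    show "ev (nf g) = g" using w ev_run[OF Nil_N w(1)] ev_closed nf_ev by (simp add: ev_Nil)
  qed
  have len_ev: "S.len (ev w) \<le> length w" if "w \<in> words" for w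
  proof -
    have "set (map (\<lambda>l. ev [l]) w) \<subseteq> S.letters"
      unfolding letters using that gensI by (auto simp: fp_words_def)
    then show ?thesis
      using word_length_le[OF _ foldr_ev_letters[OF that], of gens] by simp
  qed
  have "gromov_hyperbolic_space (carrier P) (word_dist P gens)"
  proof (rule S.hyperbolic_if_prefix_stable[of nf C])
    fix g assume g: "g \<in> carrier P"
    obtain ss where ss: "length ss = S.len g" "set ss \<subseteq> gens" "foldr (\<otimes>\<^bsub>P\<^esub>) ss \<one>\<^bsub>P\<^esub> = g"
      using S.len_witness[OF g] unfolding letters by blast
    then obtain w where w: "w \<in> words" "length w = S.len g" "ev w = g"
      using foldr_gens_word by metis
    then show "length (nf g) \<le> S.len g"
      using nf_ev[OF w(1)] run_le[OF Nil_N w(1)] by simp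
    fix s assume s: "s \<in> S.letters"
    then obtain v a where v: "v \<in> V" "a \<in> carrier (G v)" "s = ev [(v, a)]"
      unfolding letters by (auto simp: gens_def)
    have "g \<otimes>\<^bsub>P\<^esub> s = ev (w @ [(v, a)])" using w v by (simp add: ev_append)
    then have "nf (g \<otimes>\<^bsub>P\<^esub> s) = \<phi> (nf g) v a"
      using nf_ev[of "w @ [(v, a)]"] nf_ev[OF w(1)] w v by simp
    moreover have "nf g \<in> N" using nf_ev[OF w(1)] w run_closed[OF act Nil_N w(1)] by simp
    ultimately show "\<exists>z. prefix z (nf g) \<and> prefix z (nf (g \<otimes>\<^bsub>P\<^esub> s)) \<and> length (nf g) \<le> length z + C"
      using act_stable v by simp
  next
    fix g h z u w assume g: "g \<in> carrier P" and h: "h \<in> carrier P" and eq: "nf g = z @ u" "nf h = z @ w"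
    have ws: "z \<in> words" "u \<in> words" "w \<in> words" using nf(1)[OF g] nf(1)[OF h] eq by auto
    have e: "ev z \<in> carrier P" "ev u \<in> carrier P" "ev w \<in> carrier P" using ws ev_closed by auto
    have "g = ev z \<otimes>\<^bsub>P\<^esub> ev u" "h = ev z \<otimes>\<^bsub>P\<^esub> ev w"
      using nf(2)[OF g] nf(2)[OF h] eq ws by (simp_all add: ev_append)
    moreover have "inv\<^bsub>P\<^esub> (ev z) \<otimes>\<^bsub>P\<^esub> (ev z \<otimes>\<^bsub>P\<^esub> ev w) = ev w"
      using e by (simp add: P.m_assoc[symmetric])
    ultimately have "inv\<^bsub>P\<^esub> g \<otimes>\<^bsub>P\<^esub> h = inv\<^bsub>P\<^esub> (ev u) \<otimes>\<^bsub>P\<^esub> ev w"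
      using e by (simp add: P.inv_mult_group P.m_assoc)
    then show "S.len (inv\<^bsub>P\<^esub> g \<otimes>\<^bsub>P\<^esub> h) \<le> length u + length w"
      using S.len_mult[OF P.inv_closed[OF e(2)] e(3)] S.len_inv[OF e(2)] len_ev[OF ws(2)] len_ev[OF ws(3)]
      by simp
  qed
  then show ?thesis
    unfolding hyperbolic_group_def
    using finite_gens[OF fin] S.S_carrier S.generate_S P.is_group by blast
qed

section \<open>Growth of free products and induced squares\<close>

text \<open>The words are written from right to left, so that the last letter is at the head.\<close>

definition fpa :: "'v set \<Rightarrow> ('v \<times> 'a) list \<Rightarrow> 'v \<Rightarrow> 'a \<Rightarrow> ('v \<times> 'a) list" where
  "fpa B x v g = (if v \<notin> B then x else case x of
       [] \<Rightarrow> (if g = \<one>\<^bsub>G v\<^esub> then [] else [(v, g)])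
     | (w, h) # y \<Rightarrow>
         if w = v then (if h \<otimes>\<^bsub>G v\<^esub> g = \<one>\<^bsub>G v\<^esub> then y else (v, h \<otimes>\<^bsub>G v\<^esub> g) # y)
         else if g = \<one>\<^bsub>G v\<^esub> then x else (v, g) # x)"

definition alternating :: "'v set \<Rightarrow> ('v \<times> 'a) list set" where
  "alternating B = {x. successively (\<lambda>l m. fst l \<noteq> fst m) x \<and>
     (\<forall>(v, g)\<in>set x. v \<in> B \<and> g \<in> carrier (G v) \<and> g \<noteq> \<one>\<^bsub>G v\<^esub>)}"

lemma alternating_Cons:
  "(v, g) # x \<in> alternating B \<longleftrightarrow> v \<in> B \<and> g \<in> carrier (G v) \<and> g \<noteq> \<one>\<^bsub>G v\<^esub> \<and> x \<in> alternating B \<and>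
     (x = [] \<or> fst (hd x) \<noteq> v)"
  by (cases x) (auto simp: alternating_def)

text \<open>Vertices outside \<open>B\<close> act trivially, and every edge has an end outside
  \<open>B\<close>, so adjacent letters commute. The action corresponds to the retraction onto the
  free product of the groups in \<open>B\<close> that kills all other vertex groups.\<close>

lemma action_fpa:
  assumes B: "B \<subseteq> V" and irrefl: "\<And>u. {u, u} \<notin> E" and indep: "\<And>u w. \<lbrakk>u \<in> B; w \<in> B\<rbrakk> \<Longrightarrow> {u, w} \<notin> E"
  shows "action (alternating B) (fpa B)"
  unfolding action_def
proof (intro conjI ballI impI)
  fix x v assume x: "x \<in> alternating B" and v: "v \<in> V"
  interpret Gv: group "G v" using group_G v by blast
  show "fpa B x v (\<one>\<^bsub>G v\<^esub>) = x"
    using x by (auto simp: fpa_def alternating_Cons split: list.splits)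
  fix g assume g: "g \<in> carrier (G v)"
  show "fpa B x v g \<in> alternating B"
    using x g by (auto simp: fpa_def alternating_Cons split: list.splits)
  fix h assume h: "h \<in> carrier (G v)"
  show "fpa B (fpa B x v g) v h = fpa B x v (g \<otimes>\<^bsub>G v\<^esub> h)"
  proof (cases x)
    case Nil
    then show ?thesis using g h by (auto simp: fpa_def)
  next
    case (Cons l y)
    obtain w k where l: "l = (w, k)" by fastforce
    have y: "y = [] \<or> fst (hd y) \<noteq> w" and k: "k \<in> carrier (G w)" using x by (auto simp: Cons l alternating_Cons)
    show ?thesis
    proof (cases "v \<in> B \<and> w = v")
      case True
      have "fpa B y v h = (if h = \<one>\<^bsub>G v\<^esub> then y else (v, h) # y)"
        using y True by (cases y) (auto simp: fpa_def)
      moreover have "k \<otimes>\<^bsub>G v\<^esub> (g \<otimes>\<^bsub>G v\<^esub> h) = (k \<otimes>\<^bsub>G v\<^esub> g) \<otimes>\<^bsub>G v\<^esub> h"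
        using True k g h by (simp add: Gv.m_assoc)
      ultimately show ?thesis
        using True h by (auto simp: Cons l fpa_def)
    next
      case False
      then show ?thesis using g h by (auto simp: Cons l fpa_def)
    qed
  qed
next
  fix x u w g h assume "{u, w} \<in> E"
  then have "u \<notin> B \<or> w \<notin> B" using indep by blast
  then show "fpa B (fpa B x u g) w h = fpa B (fpa B x w h) u g" by (auto simp: fpa_def)
qed

lemma run_fpa_le: "length (run (fpa B) x w) \<le> length x + length w"
proof (induction w arbitrary: x)
  case (Cons l w)
  obtain v g where l: "l = (v, g)" by fastforce
  have "length (fpa B x v g) \<le> length x + 1" by (auto simp: fpa_def split: list.splits)
  then show ?case using Cons[of "fpa B x v g"] by (simp add: l)
qed simp

lemma run_fpa_outside: "fst ` set w \<inter> B = {} \<Longrightarrow> run (fpa B) x w = x"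
proof (induction w)
  case (Cons l w)
  then show ?case by (cases l) (simp add: fpa_def)
qed simp

lemma run_fpa_power:
  assumes "b \<in> B" "d \<in> B" "b \<noteq> d" "g \<noteq> \<one>\<^bsub>G b\<^esub>" "h \<noteq> \<one>\<^bsub>G d\<^esub>" "x = [] \<or> fst (hd x) \<noteq> b"
  shows "length (run (fpa B) x (concat (replicate n [(b, g), (d, h)]))) = length x + 2 * n"
  using assms(6)
proof (induction n arbitrary: x)
  case (Suc n)
  have "fpa B (fpa B x b g) d h = (d, h) # (b, g) # x"
    using Suc.prems assms(1-5) by (cases x) (auto simp: fpa_def)
  then show ?case using Suc.IH[of "(d, h) # (b, g) # x"] assms(3) by simp
qed simp

lemma ev_power: "w \<in> words \<Longrightarrow> concat (replicate n w) \<in> words \<and> ev (concat (replicate n w)) = ev w [^]\<^bsub>P\<^esub> n"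
proof (induction n)
  case (Suc n)
  have "ev w [^]\<^bsub>P\<^esub> Suc n = ev w \<otimes>\<^bsub>P\<^esub> ev w [^]\<^bsub>P\<^esub> n"
    by (rule P.nat_pow_Suc2[OF ev_closed[OF Suc.prems]])
  then show ?case using Suc by (simp add: ev_append)
qed (simp add: ev_Nil)

text \<open>A letter of a vertex group lengthens an alternating word by at most 1, and each letter
  of the given generating set is a product of at most \<open>k\<close> of these, whereas
  \<open>j\<close> periods produce an alternating word of length \<open>2 * j\<close>. The word
  \<open>u\<close> acts trivially, so the bound is uniform in it.\<close>

lemma free_product_growth:
  assumes S: "generated_group P S" "finite S" and irrefl: "\<And>u. {u, u} \<notin> E"
    and bd: "b \<in> V" "d \<in> V" "b \<noteq> d" "{b, d} \<notin> E"
    and g: "g \<in> carrier (G b)" "g \<noteq> \<one>\<^bsub>G b\<^esub>" and h: "h \<in> carrier (G d)" "h \<noteq> \<one>\<^bsub>G d\<^esub>"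
  obtains \<epsilon> :: real where "\<epsilon> > 0"
    "\<And>u j. \<lbrakk>u \<in> words; fst ` set u \<inter> {b, d} = {}\<rbrakk>
       \<Longrightarrow> \<epsilon> * real j \<le> real (word_length P S (ev u \<otimes>\<^bsub>P\<^esub> ev [(b, g), (d, h)] [^]\<^bsub>P\<^esub> j))"
proof -
  interpret S: generated_group P S by (rule S)
  let ?B = "{b, d}"
  have act: "action (alternating ?B) (fpa ?B)"
    using bd irrefl by (intro action_fpa) (auto simp: insert_commute)
  have nil: "[] \<in> alternating ?B" by (simp add: alternating_def)
  have "\<exists>w\<in>words. ev w = s" if "s \<in> S.letters" for s
  proof -
    have "s \<in> ev ` words" using that S.letters_carrier unfolding carrier_P by (rule subsetD[rotated])
    then show ?thesis by auto
  qed
  then obtain W where W: "\<And>s. s \<in> S.letters \<Longrightarrow> W s \<in> words \<and> ev (W s) = s" by metis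
  have fin: "finite S.letters" using S(2) by simp
  \<comment> \<open>\<open>insert 0\<close> and \<open>Suc\<close> keep the maximum defined and
    \<open>k\<close> positive even if there are no letters.\<close>
  define k where "k = Suc (Max (insert 0 ((\<lambda>s. length (W s)) ` S.letters)))"
  have k: "length (W s) \<le> k" if "s \<in> S.letters" for s
    unfolding k_def using fin that by (intro le_SucI Max_ge) auto
  have word: "\<exists>w\<in>words. ev w = foldr (\<otimes>\<^bsub>P\<^esub>) ss \<one>\<^bsub>P\<^esub> \<and> length w \<le> k * length ss"
    if "set ss \<subseteq> S.letters" for ss
    using that
  proof (induction ss)
    case Nil
    then show ?case by (intro bexI[of _ "[]"]) (auto simp: ev_Nil)
  next
    case (Cons s ss)
    then obtain w where "w \<in> words" "ev w = foldr (\<otimes>\<^bsub>P\<^esub>) ss \<one>\<^bsub>P\<^esub>" "length w \<le> k * length ss" by auto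
    moreover have "s \<in> S.letters" using Cons.prems by simp
    ultimately show ?case
      using W[of s] k[of s] by (intro bexI[of _ "W s @ w"]) (auto simp: ev_append)
  qed
  have "1 / real k * real j \<le> real (S.len (ev u \<otimes>\<^bsub>P\<^esub> ev [(b, g), (d, h)] [^]\<^bsub>P\<^esub> j))"
    if u: "u \<in> words" "fst ` set u \<inter> {b, d} = {}" for u j
  proof -
    let ?z = "u @ concat (replicate j [(b, g), (d, h)])"
    have z: "?z \<in> words" "ev ?z = ev u \<otimes>\<^bsub>P\<^esub> ev [(b, g), (d, h)] [^]\<^bsub>P\<^esub> j"
      using ev_power[of "[(b, g), (d, h)]" j] u bd g h by (auto simp: ev_append)
    obtain ss where ss: "length ss = S.len (ev ?z)" "set ss \<subseteq> S.letters" "foldr (\<otimes>\<^bsub>P\<^esub>) ss \<one>\<^bsub>P\<^esub> = ev ?z"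
      using S.len_witness[OF ev_closed[OF z(1)]] by blast
    obtain w where w: "w \<in> words" "ev w = ev ?z" "length w \<le> k * S.len (ev ?z)"
      using word[OF ss(2)] ss by auto
    have "2 * j = length (run (fpa ?B) [] ?z)"
      using run_fpa_outside[OF u(2)] run_fpa_power[of b ?B d g h "[]" j] bd g h by simp
    also have "\<dots> = length (run (fpa ?B) [] w)"
      using run_ev[OF act nil z(1) w(1)] w(2) by simp
    also have "\<dots> \<le> k * S.len (ev ?z)"
      using run_fpa_le[of ?B "[]" w] w(3) by simp
    finally have "j \<le> k * S.len (ev ?z)" by simp
    then have "real j \<le> real k * real (S.len (ev ?z))" by (metis of_nat_le_iff of_nat_mult)
    then show ?thesis unfolding z(2) by (simp add: k_def field_simps)
  qed
  then show ?thesis using that[of "1 / real k"] by (simp add: k_def)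
qed

text \<open>Each diagonal contributes a product of two letters. The four sides make the two products
  commute, and the missing diagonals let both have undistorted powers. As the action for
  \<open>{b, d}\<close> ignores letters of \<open>a\<close> and \<open>c\<close>, the length of
  \<open>x [^] i\<close> times \<open>y [^] j\<close> is bounded below in terms of \<open>j\<close>
  alone.\<close>

lemma not_hyperbolic_if_induced_square:
  assumes irrefl: "\<And>u. {u, u} \<notin> E" and ntriv: "\<And>v. v \<in> V \<Longrightarrow> carrier (G v) \<noteq> {\<one>\<^bsub>G v\<^esub>}"
    and V: "a \<in> V" "b \<in> V" "c \<in> V" "d \<in> V" and distinct: "a \<noteq> c" "b \<noteq> d"
    and edges: "{a, b} \<in> E" "{b, c} \<in> E" "{c, d} \<in> E" "{d, a} \<in> E"
    and nonedges: "{a, c} \<notin> E" "{b, d} \<notin> E"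
  shows "\<not> hyperbolic_group P"
proof
  assume "hyperbolic_group P"
  then obtain S where S: "finite S" "S \<subseteq> carrier P" "generate P S = carrier P"
    "gromov_hyperbolic_space (carrier P) (word_dist P S)"
    unfolding hyperbolic_group_def by blast
  then have gen: "generated_group P S"
    by (intro generated_group.intro generated_group_axioms.intro P.is_group)
  interpret S: generated_group P S by (rule gen)
  have nontrivial: "\<exists>g\<in>carrier (G v). g \<noteq> \<one>\<^bsub>G v\<^esub>" if "v \<in> V" for v
  proof -
    interpret Gv: group "G v" using group_G that by blast
    show ?thesis using ntriv[OF that] Gv.one_closed by blast
  qed
  obtain ga where ga: "ga \<in> carrier (G a)" "ga \<noteq> \<one>\<^bsub>G a\<^esub>" using nontrivial V by blast
  obtain gb where gb: "gb \<in> carrier (G b)" "gb \<noteq> \<one>\<^bsub>G b\<^esub>" using nontrivial V by blast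
  obtain gc where gc: "gc \<in> carrier (G c)" "gc \<noteq> \<one>\<^bsub>G c\<^esub>" using nontrivial V by blast
  obtain gd where gd: "gd \<in> carrier (G d)" "gd \<noteq> \<one>\<^bsub>G d\<^esub>" using nontrivial V by blast
  have ne: "a \<noteq> b" "b \<noteq> c" "c \<noteq> d" "d \<noteq> a" using edges irrefl by auto
  define xw where "xw = [(a, ga), (c, gc)]"
  define yw where "yw = [(b, gb), (d, gd)]"
  have w: "xw \<in> words" "yw \<in> words" using V ga gb gc gd by (auto simp: xw_def yw_def)
  define x where "x = ev xw"
  define y where "y = ev yw"
  have xy: "x \<in> carrier P" "y \<in> carrier P" using w ev_closed by (auto simp: x_def y_def)
  obtain \<epsilon>1 :: real where e1: "\<epsilon>1 > 0" "\<And>u j. \<lbrakk>u \<in> words; fst ` set u \<inter> {a, c} = {}\<rbrakk>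
       \<Longrightarrow> \<epsilon>1 * real j \<le> real (S.len (ev u \<otimes>\<^bsub>P\<^esub> ev [(a, ga), (c, gc)] [^]\<^bsub>P\<^esub> j))"
    using free_product_growth[OF gen S(1) irrefl V(1,3) distinct(1) nonedges(1) ga gc] by blast
  obtain \<epsilon>2 :: real where e2: "\<epsilon>2 > 0" "\<And>u j. \<lbrakk>u \<in> words; fst ` set u \<inter> {b, d} = {}\<rbrakk>
       \<Longrightarrow> \<epsilon>2 * real j \<le> real (S.len (ev u \<otimes>\<^bsub>P\<^esub> ev [(b, gb), (d, gd)] [^]\<^bsub>P\<^esub> j))"
    using free_product_growth[OF gen S(1) irrefl V(2,4) distinct(2) nonedges(2) gb gd] by blast
  define \<epsilon> where "\<epsilon> = min \<epsilon>1 \<epsilon>2"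
  have le: "\<epsilon> * real j \<le> \<epsilon>1 * real j" "\<epsilon> * real j \<le> \<epsilon>2 * real j" for j :: nat
    by (auto simp: \<epsilon>_def intro!: mult_right_mono)
  have "\<not> gromov_hyperbolic_space (carrier P) (word_dist P S)"
  proof (rule S.not_hyperbolic_if_undistorted_commuting[OF xy])
    show "\<epsilon> > 0" using e1 e2 by (simp add: \<epsilon>_def)
    show "x \<otimes>\<^bsub>P\<^esub> y = y \<otimes>\<^bsub>P\<^esub> x"
    proof -
      define A B C D where "A = ev [(a, ga)]" and "B = ev [(b, gb)]" and "C = ev [(c, gc)]" and "D = ev [(d, gd)]"
      have cl: "A \<in> carrier P" "B \<in> carrier P" "C \<in> carrier P" "D \<in> carrier P"
        using V ga gb gc gd by (auto simp: A_def B_def C_def D_def intro!: ev_closed)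
      have x: "x = A \<otimes>\<^bsub>P\<^esub> C" and y: "y = B \<otimes>\<^bsub>P\<^esub> D"
        using V ga gb gc gd
        by (auto simp: x_def y_def xw_def yw_def A_def B_def C_def D_def ev_Cons[of a ga "[(c, gc)]"] ev_Cons[of b gb "[(d, gd)]"])
      have comm: "A \<otimes>\<^bsub>P\<^esub> B = B \<otimes>\<^bsub>P\<^esub> A" "C \<otimes>\<^bsub>P\<^esub> B = B \<otimes>\<^bsub>P\<^esub> C"
        "C \<otimes>\<^bsub>P\<^esub> D = D \<otimes>\<^bsub>P\<^esub> C" "A \<otimes>\<^bsub>P\<^esub> D = D \<otimes>\<^bsub>P\<^esub> A"
        unfolding A_def B_def C_def D_def
        by (rule ev_commute; use V ga gb gc gd edges in \<open>simp add: insert_commute\<close>)+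
      have "x \<otimes>\<^bsub>P\<^esub> y = A \<otimes>\<^bsub>P\<^esub> (C \<otimes>\<^bsub>P\<^esub> B) \<otimes>\<^bsub>P\<^esub> D" using cl by (simp add: x y P.m_assoc)
      also have "\<dots> = (A \<otimes>\<^bsub>P\<^esub> B) \<otimes>\<^bsub>P\<^esub> (C \<otimes>\<^bsub>P\<^esub> D)" unfolding comm(2) using cl by (simp add: P.m_assoc)
      also have "\<dots> = B \<otimes>\<^bsub>P\<^esub> (A \<otimes>\<^bsub>P\<^esub> D) \<otimes>\<^bsub>P\<^esub> C" unfolding comm(1,3) using cl by (simp add: P.m_assoc)
      also have "\<dots> = y \<otimes>\<^bsub>P\<^esub> x" unfolding comm(4) using cl by (simp add: x y P.m_assoc)
      finally show ?thesis .
    qed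
    fix i j :: nat
    show "\<epsilon> * real i \<le> real (S.len (x [^]\<^bsub>P\<^esub> i))"
      using e1(2)[of "[]" i] le(1)[of i] xy by (simp add: x_def xw_def ev_Nil)
    have out: "fst ` set (concat (replicate i u)) \<inter> {b, d} = {}" if "fst ` set u \<inter> {b, d} = {}" for u :: "('v \<times> 'a) list"
      using that by auto
    have "fst ` set xw \<inter> {b, d} = {}" using ne by (auto simp: xw_def)
    then show "\<epsilon> * real j \<le> real (S.len (x [^]\<^bsub>P\<^esub> i \<otimes>\<^bsub>P\<^esub> y [^]\<^bsub>P\<^esub> j))"
      using e2(2)[OF _ out, of xw j] ev_power[OF w(1), of i] le(2)[of j] by (simp add: x_def y_def yw_def)
    \<comment> \<open>The bound is needed for negative powers of \<open>x\<close> too; these are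
      words in the same two vertices, so they can serve as the word \<open>u\<close>.\<close>
    define xi where "xi = [(c, inv\<^bsub>G c\<^esub> gc), (a, inv\<^bsub>G a\<^esub> ga)]"
    have xi: "xi \<in> words" using V ga gc group_G by (auto simp: xi_def group.inv_closed)
    have "ev xi = inv\<^bsub>P\<^esub> x"
    proof -
      have "x = ev [(a, ga)] \<otimes>\<^bsub>P\<^esub> ev [(c, gc)]"
        using V ga gc by (simp add: x_def xw_def ev_Cons[of a ga "[(c, gc)]"])
      moreover have "ev xi = ev [(c, inv\<^bsub>G c\<^esub> gc)] \<otimes>\<^bsub>P\<^esub> ev [(a, inv\<^bsub>G a\<^esub> ga)]"
        using xi by (simp add: xi_def ev_Cons[of c _ "[(a, inv\<^bsub>G a\<^esub> ga)]"])
      ultimately show ?thesis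
        using V ga gc by (simp add: P.inv_mult_group ev_closed inv_ev_letter)
    qed
    then have "inv\<^bsub>P\<^esub> (x [^]\<^bsub>P\<^esub> i) = ev (concat (replicate i xi))"
      using ev_power[OF xi, of i] xy by (simp add: P.nat_pow_inv)
    moreover have "fst ` set xi \<inter> {b, d} = {}" using ne by (auto simp: xi_def)
    ultimately show "\<epsilon> * real j \<le> real (S.len (inv\<^bsub>P\<^esub> (x [^]\<^bsub>P\<^esub> i) \<otimes>\<^bsub>P\<^esub> y [^]\<^bsub>P\<^esub> j))"
      using e2(2)[OF _ out, of xi j] ev_power[OF xi, of i] le(2)[of j] by (simp add: y_def yw_def)
  qed
  then show False using S(4) by blast
qed

end

section \<open>Random graphs\<close>

lemma prob_random_graph:
  assumes p: "0 \<le> p" "p \<le> 1" and AB: "A \<subseteq> all_edges n" "B \<subseteq> all_edges n" "A \<inter> B = {}"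
  shows "measure_pmf.prob (random_graph n p) {E. A \<subseteq> E \<and> B \<inter> E = {}} = p ^ card A * (1 - p) ^ card B"
proof -
  define T where "T e = (if e \<in> A then {True} else if e \<in> B then {False} else UNIV)" for e
  have "(\<lambda>f. {e. f e}) -` {E. A \<subseteq> E \<and> B \<inter> E = {}} = Pi (all_edges n) T"
    using AB by (auto simp: T_def Pi_def split: if_splits)
  then have "measure_pmf.prob (random_graph n p) {E. A \<subseteq> E \<and> B \<inter> E = {}} =
      (\<Prod>e\<in>all_edges n. measure_pmf.prob (bernoulli_pmf p) (T e))"
    by (simp add: random_graph_def measure_Pi_pmf_Pi finite_all_edges)
  also have "\<dots> = (\<Prod>e\<in>all_edges n. (if e \<in> A then p else 1) * (if e \<in> B then 1 - p else 1))"
    using p AB by (intro prod.cong) (auto simp: T_def measure_pmf_single)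
  also have "\<dots> = p ^ card A * (1 - p) ^ card B"
    using AB by (simp add: prod.distrib prod.If_cases finite_all_edges Int_absorb1)
  finally show ?thesis .
qed

lemma random_graph_subset: "E \<in> set_pmf (random_graph n p) \<Longrightarrow> E \<subseteq> all_edges n"
  using set_Pi_pmf_subset[OF finite_all_edges[of n], of False "\<lambda>_. bernoulli_pmf p"]
  by (auto simp: random_graph_def)

lemma aas_if_prob_tendsto_0:
  assumes good: "\<And>n E. \<lbrakk>n \<ge> 1; E \<subseteq> all_edges n; \<not> B n E\<rbrakk> \<Longrightarrow> Q n E"
    and bound: "eventually (\<lambda>n. measure_pmf.prob (random_graph n (p n)) {E. B n E} \<le> r n) sequentially"
    and r: "r \<longlonglongrightarrow> 0"
  shows "asymptotically_almost_surely p Q"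
  unfolding asymptotically_almost_surely_def
proof (rule tendsto_sandwich)
  have key: "1 - r n \<le> measure_pmf.prob (random_graph n (p n)) {E. Q n E}"
    if n: "n \<ge> 1" and le: "measure_pmf.prob (random_graph n (p n)) {E. B n E} \<le> r n" for n
  proof -
    let ?M = "random_graph n (p n)"
    have "1 - measure_pmf.prob ?M {E. B n E} = measure_pmf.prob ?M (- {E. B n E})"
      using measure_pmf.prob_compl[of "{E. B n E}" ?M] by (simp add: Compl_eq_Diff_UNIV)
    also have "\<dots> = measure_pmf.prob ?M (- {E. B n E} \<inter> set_pmf ?M)"
      by (simp add: measure_Int_set_pmf)
    also have "\<dots> \<le> measure_pmf.prob ?M {E. Q n E}"
      using good[OF n] random_graph_subset by (intro measure_pmf.finite_measure_mono) auto
    finally show ?thesis using le by simp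
  qed
  show "\<forall>\<^sub>F n in sequentially. 1 - r n \<le> measure_pmf.prob (random_graph n (p n)) {E. Q n E}"
    using eventually_conj[OF eventually_ge_at_top[of 1] bound]
    by (rule eventually_mono) (use key in blast)
  show "(\<lambda>n. 1 - r n) \<longlonglongrightarrow> 1" using tendsto_diff[OF tendsto_const r, of 1] by simp
qed (auto simp: measure_pmf.prob_le_1)

lemma edge_iff: "{u, w} \<in> all_edges n \<longleftrightarrow> u \<in> {1..n} \<and> w \<in> {1..n} \<and> u \<noteq> w"
  by (auto simp: all_edges_def card_2_iff doubleton_eq_iff)

lemma prob_not_complete_le:
  assumes "0 \<le> p" "p \<le> 1"
  shows "measure_pmf.prob (random_graph n p) {E. \<exists>e\<in>all_edges n. e \<notin> E} \<le> (1 - p) * real n ^ 2"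
proof -
  have "{E. \<exists>e\<in>all_edges n. e \<notin> E} = (\<Union>e\<in>all_edges n. {E. {} \<subseteq> E \<and> {e} \<inter> E = {}})" by auto
  then have "measure_pmf.prob (random_graph n p) {E. \<exists>e\<in>all_edges n. e \<notin> E} \<le>
      (\<Sum>e\<in>all_edges n. measure_pmf.prob (random_graph n p) {E. {} \<subseteq> E \<and> {e} \<inter> E = {}})"
    using finite_all_edges by (auto intro!: measure_pmf.finite_measure_subadditive_finite)
  also have "\<dots> = (\<Sum>e\<in>all_edges n. 1 - p)"
  proof (rule sum.cong[OF HOL.refl])
    fix e assume "e \<in> all_edges n"
    then show "measure_pmf.prob (random_graph n p) {E. {} \<subseteq> E \<and> {e} \<inter> E = {}} = 1 - p"
      using assms by (subst prob_random_graph) auto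
  qed
  also have "\<dots> = real (n choose 2) * (1 - p)" by (simp add: card_all_edges)
  also have "\<dots> \<le> real n ^ 2 * (1 - p)"
  proof (intro mult_right_mono)
    have "n choose 2 \<le> n ^ 2"
      using choose_two[of n] by (simp add: power2_eq_square div_le_dividend le_trans[OF div_le_dividend])
    then show "real (n choose 2) \<le> real n ^ 2" by (metis of_nat_le_iff of_nat_power)
  qed (use assms in simp)
  finally show ?thesis by (simp add: mult.commute)
qed

section \<open>Cycles in sparse random graphs\<close>

definition cycle_edges :: "'v list \<Rightarrow> 'v set set" where
  "cycle_edges xs = (\<lambda>i. {xs ! i, xs ! (Suc i mod length xs)}) ` {..<length xs}"

text \<open>Two distinct positions with the same edge would be successors of each other around the
  cycle, which is possible only for length 2.\<close>

lemma card_cycle_edges: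
  assumes "distinct xs" "length xs \<ge> 3"
  shows "card (cycle_edges xs) = length xs"
proof -
  let ?k = "length xs"
  have "inj_on (\<lambda>i. {xs ! i, xs ! (Suc i mod ?k)}) {..<?k}"
  proof (rule inj_onI)
    fix i j assume i: "i \<in> {..<?k}" and j: "j \<in> {..<?k}"
      and eq: "{xs ! i, xs ! (Suc i mod ?k)} = {xs ! j, xs ! (Suc j mod ?k)}"
    have "0 < ?k" using assms(2) by linarith
    then have lt: "Suc i mod ?k < ?k" "Suc j mod ?k < ?k"
      by (simp_all only: mod_less_divisor)
    have "i = j \<or> (i = Suc j mod ?k \<and> Suc i mod ?k = j)"
      using eq i j lt nth_eq_iff_index_eq[OF assms(1)] by (auto simp: doubleton_eq_iff)
    then show "i = j"
      using i j assms(2) by (auto simp: mod_Suc split: if_splits)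
  qed
  then show ?thesis by (simp add: cycle_edges_def card_image)
qed

text \<open>Extending a longest path of the subgraph induced on \<open>U\<close> at its first vertex would close a
  cycle.\<close>

lemma ex_vertex_degree_le_1:
  assumes E: "E \<subseteq> all_edges n" and U: "U \<subseteq> {1..n}" "U \<noteq> {}"
    and acyclic: "\<not> (\<exists>xs. distinct xs \<and> length xs \<ge> 3 \<and> set xs \<subseteq> {1..n} \<and> cycle_edges xs \<subseteq> E)"
  shows "\<exists>v\<in>U. \<forall>u\<in>U. \<forall>w\<in>U. {v, u} \<in> E \<longrightarrow> {v, w} \<in> E \<longrightarrow> u = w"
proof (rule ccontr)
  assume no: "\<not> ?thesis"
  have fin: "finite U" using U finite_subset by blast
  define path where "path xs \<longleftrightarrow> xs \<noteq> [] \<and> distinct xs \<and> set xs \<subseteq> U \<and> successively (\<lambda>u w. {u, w} \<in> E) xs" for xs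
  have "length xs \<le> card U" if "path xs" for xs
    using that card_mono[OF fin] distinct_card unfolding path_def by metis
  moreover obtain v0 where "v0 \<in> U" using U by blast
  then have "path [v0]" by (simp add: path_def)
  ultimately obtain xs where xs: "path xs" "\<And>ys. path ys \<Longrightarrow> length ys \<le> length xs"
    using ex_has_greatest_nat[of path "[v0]" length "Suc (card U)"] by (metis le_imp_less_Suc)
  define v where "v = hd xs"
  have v: "v \<in> U" "v = xs ! 0" "v \<in> set xs" using xs(1) by (auto simp: path_def v_def hd_conv_nth)
  then obtain u w where uw: "u \<in> U" "w \<in> U" "{v, u} \<in> E" "{v, w} \<in> E" "u \<noteq> w" using no by blast
  have on_path: "\<exists>i<length xs. i \<noteq> 0 \<and> xs ! i = y" if y: "y \<in> U" "{v, y} \<in> E" for y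
  proof -
    have "y \<in> set xs"
    proof (rule ccontr)
      assume "y \<notin> set xs"
      then have "path (y # xs)"
        using y xs(1) unfolding path_def v_def by (cases xs) (auto simp: insert_commute)
      then show False using xs(2)[of "y # xs"] by simp
    qed
    then obtain i where i: "i < length xs" "xs ! i = y" by (auto simp: in_set_conv_nth)
    moreover have "y \<noteq> v" using y E edge_iff[of v y n] by auto
    ultimately have "i \<noteq> 0" using v(2) by metis
    then show ?thesis using i by blast
  qed
  obtain i k where ik: "i < length xs" "i \<noteq> 0" "xs ! i = u" "k < length xs" "k \<noteq> 0" "xs ! k = w"
    using on_path[OF uw(1,3)] on_path[OF uw(2,4)] by blast
  \<comment> \<open>At most one of the two neighbours has position 1 on the path; the other one
    closes a cycle of length at least 3.\<close>
  then have "i \<ge> 2 \<or> k \<ge> 2" using uw(5) by (cases "i = 1"; cases "k = 1") auto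
  then obtain j where j: "j < length xs" "j \<ge> 2" "{v, xs ! j} \<in> E"
    using ik uw(3,4) that by metis
  define ys where "ys = take (Suc j) xs"
  have ys: "length ys = Suc j" using j by (simp add: ys_def)
  have "{ys ! k, ys ! (Suc k mod Suc j)} \<in> E" if k: "k \<le> j" for k
  proof (cases "k = j")
    case True
    then show ?thesis using j v ys by (simp add: ys_def insert_commute)
  next
    case False
    then have "{xs ! k, xs ! Suc k} \<in> E"
      using xs(1) j k by (auto simp: path_def successively_conv_nth)
    then show ?thesis using False k j by (simp add: ys_def)
  qed
  then have "cycle_edges ys \<subseteq> E" by (auto simp: cycle_edges_def ys less_Suc_eq_le)
  moreover have "distinct ys" using xs(1) by (simp add: path_def ys_def)
  moreover have "set ys \<subseteq> {1..n}" using xs(1) U set_take_subset[of "Suc j" xs] unfolding path_def ys_def by blast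
  ultimately show False using acyclic ys j by auto
qed

text \<open>Union bound over vertex sequences: at most \<open>n ^ k\<close> of them have length
  \<open>k\<close>, and each closes to a cycle with probability \<open>p ^ k\<close>. One factor
  \<open>p * n\<close> is kept, the others are bounded by 1/2, and 2 is the sum of the whole
  geometric series.\<close>

lemma prob_cycle_le:
  assumes p: "0 \<le> p" "p \<le> 1" and x: "p * real n \<le> 1 / 2"
  shows "measure_pmf.prob (random_graph n p)
    {E. \<exists>xs. distinct xs \<and> length xs \<ge> 3 \<and> set xs \<subseteq> {1..n} \<and> cycle_edges xs \<subseteq> E} \<le> 2 * (p * real n)"
proof -
  let ?M = "random_graph n p"
  define L where "L k = {xs. set xs \<subseteq> {1..n} \<and> length xs = k}" for k
  define D where "D k = {xs \<in> L k. distinct xs}" for k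
  have finL: "finite (L k)" for k unfolding L_def by (rule finite_lists_length_eq) simp
  have cardL: "card (L k) = n ^ k" for k unfolding L_def by (subst card_lists_length_eq) auto
  have finD: "finite (D k)" for k using finL by (simp add: D_def)
  have cardD: "card (D k) \<le> n ^ k" for k unfolding cardL[symmetric] D_def by (intro card_mono finL) auto
  have len: "length xs \<le> n" if "distinct xs" "set xs \<subseteq> {1..n}" for xs :: "nat list"
    using card_mono[OF _ that(2)] distinct_card[OF that(1)] by simp
  have "measure_pmf.prob ?M {E. \<exists>xs. distinct xs \<and> length xs \<ge> 3 \<and> set xs \<subseteq> {1..n} \<and> cycle_edges xs \<subseteq> E}
      \<le> measure_pmf.prob ?M (\<Union>k\<in>{3..n}. \<Union>xs\<in>D k. {E. cycle_edges xs \<subseteq> E \<and> {} \<inter> E = {}})"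
    by (intro measure_pmf.finite_measure_mono) (use len in \<open>fastforce simp: D_def L_def\<close>)+
  also have "\<dots> \<le> (\<Sum>k\<in>{3..n}. measure_pmf.prob ?M (\<Union>xs\<in>D k. {E. cycle_edges xs \<subseteq> E \<and> {} \<inter> E = {}}))"
    by (intro measure_pmf.finite_measure_subadditive_finite) auto
  also have "\<dots> \<le> (\<Sum>k\<in>{3..n}. \<Sum>xs\<in>D k. measure_pmf.prob ?M {E. cycle_edges xs \<subseteq> E \<and> {} \<inter> E = {}})"
    by (intro sum_mono measure_pmf.finite_measure_subadditive_finite finD) auto
  also have "\<dots> = (\<Sum>k\<in>{3..n}. \<Sum>xs\<in>D k. p ^ k)"
  proof (rule sum.cong[OF HOL.refl], rule sum.cong[OF HOL.refl])
    fix k xs assume k: "k \<in> {3..n}" and xs: "xs \<in> D k"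
    have "cycle_edges xs \<subseteq> all_edges n"
    proof -
      have "{xs ! i, xs ! (Suc i mod k)} \<in> all_edges n" if i: "i < k" for i
      proof -
        have "Suc i mod k < k" "Suc i mod k \<noteq> i" using i k by (auto simp: mod_Suc)
        moreover have "length xs = k" "distinct xs" "set xs \<subseteq> {1..n}"
          using xs by (auto simp: D_def L_def)
        ultimately show ?thesis
          unfolding edge_iff using i nth_mem[of i xs] nth_mem[of "Suc i mod k" xs]
          by (metis nth_eq_iff_index_eq subsetD)
      qed
      then show ?thesis using xs by (auto simp: cycle_edges_def D_def L_def)
    qed
    then show "measure_pmf.prob ?M {E. cycle_edges xs \<subseteq> E \<and> {} \<inter> E = {}} = p ^ k"
      using k xs card_cycle_edges[of xs] p by (subst prob_random_graph) (auto simp: D_def L_def)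
  qed
  also have "\<dots> \<le> (\<Sum>k\<in>{3..n}. (p * real n) ^ k)"
  proof (intro sum_mono)
    fix k
    have "real (card (D k)) \<le> real n ^ k" using cardD[of k] by (metis of_nat_le_iff of_nat_power)
    then show "(\<Sum>xs\<in>D k. p ^ k) \<le> (p * real n) ^ k"
      using p by (simp add: power_mult_distrib mult.commute[of _ "p ^ k"] mult_left_mono)
  qed
  also have "\<dots> \<le> (\<Sum>k\<in>{3..n}. p * real n * (1 / 2) ^ (k - 1))"
  proof (intro sum_mono)
    fix k assume "k \<in> {3..n}"
    then have "(p * real n) ^ k = p * real n * (p * real n) ^ (k - 1)" by (cases k) auto
    also have "\<dots> \<le> p * real n * (1 / 2) ^ (k - 1)"
      using p x by (intro mult_left_mono power_mono) auto
    finally show "(p * real n) ^ k \<le> p * real n * (1 / 2) ^ (k - 1)" .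
  qed
  also have "\<dots> = p * real n * (\<Sum>k\<in>{3..n}. (1 / 2) ^ (k - 1))" by (simp add: sum_distrib_left)
  also have "\<dots> \<le> p * real n * 2"
  proof (intro mult_left_mono)
    have "(\<Sum>k\<in>{3..n}. (1 / 2 :: real) ^ (k - 1)) = (\<Sum>k\<in>(\<lambda>k. k - 1) ` {3..n}. (1 / 2) ^ k)"
      by (subst sum.reindex) (auto simp: inj_on_def)
    also have "\<dots> \<le> suminf (\<lambda>k. (1 / 2 :: real) ^ k)"
      by (intro sum_le_suminf summable_geometric) auto
    also have "\<dots> = 2" by (subst suminf_geometric) auto
    finally show "(\<Sum>k\<in>{3..n}. (1 / 2 :: real) ^ (k - 1)) \<le> 2" .
  qed (use p in simp)
  finally show ?thesis by simp
qed

section \<open>Second moment method for induced squares\<close>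

lemma second_moment_bound:
  fixes M :: "'s pmf" and A :: "'i \<Rightarrow> 's set"
  assumes I: "finite I" and \<mu>: "\<mu> = (\<Sum>i\<in>I. measure_pmf.prob M (A i))" "\<mu> > 0"
  shows "measure_pmf.prob M {x. \<forall>i\<in>I. x \<notin> A i} \<le>
    ((\<Sum>i\<in>I. \<Sum>j\<in>I. measure_pmf.prob M (A i \<inter> A j)) - \<mu>\<^sup>2) / \<mu>\<^sup>2"
proof -
  define f :: "'s \<Rightarrow> real" where "f x = (\<Sum>i\<in>I. indicator (A i) x)" for x
  define B where "B = {x. \<forall>i\<in>I. x \<notin> A i}"
  have int: "integrable (measure_pmf M) (indicator C :: 's \<Rightarrow> real)" for C
    by (intro measure_pmf.integrable_const_bound[where B = 1]) (auto simp: indicator_def)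
  have ff: "f x * f x = (\<Sum>i\<in>I. \<Sum>j\<in>I. indicator (A i \<inter> A j) x)" for x
    by (simp add: f_def sum_product indicator_inter_arith)
  have int_f: "integrable (measure_pmf M) f" unfolding f_def by (intro Bochner_Integration.integrable_sum int)
  have int_ff: "integrable (measure_pmf M) (\<lambda>x. f x * f x)"
    unfolding ff by (intro Bochner_Integration.integrable_sum int)
  have E_f: "measure_pmf.expectation M f = \<mu>"
    unfolding f_def \<mu>(1) by (subst Bochner_Integration.integral_sum) (auto intro: int)
  have E_ff: "measure_pmf.expectation M (\<lambda>x. f x * f x) = (\<Sum>i\<in>I. \<Sum>j\<in>I. measure_pmf.prob M (A i \<inter> A j))"
    unfolding ff
    by (subst Bochner_Integration.integral_sum, intro Bochner_Integration.integrable_sum int)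
      (intro sum.cong HOL.refl, subst Bochner_Integration.integral_sum, auto intro: int)
  \<comment> \<open>Chebyshev's inequality for the number \<open>f\<close> of events that occur:
    \<open>f\<close> vanishes on \<open>B\<close>, so its squared deviation from the mean is
    \<open>\<mu>\<^sup>2\<close> there.\<close>
  have "measure_pmf.expectation M (\<lambda>x. \<mu>\<^sup>2 * indicator B x) \<le>
      measure_pmf.expectation M (\<lambda>x. f x * f x - 2 * \<mu> * f x + \<mu>\<^sup>2)"
  proof (rule integral_mono)
    show "integrable (measure_pmf M) (\<lambda>x. \<mu>\<^sup>2 * indicator B x)"
      by (intro integrable_mult_right int)
    show "integrable (measure_pmf M) (\<lambda>x. f x * f x - 2 * \<mu> * f x + \<mu>\<^sup>2)"
      using int_f int_ff by simp
    fix x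
    have "f x * f x - 2 * \<mu> * f x + \<mu>\<^sup>2 = (f x - \<mu>)\<^sup>2" by (simp add: power2_eq_square algebra_simps)
    moreover have "f x = 0" if "x \<in> B" using that by (simp add: f_def B_def)
    ultimately show "\<mu>\<^sup>2 * indicator B x \<le> f x * f x - 2 * \<mu> * f x + \<mu>\<^sup>2"
      by (cases "x \<in> B") auto
  qed
  also have "\<dots> = (\<Sum>i\<in>I. \<Sum>j\<in>I. measure_pmf.prob M (A i \<inter> A j)) - 2 * \<mu> * \<mu> + \<mu>\<^sup>2"
    using int_f int_ff by (simp add: E_f E_ff)
  finally have "\<mu>\<^sup>2 * measure_pmf.prob M B \<le> (\<Sum>i\<in>I. \<Sum>j\<in>I. measure_pmf.prob M (A i \<inter> A j)) - \<mu>\<^sup>2"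
    by (simp add: power2_eq_square)
  then show ?thesis using \<mu>(2) unfolding B_def[symmetric] by (simp add: field_simps)
qed

text \<open>The four corners of a square range over disjoint classes of vertices. Hence the edges and
  non-edges that two squares share are determined by the coordinates on which the squares agree.\<close>

definition square_edges :: "nat \<times> nat \<times> nat \<times> nat \<Rightarrow> nat set set" where
  "square_edges = (\<lambda>(i, j, k, l).
     {{4*i+1, 4*j+2}, {4*j+2, 4*k+3}, {4*k+3, 4*l+4}, {4*l+4, 4*i+1}})"

definition square_nonedges :: "nat \<times> nat \<times> nat \<times> nat \<Rightarrow> nat set set" where
  "square_nonedges = (\<lambda>(i, j, k, l). {{4*i+1, 4*k+3}, {4*j+2, 4*l+4}})"

text \<open>Bounds the factor by which the overlap of two squares increases the probability that both
  occur, where \<open>\<alpha> = 1 / p\<close> and \<open>\<beta> = 1 / (1 - p)\<close>. There is one summand for each set of at least two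
  coordinates on which the squares agree.\<close>

definition overlap_weight :: "real \<Rightarrow> real \<Rightarrow> bool \<Rightarrow> bool \<Rightarrow> bool \<Rightarrow> bool \<Rightarrow> real" where
  "overlap_weight \<alpha> \<beta> a b c d = 1
     + \<alpha> * (of_bool a * of_bool b + of_bool b * of_bool c + of_bool c * of_bool d + of_bool d * of_bool a)
     + \<beta> * (of_bool a * of_bool c + of_bool b * of_bool d)
     + \<alpha>^2 * \<beta> * (of_bool a * of_bool b * of_bool c + of_bool b * of_bool c * of_bool d
         + of_bool c * of_bool d * of_bool a + of_bool d * of_bool a * of_bool b)
     + \<alpha>^4 * \<beta>^2 * (of_bool a * of_bool b * of_bool c * of_bool d)"

text \<open>The product equals the summand that belongs to the set of all coordinates on which the
  squares agree, or 1 if there are fewer than two of them; the other summands are nonnegative. The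
  sum is easier to add up over all squares, because each summand factors over the
  coordinates.\<close>

lemma prod_le_overlap_weight:
  assumes "\<alpha> \<ge> 0" "\<beta> \<ge> 0"
  shows "(if a \<and> b then \<alpha> else 1) * (if b \<and> c then \<alpha> else 1) * (if c \<and> d then \<alpha> else 1) * (if d \<and> a then \<alpha> else 1)
    * ((if a \<and> c then \<beta> else 1) * (if b \<and> d then \<beta> else 1)) \<le> overlap_weight \<alpha> \<beta> a b c d"
proof -
  have "\<alpha>^2 * \<beta> \<ge> 0" using assms by simp
  then show ?thesis
    using assms
    by (cases a; cases b; cases c; cases d)
      (simp_all add: overlap_weight_def power2_eq_square power4_eq_xxxx algebra_simps)
qed

lemma prob_two_squares:
  assumes p: "0 < p" "p < 1" and n: "4 * m \<le> n"
    and lt: "i < m" "j < m" "k < m" "l < m" "i' < m" "j' < m" "k' < m" "l' < m"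
  defines "x \<equiv> (i, j, k, l)" and "y \<equiv> (i', j', k', l')"
  shows "measure_pmf.prob (random_graph n p)
      {E. square_edges x \<union> square_edges y \<subseteq> E \<and> (square_nonedges x \<union> square_nonedges y) \<inter> E = {}}
    \<le> (p ^ 4 * (1 - p)\<^sup>2)\<^sup>2 * overlap_weight (1 / p) (1 / (1 - p)) (i = i') (j = j') (k = k') (l = l')"
proof -
  define a a' b b' c c' d d' where "a = 4 * i + 1" and "a' = 4 * i' + 1" and "b = 4 * j + 2" and "b' = 4 * j' + 2"
    and "c = 4 * k + 3" and "c' = 4 * k' + 3" and "d = 4 * l + 4" and "d' = 4 * l' + 4"
  note defs = a_def a'_def b_def b'_def c_def c'_def d_def d'_def
  have ne: "{a, a'} \<inter> {b, b'} = {}" "{a, a'} \<inter> {c, c'} = {}" "{a, a'} \<inter> {d, d'} = {}"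
    "{b, b'} \<inter> {c, c'} = {}" "{b, b'} \<inter> {d, d'} = {}" "{c, c'} \<inter> {d, d'} = {}"
  proof -
    have "a mod 4 = 1" "a' mod 4 = 1" "b mod 4 = 2" "b' mod 4 = 2" "c mod 4 = 3" "c' mod 4 = 3" "d mod 4 = 0" "d' mod 4 = 0"
      unfolding defs by presburger+
    then show "{a, a'} \<inter> {b, b'} = {}" "{a, a'} \<inter> {c, c'} = {}" "{a, a'} \<inter> {d, d'} = {}"
      "{b, b'} \<inter> {c, c'} = {}" "{b, b'} \<inter> {d, d'} = {}" "{c, c'} \<inter> {d, d'} = {}"
      by force+
  qed
  \<comment> \<open>Each side and each diagonal has a class of its own, and the residues of the end
    points keep the classes disjoint. A class contains one pair from either square, and the two
    pairs coincide exactly if the squares agree on both coordinates involved.\<close>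
  define e1 e2 e3 e4 f1 f2 where "e1 = {{a, b}, {a', b'}}" and "e2 = {{b, c}, {b', c'}}" and "e3 = {{c, d}, {c', d'}}"
    and "e4 = {{d, a}, {d', a'}}" and "f1 = {{a, c}, {a', c'}}" and "f2 = {{b, d}, {b', d'}}"
  note sets = e1_def e2_def e3_def e4_def f1_def f2_def
  have edges: "square_edges x \<union> square_edges y = e1 \<union> e2 \<union> e3 \<union> e4"
    by (auto simp: x_def y_def square_edges_def sets defs)
  have nonedges: "square_nonedges x \<union> square_nonedges y = f1 \<union> f2"
    by (auto simp: x_def y_def square_nonedges_def sets defs)
  have disj: "e1 \<inter> e2 = {}" "e1 \<inter> e3 = {}" "e1 \<inter> e4 = {}" "e2 \<inter> e3 = {}" "e2 \<inter> e4 = {}" "e3 \<inter> e4 = {}"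
    "f1 \<inter> f2 = {}" "e1 \<inter> f1 = {}" "e2 \<inter> f1 = {}" "e3 \<inter> f1 = {}" "e4 \<inter> f1 = {}"
    "e1 \<inter> f2 = {}" "e2 \<inter> f2 = {}" "e3 \<inter> f2 = {}" "e4 \<inter> f2 = {}"
    using ne unfolding sets by (simp_all add: doubleton_eq_iff)
  have card: "card e1 = (if i = i' \<and> j = j' then 1 else 2)" "card e2 = (if j = j' \<and> k = k' then 1 else 2)"
    "card e3 = (if k = k' \<and> l = l' then 1 else 2)" "card e4 = (if l = l' \<and> i = i' then 1 else 2)"
    "card f1 = (if i = i' \<and> k = k' then 1 else 2)" "card f2 = (if j = j' \<and> l = l' then 1 else 2)"
  proof -
    have two: "card {u, w} = (if u = w then 1 else 2)" for u w :: "nat set" by simp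
    have "{a, b} = {a', b'} \<longleftrightarrow> i = i' \<and> j = j'" "{b, c} = {b', c'} \<longleftrightarrow> j = j' \<and> k = k'"
      "{c, d} = {c', d'} \<longleftrightarrow> k = k' \<and> l = l'" "{d, a} = {d', a'} \<longleftrightarrow> l = l' \<and> i = i'"
      "{a, c} = {a', c'} \<longleftrightarrow> i = i' \<and> k = k'" "{b, d} = {b', d'} \<longleftrightarrow> j = j' \<and> l = l'"
      using ne unfolding doubleton_eq_iff by (auto simp: defs)
    then show "card e1 = (if i = i' \<and> j = j' then 1 else 2)" "card e2 = (if j = j' \<and> k = k' then 1 else 2)"
    "card e3 = (if k = k' \<and> l = l' then 1 else 2)" "card e4 = (if l = l' \<and> i = i' then 1 else 2)"
    "card f1 = (if i = i' \<and> k = k' then 1 else 2)" "card f2 = (if j = j' \<and> l = l' then 1 else 2)"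
      unfolding sets two by simp_all
  qed
  have fin: "finite e1" "finite e2" "finite e3" "finite e4" "finite f1" "finite f2" by (simp_all add: sets)
  have card_e: "card (e1 \<union> e2 \<union> e3 \<union> e4) = card e1 + card e2 + card e3 + card e4"
    using disj fin by (simp add: card_Un_disjoint Int_Un_distrib2)
  have card_f: "card (f1 \<union> f2) = card f1 + card f2" using disj fin by (simp add: card_Un_disjoint)
  have vert: "{a, a', b, b', c, c', d, d'} \<subseteq> {1..n}" using lt n by (auto simp: defs)
  have sub: "e1 \<union> e2 \<union> e3 \<union> e4 \<subseteq> all_edges n" "f1 \<union> f2 \<subseteq> all_edges n"
    using vert ne unfolding sets by (auto simp: edge_iff)
  have ef: "(e1 \<union> e2 \<union> e3 \<union> e4) \<inter> (f1 \<union> f2) = {}"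
    by (simp add: Int_Un_distrib Int_Un_distrib2 disj)
  have "measure_pmf.prob (random_graph n p)
      {E. square_edges x \<union> square_edges y \<subseteq> E \<and> (square_nonedges x \<union> square_nonedges y) \<inter> E = {}}
    = p ^ (card e1 + card e2 + card e3 + card e4) * (1 - p) ^ (card f1 + card f2)"
    unfolding edges nonedges card_e[symmetric] card_f[symmetric]
    using p by (intro prob_random_graph[OF _ _ sub ef]) auto
  also have "\<dots> = (p ^ card e1 * p ^ card e2 * p ^ card e3 * p ^ card e4) * ((1 - p) ^ card f1 * (1 - p) ^ card f2)"
    by (simp add: power_add)
  also have "\<dots> = (p ^ 4 * (1 - p)\<^sup>2)\<^sup>2 *
      ((if i = i' \<and> j = j' then 1 / p else 1) * (if j = j' \<and> k = k' then 1 / p else 1)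
       * (if k = k' \<and> l = l' then 1 / p else 1) * (if l = l' \<and> i = i' then 1 / p else 1)
       * ((if i = i' \<and> k = k' then 1 / (1 - p) else 1) * (if j = j' \<and> l = l' then 1 / (1 - p) else 1)))"
  proof -
    \<comment> \<open>A coincidence leaves one factor \<open>q\<close> in place of two, which is
      recorded as the factor \<open>1 / q\<close> on \<open>q^2\<close>.\<close>
    have pow: "q ^ card e = q^2 * (if Q then 1 / q else 1)"
      if "card e = (if Q then 1 else 2)" "q \<noteq> 0" for q :: real and e :: "nat set set" and Q
      using that by (simp add: power2_eq_square)
    have p': "p \<noteq> 0" "1 - p \<noteq> 0" using p by auto
    show ?thesis
      unfolding pow[OF card(1) p'(1)] pow[OF card(2) p'(1)] pow[OF card(3) p'(1)] pow[OF card(4) p'(1)]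
        pow[OF card(5) p'(2)] pow[OF card(6) p'(2)]
      by (simp add: power2_eq_square power4_eq_xxxx)
  qed
  also have "\<dots> \<le> (p ^ 4 * (1 - p)\<^sup>2)\<^sup>2 * overlap_weight (1 / p) (1 / (1 - p)) (i = i') (j = j') (k = k') (l = l')"
    using p by (intro mult_left_mono prod_le_overlap_weight) auto
  finally show ?thesis .
qed

lemma sum_product4:
  fixes f g h e :: "nat \<Rightarrow> real"
  shows "(\<Sum>(i, j, k, l)\<in>A \<times> B \<times> C \<times> D. f i * g j * h k * e l) = sum f A * sum g B * sum h C * sum e D"
proof -
  have "(\<Sum>(i, j, k, l)\<in>A \<times> B \<times> C \<times> D. f i * g j * h k * e l) =
      (\<Sum>i\<in>A. \<Sum>j\<in>B. \<Sum>k\<in>C. \<Sum>l\<in>D. f i * g j * h k * e l)"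
    by (simp add: sum.cartesian_product)
  then show ?thesis by (simp add: mult.assoc flip: sum_distrib_left sum_distrib_right)
qed

text \<open>Prescribing agreement on \<open>r\<close> of the coordinates leaves
  \<open>m ^ (4 - r)\<close> squares.\<close>

lemma sum_overlap_weight:
  assumes "i < m" "j < m" "k < m" "l < m"
  shows "(\<Sum>(i', j', k', l')\<in>{..<m} \<times> {..<m} \<times> {..<m} \<times> {..<m}.
      overlap_weight \<alpha> \<beta> (i = i') (j = j') (k = k') (l = l'))
    = real m ^ 4 + (4 * \<alpha> + 2 * \<beta>) * real m ^ 2 + 4 * \<alpha>^2 * \<beta> * real m + \<alpha>^4 * \<beta>^2"
proof -
  let ?I = "{..<m} \<times> {..<m} \<times> {..<m} \<times> {..<m}"
  \<comment> \<open>Each summand becomes a product of functions of one coordinate,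
    \<open>\<delta>\<close> where agreement is prescribed and the constant \<open>\<o>\<close>
    elsewhere, so that \<open>sum_product4\<close> applies.\<close>
  define \<delta> :: "nat \<Rightarrow> nat \<Rightarrow> real" where "\<delta> i i' = of_bool (i = i')" for i i'
  define \<o> :: "nat \<Rightarrow> real" where "\<o> = (\<lambda>_. 1)"
  have s: "sum (\<delta> r) {..<m} = 1" if "r < m" for r
    using that by (simp add: \<delta>_def of_bool_def)
  have o: "sum \<o> {..<m} = real m" by (simp add: \<o>_def)
  note ss = s[OF assms(1)] s[OF assms(2)] s[OF assms(3)] s[OF assms(4)] o
  have "overlap_weight \<alpha> \<beta> (i = i') (j = j') (k = k') (l = l') =
      \<o> i' * \<o> j' * \<o> k' * \<o> l'
      + \<alpha> * (\<delta> i i' * \<delta> j j' * \<o> k' * \<o> l') + \<alpha> * (\<o> i' * \<delta> j j' * \<delta> k k' * \<o> l')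
      + \<alpha> * (\<o> i' * \<o> j' * \<delta> k k' * \<delta> l l') + \<alpha> * (\<delta> i i' * \<o> j' * \<o> k' * \<delta> l l')
      + \<beta> * (\<delta> i i' * \<o> j' * \<delta> k k' * \<o> l') + \<beta> * (\<o> i' * \<delta> j j' * \<o> k' * \<delta> l l')
      + \<alpha>^2 * \<beta> * (\<delta> i i' * \<delta> j j' * \<delta> k k' * \<o> l') + \<alpha>^2 * \<beta> * (\<o> i' * \<delta> j j' * \<delta> k k' * \<delta> l l')
      + \<alpha>^2 * \<beta> * (\<delta> i i' * \<o> j' * \<delta> k k' * \<delta> l l') + \<alpha>^2 * \<beta> * (\<delta> i i' * \<delta> j j' * \<o> k' * \<delta> l l')
      + \<alpha>^4 * \<beta>^2 * (\<delta> i i' * \<delta> j j' * \<delta> k k' * \<delta> l l')" for i' j' k' l'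
    by (simp add: overlap_weight_def \<delta>_def \<o>_def distrib_left mult.commute mult.left_commute)
  then show ?thesis
    by (simp add: split_def sum.distrib sum_distrib_left[symmetric] sum_product4[unfolded split_def] ss)
      (simp add: power2_eq_square power4_eq_xxxx algebra_simps)
qed

text \<open>The sum of the joint probabilities over the second square has a bound that does not
  depend on the first. Its leading term \<open>m ^ 4\<close> reproduces \<open>\<mu>\<^sup>2\<close>
  exactly, and the remainder \<open>T\<close>, divided by \<open>m ^ 4\<close>, bounds the variance
  over the squared mean.\<close>

lemma prob_no_square_le:
  assumes p: "0 < p" "p < 1" and m: "0 < m" "4 * m \<le> n"
  defines "I \<equiv> {..<m} \<times> {..<m} \<times> {..<m} \<times> {..<m}"
  shows "measure_pmf.prob (random_graph n p)
      {E. \<forall>x\<in>I. \<not> (square_edges x \<subseteq> E \<and> square_nonedges x \<inter> E = {})}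
    \<le> (4 / p + 2 / (1 - p)) / real m ^ 2 + 4 / (p^2 * (1 - p) * real m ^ 3) + 1 / (p^4 * (1 - p)^2 * real m ^ 4)"
proof -
  let ?M = "random_graph n p"
  define A where "A x = {E. square_edges x \<subseteq> E \<and> square_nonedges x \<inter> E = {}}" for x
  define q where "q = p ^ 4 * (1 - p)\<^sup>2"
  define T where "T = (4 / p + 2 / (1 - p)) * real m ^ 2 + 4 / (p^2 * (1 - p)) * real m + 1 / (p^4 * (1 - p)^2)"
  have q: "q > 0" using p by (simp add: q_def)
  have card_I: "card I = m ^ 4" by (simp add: I_def power4_eq_xxxx)
  have A_Int: "A x \<inter> A y =
      {E. square_edges x \<union> square_edges y \<subseteq> E \<and> (square_nonedges x \<union> square_nonedges y) \<inter> E = {}}" for x y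
    by (auto simp: A_def)
  have prob_A: "measure_pmf.prob ?M (A x) = q" if x_I: "x \<in> I" for x
  proof -
    obtain i j k l where x: "x = (i, j, k, l)" "i < m" "j < m" "k < m" "l < m"
      using x_I by (auto simp: I_def)
    have ne: "4*u+1 \<noteq> 4*w+2" "4*u+1 \<noteq> 4*w+3" "4*u+1 \<noteq> 4*w+4" "4*u+2 \<noteq> 4*w+3" "4*u+2 \<noteq> 4*w+4" "4*u+3 \<noteq> 4*w+4"
      for u w :: nat by presburger+
    have "card (square_edges x) = 4" "card (square_nonedges x) = 2" "square_edges x \<inter> square_nonedges x = {}"
      using ne ne[symmetric] by (simp_all add: x(1) square_edges_def square_nonedges_def doubleton_eq_iff)
    moreover have "square_edges x \<subseteq> all_edges n" "square_nonedges x \<subseteq> all_edges n"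
      using x m ne ne[symmetric] by (simp_all add: square_edges_def square_nonedges_def edge_iff)
    ultimately show ?thesis
      unfolding A_def q_def using p by (subst prob_random_graph) auto
  qed
  define \<mu> where "\<mu> = (\<Sum>x\<in>I. measure_pmf.prob ?M (A x))"
  have \<mu>: "\<mu> = real m ^ 4 * q" using prob_A card_I by (simp add: \<mu>_def)
  then have "\<mu> > 0" using q m by simp
  have row: "(\<Sum>y\<in>I. measure_pmf.prob ?M (A x \<inter> A y)) \<le> q\<^sup>2 * (real m ^ 4 + T)" if x_I: "x \<in> I" for x
  proof -
    obtain i j k l where x: "x = (i, j, k, l)" "i < m" "j < m" "k < m" "l < m"
      using x_I by (auto simp: I_def)
    have "(\<Sum>y\<in>I. measure_pmf.prob ?M (A x \<inter> A y)) \<le>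
        (\<Sum>(i', j', k', l')\<in>I. q\<^sup>2 * overlap_weight (1 / p) (1 / (1 - p)) (i = i') (j = j') (k = k') (l = l'))"
    proof (rule sum_mono)
      fix y assume "y \<in> I"
      then obtain i' j' k' l' where y: "y = (i', j', k', l')" "i' < m" "j' < m" "k' < m" "l' < m"
        by (auto simp: I_def)
      show "measure_pmf.prob ?M (A x \<inter> A y) \<le>
          (case y of (i', j', k', l') \<Rightarrow> q\<^sup>2 * overlap_weight (1 / p) (1 / (1 - p)) (i = i') (j = j') (k = k') (l = l'))"
        using prob_two_squares[OF p m(2) x(2-5) y(2-5)] by (simp add: A_Int x(1) y(1) q_def)
    qed
    also have "\<dots> = q\<^sup>2 * (\<Sum>(i', j', k', l')\<in>I. overlap_weight (1 / p) (1 / (1 - p)) (i = i') (j = j') (k = k') (l = l'))"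
      by (simp add: sum_distrib_left split_def)
    also have "\<dots> = q\<^sup>2 * (real m ^ 4 + T)"
      unfolding I_def sum_overlap_weight[OF x(2-5)] by (simp add: T_def power_one_over)
    finally show ?thesis .
  qed
  have "(\<Sum>x\<in>I. \<Sum>y\<in>I. measure_pmf.prob ?M (A x \<inter> A y)) \<le> (\<Sum>x\<in>I. q\<^sup>2 * (real m ^ 4 + T))"
    by (rule sum_mono) (rule row)
  also have "\<dots> = \<mu>\<^sup>2 + real m ^ 4 * q\<^sup>2 * T"
    by (simp add: card_I \<mu>) (simp add: power2_eq_square algebra_simps)
  finally have "((\<Sum>x\<in>I. \<Sum>y\<in>I. measure_pmf.prob ?M (A x \<inter> A y)) - \<mu>\<^sup>2) / \<mu>\<^sup>2 \<le> (real m ^ 4 * q\<^sup>2 * T) / \<mu>\<^sup>2"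
    by (intro divide_right_mono) auto
  also have "\<dots> = T / real m ^ 4"
    using q m by (simp add: \<mu> power2_eq_square)
  also have "\<dots> = (4 / p + 2 / (1 - p)) / real m ^ 2 + 4 / (p^2 * (1 - p) * real m ^ 3) + 1 / (p^4 * (1 - p)^2 * real m ^ 4)"
    using m by (simp add: T_def add_divide_distrib power2_eq_square power3_eq_cube power4_eq_xxxx)
  finally have "((\<Sum>x\<in>I. \<Sum>y\<in>I. measure_pmf.prob ?M (A x \<inter> A y)) - \<mu>\<^sup>2) / \<mu>\<^sup>2 \<le> \<dots>" .
  moreover have "measure_pmf.prob ?M {E. \<forall>x\<in>I. E \<notin> A x} \<le>
      ((\<Sum>x\<in>I. \<Sum>y\<in>I. measure_pmf.prob ?M (A x \<inter> A y)) - \<mu>\<^sup>2) / \<mu>\<^sup>2"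
    by (rule second_moment_bound[OF _ \<mu>_def \<open>\<mu> > 0\<close>]) (simp add: I_def)
  ultimately show ?thesis by (simp add: A_def)
qed

text \<open>One of \<open>p\<close> and \<open>1 - p\<close> is at least 1/2. It is replaced by 1/2
  in the last two denominators; these then contain \<open>p * m\<close> or
  \<open>(1 - p) * m\<^sup>2\<close> up to a constant, and the surplus factors, which are at least
  1, are dropped. Adding the bounds of both cases gives 16 = 4 + 4 * 2 + 4 and 34 = 2 + 4 * 4 +
  16.\<close>

lemma no_square_bound_le:
  assumes p: "0 < p" "p < (1::real)" and m: "m \<ge> (1::real)" and uv: "p * m \<ge> 1" "(1 - p) * m\<^sup>2 \<ge> 1"
  shows "(4 / p + 2 / (1 - p)) / m ^ 2 + 4 / (p^2 * (1 - p) * m ^ 3) + 1 / (p^4 * (1 - p)^2 * m ^ 4)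
    \<le> 16 / (p * m) + 34 / ((1 - p) * m\<^sup>2)"
proof -
  define u v where "u = p * m" and "v = (1 - p) * m\<^sup>2"
  have pos: "u \<ge> 1" "v \<ge> 1" using uv by (auto simp: u_def v_def)
  have inv: "2 / u \<ge> 0" "4 / u \<ge> 0" "4 / v \<ge> 0" "16 / v \<ge> 0"
    using pos by auto
  have 1: "4 / p / m\<^sup>2 \<le> 4 * (1 / u)"
    using p m by (simp add: u_def power2_eq_square divide_simps mult_le_cancel_left1)
  have 2: "2 / (1 - p) / m\<^sup>2 = 2 * (1 / v)" by (simp add: v_def)
  have half: "1 / (p^2 * (1 - p) * m ^ 3) \<le> 2 / u + 4 / v \<and>
      1 / (p^4 * (1 - p)^2 * m ^ 4) \<le> 4 / u + 16 / v"
  proof (cases "p \<le> 1 / 2")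
    case True
    have "u * (1 / 2) \<le> u\<^sup>2 * ((1 - p) * m)"
      using pos m True mult_mono[of "1 / 2" "1 - p" 1 m] by (intro mult_mono self_le_power) auto
    also have "\<dots> = p^2 * (1 - p) * m ^ 3" by (simp add: u_def power2_eq_square power3_eq_cube)
    finally have "1 / (p^2 * (1 - p) * m ^ 3) \<le> 1 / (u * (1 / 2))"
      using pos by (intro divide_left_mono) auto
    then have 3: "1 / (p^2 * (1 - p) * m ^ 3) \<le> 2 / u" by simp
    have "u * (1 / 4) \<le> u ^ 4 * (1 - p)\<^sup>2"
      using pos True power_mono[of "1 / 2" "1 - p" 2]
      by (intro mult_mono self_le_power) (auto simp: power_divide)
    then have "u * (1 / 4) \<le> p^4 * (1 - p)^2 * m ^ 4" by (simp add: u_def power_mult_distrib mult_ac)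
    then have "1 / (p^4 * (1 - p)^2 * m ^ 4) \<le> 1 / (u * (1 / 4))"
      using pos by (intro divide_left_mono) auto
    then have 4: "1 / (p^4 * (1 - p)^2 * m ^ 4) \<le> 4 / u" by simp
    show ?thesis by (intro conjI add_increasing2 3 4 inv)
  next
    case False
    have "1 / 4 * v \<le> p\<^sup>2 * (v * m)"
      using pos m False power_mono[of "1 / 2" p 2] mult_mono[of v v 1 m]
      by (intro mult_mono) (auto simp: power_divide)
    also have "\<dots> = p^2 * (1 - p) * m ^ 3" by (simp add: v_def power2_eq_square power3_eq_cube)
    finally have "1 / (p^2 * (1 - p) * m ^ 3) \<le> 1 / (1 / 4 * v)"
      using pos by (intro divide_left_mono) auto
    then have 3: "1 / (p^2 * (1 - p) * m ^ 3) \<le> 4 / v" by simp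
    have "1 / 16 * v \<le> p ^ 4 * v\<^sup>2"
      using pos False power_mono[of "1 / 2" p 4]
      by (intro mult_mono self_le_power) (auto simp: power_divide)
    then have "1 / 16 * v \<le> p^4 * (1 - p)^2 * m ^ 4"
      by (simp add: v_def power_mult_distrib mult_ac flip: power_mult)
    then have "1 / (p^4 * (1 - p)^2 * m ^ 4) \<le> 1 / (1 / 16 * v)"
      using pos by (intro divide_left_mono) auto
    then have 4: "1 / (p^4 * (1 - p)^2 * m ^ 4) \<le> 16 / v" by simp
    show ?thesis by (intro conjI add_increasing 3 4 inv)
  qed
  have "4 / (p^2 * (1 - p) * m ^ 3) = 4 * (1 / (p^2 * (1 - p) * m ^ 3))" by simp
  then show ?thesis
    using 1 2 half by (simp add: add_divide_distrib flip: u_def v_def)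
qed

theorem theorem1:
  fixes G :: "nat \<Rightarrow> ('a, 'b) monoid_scheme" and p :: "nat \<Rightarrow> real"
  assumes "\<And>i. i \<ge> 1 \<Longrightarrow> group (G i)"
    and "\<And>i. i \<ge> 1 \<Longrightarrow> finite (carrier (G i))"
    and "\<And>i. i \<ge> 1 \<Longrightarrow> carrier (G i) \<noteq> {\<one>\<^bsub>G i\<^esub>}"
    and "\<And>n. n \<ge> 1 \<Longrightarrow> 0 < p n \<and> p n < 1"
  shows
    "((\<lambda>n. (1 - p n) * real n ^ 2) \<longlonglongrightarrow> 0 \<longrightarrow>
        asymptotically_almost_surely p (\<lambda>n E. finite (carrier (graph_product {1..n} E G)))) \<and>
     ((\<lambda>n. p n * real n) \<longlonglongrightarrow> 0 \<longrightarrow>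
        asymptotically_almost_surely p (\<lambda>n E. hyperbolic_group (graph_product {1..n} E G))) \<and>
     (filterlim (\<lambda>n. p n * real n) at_top sequentially \<and>
      filterlim (\<lambda>n. (1 - p n) * real n ^ 2) at_top sequentially \<longrightarrow>
        asymptotically_almost_surely p (\<lambda>n E. \<not> hyperbolic_group (graph_product {1..n} E G)))"
proof (intro conjI impI)
  have vertex_groups: "vertex_groups {1..n} G" for n
    by (rule vertex_groups.intro) (use assms(1) in simp)
  have p_le: "0 \<le> p n" "p n \<le> 1" if "n \<ge> 1" for n
    using assms(4)[OF that] by auto
  have irrefl: "{u, u} \<notin> E" if "E \<subseteq> all_edges n" for E n u
    using that edge_iff[of u u n] by blast
  {
    assume lim: "(\<lambda>n. (1 - p n) * real n ^ 2) \<longlonglongrightarrow> 0"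
    show "asymptotically_almost_surely p (\<lambda>n E. finite (carrier (graph_product {1..n} E G)))"
    proof (rule aas_if_prob_tendsto_0[OF _ _ lim])
      show "\<forall>\<^sub>F n in sequentially. measure_pmf.prob (random_graph n (p n)) {E. \<exists>e\<in>all_edges n. e \<notin> E}
          \<le> (1 - p n) * real n ^ 2"
        using eventually_ge_at_top[of 1]
        by (rule eventually_mono) (intro prob_not_complete_le p_le)
    next
      fix n E assume "\<not> (\<exists>e\<in>all_edges n. e \<notin> E)"
      then have "{v, w} \<in> E" if "v \<in> {1..n}" "w \<in> {1..n}" "v \<noteq> w" for v w
        using that edge_iff by blast
      then show "finite (carrier (graph_product {1..n} E G))"
        using assms(2) by (intro vertex_groups.finite_if_complete[OF vertex_groups]) auto
    qed
  next
    assume lim: "(\<lambda>n. p n * real n) \<longlonglongrightarrow> 0"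
    let ?B = "\<lambda>n E. \<exists>xs. distinct xs \<and> length xs \<ge> 3 \<and> set xs \<subseteq> {1..n} \<and> cycle_edges xs \<subseteq> E"
    show "asymptotically_almost_surely p (\<lambda>n E. hyperbolic_group (graph_product {1..n} E G))"
    proof (rule aas_if_prob_tendsto_0[where B = ?B and r = "\<lambda>n. 2 * (p n * real n)"])
      show "(\<lambda>n. 2 * (p n * real n)) \<longlonglongrightarrow> 0" using tendsto_mult_right_zero[OF lim] .
      have "\<forall>\<^sub>F n in sequentially. p n * real n < 1 / 2" using order_tendstoD(2)[OF lim, of "1 / 2"] by simp
      then show "\<forall>\<^sub>F n in sequentially. measure_pmf.prob (random_graph n (p n)) {E. ?B n E} \<le> 2 * (p n * real n)"
        using eventually_ge_at_top[of 1]
        by eventually_elim (intro prob_cycle_le p_le less_imp_le[of "p _ * real _"])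
    next
      fix n E assume E: "E \<subseteq> all_edges n" and acyclic: "\<not> ?B n E"
      interpret vertex_groups "{1..n}" E G by (rule vertex_groups)
      have "\<exists>N \<phi> C. nf_system {1..n} E G {1..n} N \<phi> C"
        using ex_vertex_degree_le_1[OF E _ _ acyclic] by (intro ex_nf_system irrefl[OF E]) auto
      then show "hyperbolic_group (graph_product {1..n} E G)"
        using hyperbolic_if_nf_system assms(2) by auto
    qed
  next
    assume "filterlim (\<lambda>n. p n * real n) at_top sequentially \<and>
      filterlim (\<lambda>n. (1 - p n) * real n ^ 2) at_top sequentially"
    then have lim1: "filterlim (\<lambda>n. p n * real n) at_top sequentially"
      and lim2: "filterlim (\<lambda>n. (1 - p n) * real n ^ 2) at_top sequentially" by auto
    let ?I = "\<lambda>m. {..<m} \<times> {..<m} \<times> {..<m} \<times> {..<m}"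
    let ?B = "\<lambda>n E. \<forall>x\<in>?I (n div 4). \<not> (square_edges x \<subseteq> E \<and> square_nonedges x \<inter> E = {})"
    \<comment> \<open>For \<open>m = n div 4\<close> and \<open>n \<ge> 4\<close> one has
      \<open>n \<le> 8 * m\<close>. Passing from \<open>m\<close> to \<open>n\<close> thus costs a
      factor 8 in the first and 64 in the second summand: 128 = 16 * 8 and 2176 = 34 * 64. The lower
      bounds 8 and 64 below ensure that \<open>p n * m\<close> and
      \<open>(1 - p n) * m\<^sup>2\<close> are at least 1.\<close>
    let ?r = "\<lambda>n. 128 / (p n * real n) + 2176 / ((1 - p n) * real n ^ 2)"
    show "asymptotically_almost_surely p (\<lambda>n E. \<not> hyperbolic_group (graph_product {1..n} E G))"
    proof (rule aas_if_prob_tendsto_0[where B = ?B and r = ?r])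
      have "?r \<longlonglongrightarrow> 0 + 0"
        by (intro tendsto_add real_tendsto_divide_at_top[OF tendsto_const] lim1 lim2)
      then show "?r \<longlonglongrightarrow> 0" by simp
      have "\<forall>\<^sub>F n in sequentially. 8 \<le> p n * real n" "\<forall>\<^sub>F n in sequentially. 64 \<le> (1 - p n) * real n ^ 2"
        using lim1 lim2 by (auto simp: filterlim_at_top)
      then show "\<forall>\<^sub>F n in sequentially. measure_pmf.prob (random_graph n (p n)) {E. ?B n E} \<le> ?r n"
        using eventually_ge_at_top[of 4]
      proof eventually_elim
        fix n assume pn: "8 \<le> p n * real n" "64 \<le> (1 - p n) * real n ^ 2" and n: "4 \<le> n"
        define m where "m = n div 4"
        have p: "0 < p n" "p n < 1" using assms(4)[of n] n by auto
        have m: "0 < m" "4 * m \<le> n" using n by (auto simp: m_def)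
        have "n \<le> 8 * m" using n unfolding m_def by presburger
        then have nm: "real n / 8 \<le> real m" by linarith
        have u: "p n * real n / 8 \<le> p n * real m"
          using mult_left_mono[OF nm, of "p n"] p by simp
        have v: "(1 - p n) * real n ^ 2 / 64 \<le> (1 - p n) * real m ^ 2"
          using mult_left_mono[OF power_mono[OF nm, of 2], of "1 - p n"] p by (simp add: power_divide)
        have "measure_pmf.prob (random_graph n (p n)) {E. ?B n E} \<le>
            16 / (p n * real m) + 34 / ((1 - p n) * (real m)\<^sup>2)"
          using prob_no_square_le[OF p m] no_square_bound_le[OF p, of "real m"] m u v pn
          by (simp add: m_def)
        also have "16 / (p n * real m) \<le> 16 / (p n * real n / 8)"
          using u pn p m by (intro divide_left_mono mult_pos_pos) auto
        also have "34 / ((1 - p n) * (real m)\<^sup>2) \<le> 34 / ((1 - p n) * real n ^ 2 / 64)"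
          using v pn p m n by (intro divide_left_mono mult_pos_pos) auto
        finally show "measure_pmf.prob (random_graph n (p n)) {E. ?B n E} \<le> ?r n" by simp
      qed
    next
      fix n E assume E: "E \<subseteq> all_edges n" and "\<not> ?B n E"
      then obtain i j k l where lt: "i < n div 4" "j < n div 4" "k < n div 4" "l < n div 4"
        and sq: "square_edges (i, j, k, l) \<subseteq> E" "square_nonedges (i, j, k, l) \<inter> E = {}" by auto
      interpret vertex_groups "{1..n}" E G by (rule vertex_groups)
      have corners: "4 * i + 1 \<in> {1..n}" "4 * j + 2 \<in> {1..n}" "4 * k + 3 \<in> {1..n}" "4 * l + 4 \<in> {1..n}"
        using lt by auto
      have "4 * i + 1 \<noteq> 4 * k + 3" "4 * j + 2 \<noteq> 4 * l + 4" by presburger+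
      then show "\<not> hyperbolic_group (graph_product {1..n} E G)"
        using assms(3) sq
        by (intro not_hyperbolic_if_induced_square[OF irrefl[OF E] _ corners])
          (auto simp: square_edges_def square_nonedges_def)
    qed
  }
qed

end
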